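(* Let $m\ge 2$ be an integer, let $\nu=(\nu_1,\dots,\nu_{m-1})\in\mathbb{C}^{m-1}$ with $\Re(\nu_j)>0$ for all $j$, and put $k_j=m\nu_j+m-j$ for $1\le j\le m-1$. Let $T(k)$ be the complex Dunkl operator with parameters $k_1,\dots,k_{m-1}$ and let $V_m$ be the operator on $\mathcal{E}(U)$ given by $$V_m(f)=\sum_{j=1}^{m}A_j\circ\mathcal{R}_{\nu,m}\circ I^{m-j}\circ p_j(f),$$ where $U$, $\mathcal{E}(U)$, $T(k)$, $p_j$, $I$, $A_j$ and $\mathcal{R}_{\nu,m}$ are as defined in the context. Then the following intertwining relation holds on $\mathcal{E}(U)$: $$T(k)\circ V_m=V_m\circ\frac{d}{dx}.$$
   Context: Let $m\ge2$, $\varepsilon=e^{2i\pi/m}$, and $U=\bigcup_{j=1}^m\varepsilon^j\mathbb{R}\subset\mathbb{C}$. $\mathcal{E}(U)$ is the space of $C^\infty$ complex-valued functions on $U$, where $\frac{d}{dx}$ is the derivative along $U$: $f'(x)=\lim_{y\to x,\,y\in U\setminus\{x\}}\frac{f(y)-f(x)}{y-x}$ (complex difference quotient; in particular the derivatives at $0$ along the different lines of $U$ agree). A function $f:U\to\mathbb{C}$ is of type $j$ if $f(\varepsilon x)=\varepsilon^jf(x)$ for all $x\in U$ (so type depends only on $j$ mod $m$); $\mathcal{E}_j(U)$ is the subspace of functions of type $j$ in $\mathcal{E}(U)$. For $1\le i\le m$ let $$p_i(f)(x)=\frac1m\sum_{j=0}^{m-1}\varepsilon^{-ij}f(\varepsilon^jx).$$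 The complex Dunkl operator with parameters $k_1,\dots,k_{m-1}\in\mathbb{C}$ is $$T(k)f(x)=\frac{df(x)}{dx}+\sum_{i=1}^{m-1}\frac{k_i}{x}\,p_i(f)(x),$$ with the value at $x=0$ understood by continuous extension. $I(f)(x)=\int_0^xf(t)\,dt$ (integral along the segment from $0$ to $x$ in $U$), $I^n$ is its $n$-th iterate, and $I^0=\mathrm{id}$. If $f\in\mathcal{E}(U)$, then $I^{m-j}\circ p_j(f)\in\mathcal{E}_m(U)$. Write $\Gamma(\nu+\mathbf 1)=\prod_{j=1}^{m-1}\Gamma(\nu_j+1)$. For $f\in\mathcal{E}_m(U)$, $$\mathcal{R}_{\nu,m}f(x)=\frac{m^{1/2}\,\Gamma(\nu+\mathbf 1)}{(2\pi)^{(m-1)/2}}\int_0^1G^{m-1,0}_{m-1,m-1}\left(\left.\begin{matrix}\nu_1,\dots,\nu_{m-1}\\ -\frac1m,\dots,-\frac{m-1}m\end{matrix}\right|t\right)f(xt^{1/m})\,dt,$$ where $G$ is the Meijer $G$-function: for $0<t<1$, $$G^{m-1,0}_{m-1,m-1}\left(\left.\begin{matrix}a_1,\dots,a_{m-1}\\ {b_1},\dots,b_{m-1}\end{matrix}\right|t\right)=\frac1{2\pi i}\int_L\prod_{j=1}^{m-1}\frac{\Gamma(b_j-s)}{\Gamma(a_j-s)}\,t^s\,ds,$$ with $L$ a loop beginning and ending at $+\infty$ and encircling all the poles of the $\Gamma(b_j-s)$ once in the negative direction. The operators $A_j$ are $$A_m=1,\qquad A_{m-1}=\frac{d}{dx},\qquad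 A_j=\prod_{k=j+1}^{m-1}\left(\frac{d}{dx}+\frac{m\nu_k+m-k}{x}\right)\frac{d}{dx}\quad(1\le j\le m-2),$$ where the product is an ordered composition with factors written from left to right in increasing order of $k$ (so $\frac{d}{dx}$ is applied first, then the factor $k=m-1$, and so on, the factor $k=j+1$ being applied last). Values at $x=0$ are understood by continuous extension. *)

theory Defs
  imports "HOL-Complex_Analysis.Complex_Analysis"
begin

text \<open>
  A function on the union of lines \<open>U\<close> is represented by a function on \<^typ>\<open>complex\<close> of which only
  the values on \<open>U\<close> matter.  All limits and derivatives are taken within \<open>U\<close>, and every operator
  below depends, at points of \<open>U\<close>, only on the values of its argument on \<open>U\<close>.
\<close>

definition eps :: "nat \<Rightarrow> complex" where
  "eps m = exp (2 * \<i> * of_real pi / of_nat m)"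

definition lines :: "nat \<Rightarrow> complex set" where
  "lines m = (\<Union>j\<in>{1..m}. range (\<lambda>r::real. eps m ^ j * of_real r))"

definition deriv_U :: "nat \<Rightarrow> (complex \<Rightarrow> complex) \<Rightarrow> complex \<Rightarrow> complex" where
  "deriv_U m f x = Lim (at x within lines m) (\<lambda>y. (f y - f x) / (y - x))"

definition smooth_U :: "nat \<Rightarrow> (complex \<Rightarrow> complex) set" where
  "smooth_U m =
     {f. \<forall>n. \<forall>x\<in>lines m. (deriv_U m ^^ n) f field_differentiable (at x within lines m)}"

text \<open>Replaces the value at \<open>0\<close> by the limit along \<open>U\<close>.\<close>

definition extend_0 :: "nat \<Rightarrow> (complex \<Rightarrow> complex) \<Rightarrow> complex \<Rightarrow> complex" where
  "extend_0 m g x = (if x = 0 then Lim (at 0 within lines m) g else g x)"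

definition type_proj :: "nat \<Rightarrow> nat \<Rightarrow> (complex \<Rightarrow> complex) \<Rightarrow> complex \<Rightarrow> complex" where
  "type_proj m i f x =
     1 / of_nat m * (\<Sum>j = 0..m - 1. eps m powi (- int (i * j)) * f (eps m ^ j * x))"

definition dunkl_T ::
    "nat \<Rightarrow> (nat \<Rightarrow> complex) \<Rightarrow> (complex \<Rightarrow> complex) \<Rightarrow> complex \<Rightarrow> complex" where
  "dunkl_T m k f =
     extend_0 m (\<lambda>x. deriv_U m f x + (\<Sum>i = 1..m - 1. k i / x * type_proj m i f x))"

definition integral_0 :: "(complex \<Rightarrow> complex) \<Rightarrow> complex \<Rightarrow> complex" where
  "integral_0 f x = contour_integral (linepath 0 x) f"

text \<open>
  The function \<open>G\<^bsup>n,0\<^esup>\<^bsub>n,n\<^esub>\<close> with parameters \<open>a\<^sub>1,\<dots>,a\<^sub>n\<close> and \<open>b\<^sub>1,\<dots>,b\<^sub>n\<close>.  The loop \<open>L\<close> is three sides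
  of a half-infinite rectangle: it comes in from \<open>+\<infinity> - \<i>h\<close>, goes up from \<open>c - \<i>h\<close> to \<open>c + \<i>h\<close> and
  leaves to \<open>+\<infinity> + \<i>h\<close>, that is, it runs clockwise around the poles \<open>b\<^sub>j + l\<close> (\<open>l = 0, 1, \<dots>\<close>)
  of \<open>\<Gamma>(b\<^sub>j - s)\<close>.  The integral over \<open>L\<close> is the limit of the integrals over its part in
  \<open>Re s \<le> N\<close> as \<open>N\<close> tends to infinity.  At the poles of \<open>\<Gamma>(a\<^sub>j - s)\<close> the quotient \<open>1 / \<Gamma>(a\<^sub>j - s)\<close>
  is \<open>0\<close>, as it should be, by the library's conventions for \<^const>\<open>Gamma\<close> and division.
\<close>

definition meijer_loop :: "nat \<Rightarrow> (nat \<Rightarrow> complex) \<Rightarrow> real \<Rightarrow> real \<Rightarrow> complex" where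
  "meijer_loop n b N =
     (let c = Min ((\<lambda>j. Re (b j)) ` {1..n}) - 1;
          h = Max ((\<lambda>j. \<bar>Im (b j)\<bar>) ` {1..n}) + 1
      in linepath (Complex N (- h)) (Complex c (- h)) +++
         linepath (Complex c (- h)) (Complex c h) +++
         linepath (Complex c h) (Complex N h))"

definition meijer_G ::
    "nat \<Rightarrow> (nat \<Rightarrow> complex) \<Rightarrow> (nat \<Rightarrow> complex) \<Rightarrow> real \<Rightarrow> complex" where
  "meijer_G n a b t =
     1 / (2 * of_real pi * \<i>) *
     Lim at_top (\<lambda>N. contour_integral (meijer_loop n b N)
       (\<lambda>s. (\<Prod>j = 1..n. Gamma (b j - s) / Gamma (a j - s)) * of_real t powr s))"

definition op_R ::
    "nat \<Rightarrow> (nat \<Rightarrow> complex) \<Rightarrow> (complex \<Rightarrow> complex) \<Rightarrow> complex \<Rightarrow> complex" where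
  "op_R m \<nu> f x =
     of_real (sqrt (real m)) * (\<Prod>j = 1..m - 1. Gamma (\<nu> j + 1)) /
       of_real ((2 * pi) powr ((real m - 1) / 2)) *
     (LINT t:{0<..<1}|lborel.
        meijer_G (m - 1) \<nu> (\<lambda>j. - of_nat j / of_nat m) t *
        f (x * of_real (t powr (1 / real m))))"

definition bessel_factor ::
    "nat \<Rightarrow> complex \<Rightarrow> (complex \<Rightarrow> complex) \<Rightarrow> complex \<Rightarrow> complex" where
  "bessel_factor m c f = extend_0 m (\<lambda>x. deriv_U m f x + c / x * f x)"

text \<open>
  In \<^const>\<open>foldr\<close> the factor with the largest index \<open>k = m - 1\<close> acts first and \<open>k = j + 1\<close> acts
  last; for \<open>j = m - 1\<close> the list is empty and only the derivative remains.
  Extending each factor to \<open>0\<close> changes the composition at most at \<open>0\<close>, where it gives the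
  continuous extension.
\<close>

definition op_A ::
    "nat \<Rightarrow> (nat \<Rightarrow> complex) \<Rightarrow> nat \<Rightarrow> (complex \<Rightarrow> complex) \<Rightarrow> complex \<Rightarrow> complex" where
  "op_A m \<nu> j f =
     (if j = m then f
      else foldr (\<lambda>k. bessel_factor m (of_nat m * \<nu> k + of_nat m - of_nat k))
             [j + 1..<m] (deriv_U m f))"

definition op_V ::
    "nat \<Rightarrow> (nat \<Rightarrow> complex) \<Rightarrow> (complex \<Rightarrow> complex) \<Rightarrow> complex \<Rightarrow> complex" where
  "op_V m \<nu> f x =
     (\<Sum>j = 1..m. op_A m \<nu> j (op_R m \<nu> ((integral_0 ^^ (m - j)) (type_proj m j f))) x)"

end

theory Submission
  imports Defs
begin

text \<open>
  Write \<open>R\<close> for \<^const>\<open>op_R\<close> and \<open>\<theta> = x d/dx\<close>.  For \<open>f\<close> of type \<open>j\<close> with \<open>1 \<le> j \<le> m\<close>, the function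
  \<open>h\<^sub>j = A\<^sub>j (R (I\<^bsup>m-j\<^esup> f))\<close> is again of type \<open>j\<close>, so \<open>T(k)\<close> acts on it as \<open>d/dx + k\<^sub>j/x\<close> if \<open>j < m\<close> and
  as \<open>d/dx\<close> if \<open>j = m\<close>.  The choice \<open>k\<^sub>j = m \<nu>\<^sub>j + m - j\<close> makes this the very factor that turns
  \<open>A\<^sub>j\<close> into \<open>A\<^bsub>j-1\<^esub>\<close>.  On the other side \<open>f'\<close> has type \<open>j - 1\<close> and \<open>I f' = f - f(0)\<close>.  For
  \<open>2 \<le> j < m\<close> a function of type \<open>j\<close> vanishes at \<open>0\<close> and the relation is immediate; for
  \<open>j = m\<close> the constant \<open>f(0)\<close> is killed by the derivative in \<open>A\<^bsub>m-1\<^esub>\<close>.  All the analysis sits in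
  the type \<open>1\<close>, where the derivative has type \<open>0\<close>, that is, type \<open>m\<close>.  There, with
  \<open>g = I\<^bsup>m-1\<^esup> f\<close> of type \<open>m\<close>, the claim is
  \<open>(d/dx + k\<^sub>1/x) (d/dx + k\<^sub>2/x) \<dots> (d/dx + k\<^bsub>m-1\<^esub>/x) d/dx (R g) = R (g\<^bsup>(m)\<^esup>)\<close>.

  Moving the powers of \<open>x\<close> to the left turns its left-hand side into
  \<open>x\<^bsup>-m\<^esup> (\<theta> + m \<nu>\<^sub>1) \<dots> (\<theta> + m \<nu>\<^bsub>m-1\<^esub>) \<theta> (R g)\<close> (lemma \<open>op_A_typed\<close>).  The operator \<open>R\<close> averages the
  dilates \<open>x \<mapsto> g (x t\<^bsup>1/m\<^esup>)\<close> and therefore commutes with \<open>\<theta>\<close> (lemma \<open>euler_avg\<close>), so it remains to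
  compare \<open>R ((\<theta> + m \<nu>\<^sub>1) \<dots> \<theta> g)\<close> with \<open>x\<^sup>m R (g\<^bsup>(m)\<^esup>)\<close>.  For \<open>g = x\<^bsup>mn\<^esup>\<close> both are multiples of
  moments of the Meijer function, and equality is a two-term recursion for these moments.
  Both sides vanish on constants and depend otherwise continuously on \<open>g\<^bsup>(m)\<^esup>\<close> on the segment from
  \<open>0\<close> to \<open>x\<close>, and the theorem of
  Weierstrass, applied to \<open>g\<^bsup>(m)\<^esup>\<close> as a function of the \<open>m\<close>-th power of the distance to \<open>0\<close>, extends
  the equality to all \<open>g\<close> of type \<open>m\<close> (lemma \<open>avg_root_intertwining\<close>).

  The moments are \<open>\<integral> G(t) t\<^sup>n dt = \<Prod>\<^sub>j \<Gamma>(b\<^sub>j + n + 1) / \<Gamma>(a\<^sub>j + n + 1)\<close> (lemma \<open>meijer_G_moments\<close>).  The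
  quotient \<open>\<Phi>(s) = \<Prod>\<^sub>j \<Gamma>(b\<^sub>j - s) / \<Gamma>(a\<^sub>j - s)\<close> is a sum of partial fractions \<open>c\<^sub>p / (p - s)\<close> over its poles,
  with \<open>\<Sum>\<^sub>p |c\<^sub>p| / (1 + |p|) < \<infinity>\<close> (lemma \<open>Gamma_quotient_partial_fractions\<close>).  The loop integral of
  \<open>t\<^sup>s / (p - s)\<close> is \<open>2 \<pi> \<i> t\<^sup>p\<close> by the formula of Cauchy, hence \<open>G(t) = \<Sum>\<^sub>p c\<^sub>p t\<^sup>p\<close>, and termwise integration
  gives \<open>\<Sum>\<^sub>p c\<^sub>p / (p + n + 1) = \<Phi>(- n - 1)\<close>; the summability of the coefficients also makes \<open>G\<close>
  integrable.  For one factor the expansion is the limit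
  of the partial fractions of a quotient of Pochhammer symbols; a product of two expansions is
  again one because \<open>1 / ((p - s) (q - s)) = (1 / (p - s) - 1 / (q - s)) / (q - p)\<close>.
\<close>

section \<open>Partial fractions of a quotient of two Gamma functions\<close>

lemma pochhammer_shift_neg: "pochhammer (a - of_nat (Suc n)) n = (-1) ^ n * pochhammer (2 - a) n"
  for a :: complex
  using pochhammer_minus[of "of_nat (Suc n) - a" n] by (simp add: algebra_simps)

text \<open>
  The discrete analogue of the expansion of \<open>\<Gamma>(z) / \<Gamma>(z + a)\<close>.  In the step from \<open>n\<close> to \<open>n + 1\<close> the
  right-hand side is multiplied by \<open>(z + a + n) / (z + n + 1)\<close>, which changes the old coefficients as
  required; the coefficient at the new pole \<open>- (n + 1)\<close> is supplied by the induction hypothesis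
  evaluated at \<open>z = - (n + 1)\<close>.
\<close>

lemma beta_partial_fractions_finite:
  fixes z a :: complex
  assumes "\<And>l. l \<le> n \<Longrightarrow> z + of_nat l \<noteq> 0"
  shows "(\<Sum>l\<le>n. pochhammer (1 - a) l / fact l * (pochhammer a (n - l) / fact (n - l)) / (z + of_nat l))
         = pochhammer (z + a) n / pochhammer z (Suc n)"
  using assms
proof (induction n arbitrary: z)
  case 0
  then show ?case by simp
next
  case (Suc n)
  define r where "r = (\<lambda>n l. pochhammer (1 - a) l / fact l * (pochhammer a (n - l) / fact (n - l)))"
  have r_Suc: "r (Suc n) l = r n l * (a + of_nat (n - l)) / (of_nat (n - l) + 1)" if "l \<le> n" for l
    using that by (simp add: r_def Suc_diff_le pochhammer_Suc field_simps)
  have IH: "(\<Sum>l\<le>n. r n l / (w + of_nat l)) = pochhammer (w + a) n / pochhammer w (Suc n)"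
    if "\<And>l. l \<le> n \<Longrightarrow> w + of_nat l \<noteq> 0" for w
    using Suc.IH[of w] that by (simp add: r_def)
  have nz: "z + of_nat l \<noteq> 0" if "l \<le> Suc n" for l
    using Suc.prems that by blast
  have nz': "z + of_nat n + 1 \<noteq> 0" using nz[of "Suc n"] by (simp add: algebra_simps)
  have last: "(1 - a) * (\<Sum>l\<le>n. r n l / (of_nat (n - l) + 1)) = r (Suc n) (Suc n)"
  proof -
    have "(\<Sum>l\<le>n. r n l / (of_nat (n - l) + 1)) = - (\<Sum>l\<le>n. r n l / (- of_nat (Suc n) + of_nat l))"
      unfolding sum_negf[symmetric]
    proof (intro sum.cong refl)
      fix l assume "l \<in> {..n}"
      then have "of_nat (n - l) + 1 = - (- of_nat (Suc n) + of_nat l :: complex)"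
        by (simp add: of_nat_diff)
      then show "r n l / (of_nat (n - l) + 1) = - (r n l / (- of_nat (Suc n) + of_nat l))"
        by (simp only: minus_divide_right)
    qed
    also have "(\<Sum>l\<le>n. r n l / (- of_nat (Suc n) + of_nat l)) =
        pochhammer (- of_nat (Suc n) + a) n / pochhammer (- of_nat (Suc n)) (Suc n)"
    proof (rule IH)
      fix l assume "l \<le> n"
      then show "- of_nat (Suc n) + of_nat l \<noteq> (0::complex)"
        by (metis add.commute add_cancel_right_left add_diff_cancel_left' not_less_eq_eq of_nat_eq_iff order_refl
            uminus_add_conv_diff diff_add_cancel)
    qed
    also have "pochhammer (- of_nat (Suc n) + a) n = (-1) ^ n * pochhammer (2 - a) n"
      using pochhammer_shift_neg[of a n] by (simp add: algebra_simps)
    also have "pochhammer (- of_nat (Suc n) :: complex) (Suc n) = (-1) ^ Suc n * fact (Suc n)"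
      by (rule pochhammer_same)
    finally have "(\<Sum>l\<le>n. r n l / (of_nat (n - l) + 1)) = pochhammer (2 - a) n / fact (Suc n)"
      by (simp del: fact_Suc)
    then show ?thesis
      using pochhammer_rec[of "1 - a" n] by (simp add: r_def del: fact_Suc)
  qed
  have "(\<Sum>l\<le>Suc n. r (Suc n) l / (z + of_nat l)) =
        (\<Sum>l\<le>n. r (Suc n) l / (z + of_nat l)) + r (Suc n) (Suc n) / (z + of_nat n + 1)"
    by (simp add: algebra_simps)
  also have "\<dots> = (\<Sum>l\<le>n. r (Suc n) l / (z + of_nat l) + (1 - a) * (r n l / (of_nat (n - l) + 1)) / (z + of_nat n + 1))"
    by (simp add: sum.distrib last[symmetric] sum_distrib_left sum_divide_distrib)
  also have "\<dots> = (\<Sum>l\<le>n. r n l / (z + of_nat l) * ((z + a + of_nat n) / (z + of_nat n + 1)))"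
  proof (intro sum.cong refl)
    fix l assume "l \<in> {..n}"
    then have l: "l \<le> n" by simp
    define k where "k = n - l"
    have n: "n = l + k" using l by (simp add: k_def)
    have "z + of_nat l \<noteq> 0" "z + of_nat (l + k) + 1 \<noteq> 0" "of_nat k + 1 \<noteq> (0::complex)"
      using nz[of l] l nz' n by (simp_all, metis of_nat_Suc of_nat_neq_0 add.commute)
    then have "A * (a + of_nat k) / (of_nat k + 1) / (z + of_nat l) + (1 - a) * (A / (of_nat k + 1)) / (z + of_nat (l + k) + 1)
       = A / (z + of_nat l) * ((z + a + of_nat (l + k)) / (z + of_nat (l + k) + 1))" for A
      by (simp add: divide_simps) (simp add: algebra_simps)
    then show "r (Suc n) l / (z + of_nat l) + (1 - a) * (r n l / (of_nat (n - l) + 1)) / (z + of_nat n + 1)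
       = r n l / (z + of_nat l) * ((z + a + of_nat n) / (z + of_nat n + 1))"
      unfolding r_Suc[OF l] k_def[symmetric] n[symmetric] by blast
  qed
  also have "\<dots> = pochhammer (z + a) n / pochhammer z (Suc n) * ((z + a + of_nat n) / (z + of_nat n + 1))"
  proof -
    have "(\<Sum>l\<le>n. r n l / (z + of_nat l)) = pochhammer (z + a) n / pochhammer z (Suc n)"
      using nz by (intro IH) auto
    then show ?thesis by (simp only: sum_distrib_right[symmetric])
  qed
  also have "\<dots> = pochhammer (z + a) (Suc n) / pochhammer z (Suc (Suc n))"
    by (simp add: pochhammer_Suc add_ac)
  finally show ?case by (simp only: r_def)
qed

text \<open>
  Euler's limit formula for \<open>1 / \<Gamma>\<close>, with \<open>k + 1\<close> in place of \<open>k\<close> under the logarithm, so that the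
  sequence makes sense for all \<open>k\<close> and convergence yields a bound for all \<open>k\<close>.
\<close>

lemma pochhammer_fact_tendsto_rGamma:
  fixes a :: complex
  shows "(\<lambda>k. pochhammer a k / fact k * exp ((1 - a) * of_real (ln (real (Suc k))))) \<longlonglongrightarrow> rGamma a"
proof -
  have lim: "(\<lambda>k. 1 + c / of_nat (Suc k)) \<longlonglongrightarrow> 1" for c :: complex
  proof -
    have "(\<lambda>k. 1 + c * inverse (of_nat (Suc k))) \<longlonglongrightarrow> 1 + c * 0"
      by (intro tendsto_intros LIMSEQ_Suc[OF lim_inverse_n])
    then show ?thesis by (simp add: divide_inverse)
  qed
  have "(\<lambda>k. rGamma_series a (Suc k) / ((1 + (a - 1) / of_nat (Suc k)) * (1 + a / of_nat (Suc k))))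
      \<longlonglongrightarrow> rGamma a / (1 * 1)"
    by (intro tendsto_intros lim LIMSEQ_Suc[OF rGamma_series_LIMSEQ]) auto
  moreover have "\<forall>\<^sub>F k in sequentially.
     rGamma_series a (Suc k) / ((1 + (a - 1) / of_nat (Suc k)) * (1 + a / of_nat (Suc k)))
     = pochhammer a k / fact k * exp ((1 - a) * of_real (ln (real (Suc k))))"
    using eventually_gt_at_top[of "nat \<lceil>norm a\<rceil>"]
  proof eventually_elim
    case (elim k)
    then have k: "real k > norm a" by linarith
    have nz: "a + of_nat i \<noteq> 0" if "i \<ge> k" for i
    proof
      assume "a + of_nat i = 0"
      then have "norm a = real i"
        by (metis add_eq_0_iff2 norm_minus_cancel norm_of_nat)
      with k that show False by simp
    qed
    define w where "w = (of_nat (Suc k) :: complex)"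
    define L where "L = (of_real (ln (real (Suc k))) :: complex)"
    have w: "w \<noteq> 0" "exp L = w"
      by (simp_all add: w_def L_def exp_of_real del: of_nat_Suc)
    have f: "1 + (a - 1) / w = (a + of_nat k) / w" "1 + a / w = (a + of_nat (Suc k)) / w"
      using w(1) by (simp_all add: field_simps) (simp_all add: w_def)
    have P: "pochhammer a (Suc k + 1) = pochhammer a k * (a + of_nat k) * (a + of_nat (Suc k))"
      by (simp add: pochhammer_Suc)
    have F: "fact (Suc k) = w * fact k" by (simp add: w_def)
    have E: "exp ((1 - a) * L) = w / exp (a * L)"
      using w by (simp add: algebra_simps exp_diff)
    have R: "rGamma_series a (Suc k) =
        pochhammer a k * (a + of_nat k) * (a + of_nat (Suc k)) / (w * fact k * exp (a * L))"
      unfolding rGamma_series_def P F L_def by simp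
    show ?case
      unfolding w_def[symmetric] L_def[symmetric] f R E
      using w(1) nz[of k] nz[of "Suc k"] by (simp add: w_def divide_simps del: of_nat_Suc)
  qed
  ultimately show ?thesis
    by (simp add: tendsto_cong)
qed

text \<open>
  Only finitely many of the points \<open>w + n\<close>, \<open>n \<in> S\<close>, lie in the unit disc, so their distance to \<open>0\<close> has a
  positive minimum, and far away \<open>|w + n|\<close> is comparable with \<open>|n|\<close>.
\<close>

lemma pole_distance:
  fixes w :: complex
  assumes "\<And>n. n \<in> S \<Longrightarrow> w + of_int n \<noteq> 0"
  obtains \<kappa> where "\<kappa> > 0" "\<And>n. n \<in> S \<Longrightarrow> \<kappa> * (1 + \<bar>of_int n\<bar>) \<le> norm (w + of_int n)"
proof -
  define N where "N = {n \<in> S. norm (w + of_int n) < 1}"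
  have "N \<subseteq> {- \<lceil>norm w + 1\<rceil>..\<lceil>norm w + 1\<rceil>}"
  proof
    fix n assume "n \<in> N"
    then have "norm (w + of_int n) < 1" by (simp add: N_def)
    moreover have "norm (of_int n :: complex) \<le> norm (w + of_int n) + norm w"
      using norm_triangle_ineq4[of "w + of_int n" w] by simp
    ultimately have "\<bar>real_of_int n\<bar> < norm w + 1" by simp
    then show "n \<in> {- \<lceil>norm w + 1\<rceil>..\<lceil>norm w + 1\<rceil>}" by (simp add: abs_less_iff) linarith
  qed
  then have fin: "finite N" using finite_subset by blast
  define d where "d = Min (insert 1 ((\<lambda>n. norm (w + of_int n)) ` N))"
  have d: "d > 0" unfolding d_def using fin assms by (subst Min_gr_iff) (auto simp: N_def)
  have d_le: "d \<le> norm (w + of_int n)" if "n \<in> S" for n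
  proof (cases "n \<in> N")
    case True then show ?thesis unfolding d_def using fin by (intro Min_le) auto
  next
    case False
    then have "1 \<le> norm (w + of_int n)" using that by (simp add: N_def)
    moreover have "d \<le> 1" unfolding d_def using fin by (intro Min_le) auto
    ultimately show ?thesis by linarith
  qed
  define K where "K = (1 + norm w) / d + 1"
  have K: "K > 0" using d unfolding K_def by (smt (verit) divide_nonneg_pos norm_ge_zero)
  show ?thesis
  proof (rule that[of "1 / K"])
    fix n assume n: "n \<in> S"
    have "\<bar>real_of_int n\<bar> \<le> norm (w + of_int n) + norm w"
      using norm_triangle_ineq4[of "w + of_int n" w] by simp
    then have "1 + \<bar>real_of_int n\<bar> \<le> norm (w + of_int n) + (1 + norm w)" by simp
    also have "1 + norm w \<le> (1 + norm w) / d * norm (w + of_int n)"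
      using d_le[OF n] d by (simp add: divide_simps mult_left_mono)
    finally have "1 + \<bar>real_of_int n\<bar> \<le> K * norm (w + of_int n)"
      by (simp add: K_def algebra_simps)
    then show "1 / K * (1 + \<bar>of_int n\<bar>) \<le> norm (w + of_int n)" using K by (simp add: field_simps)
  qed (use K in auto)
qed

lemma pole_distance_nat:
  fixes z :: complex
  assumes "\<And>l. z + of_nat l \<noteq> 0"
  obtains \<kappa> where "\<kappa> > 0" "\<And>l. \<kappa> * (1 + real l) \<le> norm (z + of_nat l)"
proof -
  have "z + of_int n \<noteq> 0" if "n \<in> range int" for n
    using that assms by auto
  from pole_distance[OF this] obtain \<kappa> where "\<kappa> > 0"
    "\<And>n. n \<in> range int \<Longrightarrow> \<kappa> * (1 + \<bar>of_int n\<bar>) \<le> norm (z + of_int n)" by blast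
  then show ?thesis using that[of \<kappa>] by (metis abs_of_nat of_int_of_nat_eq rangeI)
qed

text \<open>
  The residue of \<open>\<Gamma>(z) / \<Gamma>(z + a)\<close> at \<open>z = - l\<close>, in other words
  \<open>(-1)\<^sup>l binomial (a - 1, l) / \<Gamma>(a)\<close>.
\<close>

definition beta_coeff :: "complex \<Rightarrow> nat \<Rightarrow> complex" where
  "beta_coeff a l = pochhammer (1 - a) l / fact l * rGamma a"

lemma norm_pochhammer_fact_le:
  fixes a :: complex
  obtains C where "C > 0" "\<And>l. norm (pochhammer a l / fact l) \<le> C * real (Suc l) powr (Re a - 1)"
proof -
  have "Bseq (\<lambda>l. pochhammer a l / fact l * exp ((1 - a) * of_real (ln (real (Suc l)))))"
    using pochhammer_fact_tendsto_rGamma[of a] by (intro convergent_imp_Bseq) (auto simp: convergent_def)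
  then obtain C where C: "C > 0"
      "\<And>l. norm (pochhammer a l / fact l * exp ((1 - a) * of_real (ln (real (Suc l))))) \<le> C"
    by (auto elim!: BseqE)
  show ?thesis
  proof (rule that[OF C(1)])
    fix l
    have "norm (exp ((1 - a) * of_real (ln (real (Suc l))))) = real (Suc l) powr (1 - Re a)"
      by (simp add: powr_def del: of_nat_Suc)
    then have "norm (pochhammer a l / fact l) * real (Suc l) powr (1 - Re a) \<le> C"
      using C(2)[of l] unfolding norm_mult by simp
    moreover have "real (Suc l) powr (Re a - 1) * real (Suc l) powr (1 - Re a) = 1"
      by (simp add: powr_add[symmetric])
    ultimately show "norm (pochhammer a l / fact l) \<le> C * real (Suc l) powr (Re a - 1)"
      using mult_right_mono[of "norm (pochhammer a l / fact l) * real (Suc l) powr (1 - Re a)" C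
          "real (Suc l) powr (Re a - 1)"]
      by (simp add: mult.assoc mult.commute[of "real (Suc l) powr (1 - Re a)"] del: of_nat_Suc)
  qed
qed

lemma norm_beta_coeff_le:
  obtains C where "C > 0" "\<And>l. norm (beta_coeff a l) \<le> C * real (Suc l) powr (- Re a)"
proof -
  obtain C where C: "C > 0" "\<And>l. norm (pochhammer (1 - a) l / fact l) \<le> C * real (Suc l) powr (Re (1 - a) - 1)"
    using norm_pochhammer_fact_le by blast
  show ?thesis
  proof (rule that[of "C * (norm (rGamma a) + 1)"])
    show "C * (norm (rGamma a) + 1) > 0" using C(1) by (simp add: add_nonneg_pos)
    fix l
    have "norm (pochhammer (1 - a) l / fact l) \<le> C * real (Suc l) powr (- Re a)"
      using C(2)[of l] by simp
    then have "norm (beta_coeff a l) \<le> C * real (Suc l) powr (- Re a) * norm (rGamma a)"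
      unfolding beta_coeff_def norm_mult by (rule mult_right_mono) simp
    also have "\<dots> \<le> C * (norm (rGamma a) + 1) * real (Suc l) powr (- Re a)"
      using C(1) by (simp add: algebra_simps)
    finally show "norm (beta_coeff a l) \<le> C * (norm (rGamma a) + 1) * real (Suc l) powr (- Re a)" .
  qed
qed

lemma summable_Suc_powr: "a > 1 \<Longrightarrow> summable (\<lambda>l. real (Suc l) powr (- a))"
  by (subst summable_Suc_iff) (simp add: summable_real_powr_iff)

lemma summable_norm_pole_term:
  fixes z :: complex
  assumes "Re a > 0" "\<And>l. z + of_nat l \<noteq> 0" "\<And>l. norm (c l) \<le> C * real (Suc l) powr (- Re a)"
  shows "summable (\<lambda>l. norm (c l / (z + of_nat l)))"
proof -
  obtain \<kappa> where \<kappa>: "\<kappa> > 0" "\<And>l. \<kappa> * (1 + real l) \<le> norm (z + of_nat l)"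
    using pole_distance_nat assms(2) by metis
  show ?thesis
  proof (rule summable_comparison_test')
    show "summable (\<lambda>l. C / \<kappa> * real (Suc l) powr (- (Re a + 1)))"
      using assms(1) by (intro summable_mult summable_Suc_powr) simp
    fix l :: nat
    have "norm (c l / (z + of_nat l)) \<le> C * real (Suc l) powr (- Re a) / (\<kappa> * (1 + real l))"
      unfolding norm_divide
      using \<kappa> assms(3)[of l] by (intro frac_le) (auto intro: order_trans[OF norm_ge_zero])
    also have "\<dots> = C / \<kappa> * real (Suc l) powr (- (Re a + 1))"
    proof -
      have "real (Suc l) powr (- (Re a + 1)) = real (Suc l) powr (- Re a) / (1 + real l)"
        using powr_diff[of "real (Suc l)" "- Re a" 1] by simp
      then show ?thesis by simp
    qed
    finally show "norm (norm (c l / (z + of_nat l))) \<le> C / \<kappa> * real (Suc l) powr (- (Re a + 1))" by simp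
  qed
qed

lemma beta_summable:
  assumes "Re a > 0" "\<And>l. z + of_nat l \<noteq> 0"
  shows "summable (\<lambda>l. norm (beta_coeff a l / (z + of_nat l)))"
proof -
  obtain C where "C > 0" "\<And>l. norm (beta_coeff a l) \<le> C * real (Suc l) powr (- Re a)"
    using norm_beta_coeff_le by blast
  with assms show ?thesis using summable_norm_pole_term by blast
qed

text \<open>
  The theorem of Tannery, applied to the finite expansion multiplied by \<open>(n + 1)\<^bsup>1-a\<^esup>\<close>.  The
  hypothesis \<open>Re a \<ge> 1\<close> provides the dominating series: the \<open>l\<close>-th term contains the factor
  \<open>((n + 1) / (n - l + 1))\<^bsup>1-a\<^esup>\<close>, whose modulus is then at most \<open>1\<close>.
\<close>

lemma beta_partial_fractions_ge_1:
  fixes z a :: complex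
  assumes a: "Re a \<ge> 1" and z: "\<And>l. z + of_nat l \<noteq> 0"
  shows "(\<Sum>l. beta_coeff a l / (z + of_nat l)) = Gamma z * rGamma (z + a)"
proof -
  define L where "L = (\<lambda>k. of_real (ln (real (Suc k))) :: complex)"
  define P where "P = (\<lambda>k. pochhammer a k / fact k * exp ((1 - a) * L k))"
  define u where "u = (\<lambda>l n. if l \<le> n then pochhammer (1 - a) l / fact l * (P (n - l) *
      exp ((1 - a) * (L n - L (n - l)))) / (z + of_nat l) else 0)"
  have P: "P \<longlonglongrightarrow> rGamma a"
    using pochhammer_fact_tendsto_rGamma[of a] unfolding P_def L_def .
  obtain C where C: "C > 0" "\<And>k. norm (P k) \<le> C"
    using convergent_imp_Bseq[OF convergentI[OF P]] by (elim BseqE) blast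
  define b where "b = (\<lambda>l. pochhammer (1 - a) l / fact l * (rGamma a * exp ((1 - a) * 0)) / (z + of_nat l))"
  have b: "b = (\<lambda>l. beta_coeff a l / (z + of_nat l))" by (simp add: b_def beta_coeff_def)
  have lim_L: "(\<lambda>n. L n - L (n - l)) \<longlonglongrightarrow> 0" for l
  proof -
    have "(\<lambda>n. ln (real (Suc n) / real (Suc (n - l)))) \<longlonglongrightarrow> ln 1"
    proof (intro tendsto_intros)
      have "(\<lambda>k. 1 + real l * inverse (real (Suc k))) \<longlonglongrightarrow> 1 + real l * 0"
        by (intro tendsto_intros LIMSEQ_Suc[OF lim_inverse_n])
      then have "(\<lambda>k. real (Suc (k + l)) / real (Suc (k + l - l))) \<longlonglongrightarrow> 1"
        by (simp add: field_simps)
      then show "(\<lambda>n. real (Suc n) / real (Suc (n - l))) \<longlonglongrightarrow> 1"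
        by (rule LIMSEQ_offset)
    qed auto
    then have "(\<lambda>n. of_real (ln (real (Suc n) / real (Suc (n - l)))) :: complex) \<longlonglongrightarrow> of_real (ln 1)"
      by (rule tendsto_of_real)
    then show ?thesis by (simp add: L_def ln_div del: of_nat_Suc)
  qed
  have lim_a: "(\<lambda>n. u l n) \<longlonglongrightarrow> b l" for l
  proof -
    have "(\<lambda>n. P (n - l)) \<longlonglongrightarrow> rGamma a"
      by (rule LIMSEQ_offset[of _ l]) (simp add: P)
    then have "(\<lambda>n. pochhammer (1 - a) l / fact l * (P (n - l) * exp ((1 - a) * (L n - L (n - l)))) / (z + of_nat l)) \<longlonglongrightarrow> b l"
      unfolding b_def using z[of l] by (intro tendsto_intros lim_L)
    moreover have "\<forall>\<^sub>F n in sequentially. pochhammer (1 - a) l / fact l * (P (n - l) * exp ((1 - a) * (L n - L (n - l)))) / (z + of_nat l) = u l n"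
      using eventually_ge_at_top[of l] by eventually_elim (simp add: u_def)
    ultimately show ?thesis by (rule Lim_transform_eventually)
  qed
  define M where "M = (\<lambda>l. norm (pochhammer (1 - a) l / fact l / (z + of_nat l)) * C)"
  have bound: "norm (u l n) \<le> M l" for l n
  proof (cases "l \<le> n")
    case True
    have "Re ((1 - a) * (L n - L (n - l))) = (1 - Re a) * (ln (real (Suc n)) - ln (real (Suc (n - l))))"
      by (simp add: L_def)
    also have "\<dots> \<le> 0" using a by (intro mult_nonpos_nonneg) auto
    finally have "norm (exp ((1 - a) * (L n - L (n - l)))) \<le> 1" by simp
    then have "norm (P (n - l) * exp ((1 - a) * (L n - L (n - l)))) \<le> C * 1"
      unfolding norm_mult using C by (intro mult_mono) auto
    then have "norm (pochhammer (1 - a) l / fact l / (z + of_nat l)) * norm (P (n - l) * exp ((1 - a) * (L n - L (n - l)))) \<le> M l"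
      unfolding M_def by (intro mult_left_mono) auto
    moreover have "norm (u l n) = norm (pochhammer (1 - a) l / fact l / (z + of_nat l)) * norm (P (n - l) * exp ((1 - a) * (L n - L (n - l))))"
      using True by (simp add: u_def norm_mult norm_divide)
    ultimately show ?thesis by linarith
  next
    case False then show ?thesis using C(1) by (simp add: u_def M_def)
  qed
  have sumM: "summable M"
  proof -
    obtain C' where "\<And>l. norm (pochhammer (1 - a) l / fact l) \<le> C' * real (Suc l) powr (Re (1 - a) - 1)"
      using norm_pochhammer_fact_le by blast
    then have "\<And>l. norm (pochhammer (1 - a) l / fact l) \<le> C' * real (Suc l) powr (- Re a)"
      by simp
    then show ?thesis unfolding M_def using a z
      by (intro summable_mult2 summable_norm_pole_term[of a z _ C']) auto
  qed
  \<comment> \<open>The scaled finite sums converge to the infinite one, and their closed form to the Gamma quotient.\<close>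
  have to_b: "(\<lambda>n. suminf (\<lambda>l. u l n)) \<longlonglongrightarrow> suminf b"
  proof -
    have "\<forall>\<^sub>F (k, n) in sequentially \<times>\<^sub>F sequentially. norm (u k n) \<le> M k"
      using bound by (intro always_eventually) auto
    from tannerys_theorem[OF lim_a this sumM] show ?thesis by simp
  qed
  have partial: "suminf (\<lambda>l. u l n) = exp ((1 - a) * L n) * (pochhammer (z + a) n / pochhammer z (Suc n))" for n
  proof -
    have "suminf (\<lambda>l. u l n) = (\<Sum>l\<le>n. u l n)"
      by (rule suminf_finite) (auto simp: u_def)
    also have "\<dots> = (\<Sum>l\<le>n. exp ((1 - a) * L n) * (pochhammer (1 - a) l / fact l * (pochhammer a (n - l) / fact (n - l)) / (z + of_nat l)))"
    proof (intro sum.cong refl)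
      fix l assume "l \<in> {..n}"
      moreover have "exp ((1 - a) * L (n - l)) * exp ((1 - a) * (L n - L (n - l))) = exp ((1 - a) * L n)"
        by (simp add: exp_add[symmetric] algebra_simps)
      ultimately show "u l n = exp ((1 - a) * L n) * (pochhammer (1 - a) l / fact l * (pochhammer a (n - l) / fact (n - l)) / (z + of_nat l))"
        by (simp add: u_def P_def)
    qed
    finally show ?thesis
      unfolding sum_distrib_left[symmetric] using beta_partial_fractions_finite[of n z a] z by metis
  qed
  have "(\<lambda>n. exp ((1 - a) * L n) * (pochhammer (z + a) n / pochhammer z (Suc n))) \<longlonglongrightarrow> Gamma z * rGamma (z + a)"
  proof -
    define Q where "Q = (\<lambda>w n. pochhammer w n / fact n * exp ((1 - w) * L n))"
    have Q: "Q w \<longlonglongrightarrow> rGamma w" for w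
      using pochhammer_fact_tendsto_rGamma[of w] by (simp add: Q_def L_def)
    have "rGamma z \<noteq> 0"
    proof
      assume "rGamma z = 0"
      then obtain n where "z = - of_nat n"
        unfolding rGamma_eq_zero_iff by (elim nonpos_Ints_cases')
      then show False using z[of n] by simp
    qed
    have one: "(\<lambda>n. 1 + (z - 1) / of_nat (Suc n)) \<longlonglongrightarrow> 1"
    proof -
      have "(\<lambda>k. 1 + (z - 1) * inverse (of_nat (Suc k))) \<longlonglongrightarrow> 1 + (z - 1) * 0"
        by (intro tendsto_intros LIMSEQ_Suc[OF lim_inverse_n])
      then show ?thesis by (simp add: divide_inverse)
    qed
    have "(\<lambda>n. Q (z + a) n / (Q z n * (1 + (z - 1) / of_nat (Suc n)))) \<longlonglongrightarrow> rGamma (z + a) / (rGamma z * 1)"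
      by (intro tendsto_intros Q one) (use \<open>rGamma z \<noteq> 0\<close> in auto)
    moreover have "Q (z + a) n / (Q z n * (1 + (z - 1) / of_nat (Suc n))) = exp ((1 - a) * L n) * (pochhammer (z + a) n / pochhammer z (Suc n))" for n
    proof -
      define w where "w = (of_nat (Suc n) :: complex)"
      have w: "w \<noteq> 0" "exp (L n) = w" by (simp_all add: w_def L_def exp_of_real del: of_nat_Suc)
      have f: "1 + (z - 1) / w = (z + of_nat n) / w" using w(1) by (simp add: field_simps) (simp add: w_def)
      have e: "exp ((1 - a) * L n) = exp ((1 - (z + a)) * L n) / exp ((1 - z) * L n) * w"
        unfolding w(2)[symmetric] exp_diff[symmetric] exp_add[symmetric] by (simp add: algebra_simps)
      show ?thesis
        unfolding Q_def w_def[symmetric] f e using w(1) by (simp add: pochhammer_Suc divide_simps)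
    qed
    moreover have "rGamma (z + a) / (rGamma z * 1) = Gamma z * rGamma (z + a)"
      by (simp add: rGamma_inverse_Gamma divide_inverse mult.commute)
    ultimately show ?thesis by simp
  qed
  then have "(\<lambda>n. suminf (\<lambda>l. u l n)) \<longlonglongrightarrow> Gamma z * rGamma (z + a)"
    unfolding partial .
  from LIMSEQ_unique[OF to_b this] show ?thesis unfolding b .
qed

lemma beta_coeff_absorb: "(a - of_nat l) * beta_coeff (a + 1) l = beta_coeff a l"
proof -
  have "(a - of_nat l) * pochhammer (- a) l = a * pochhammer (1 - a) l"
    using pochhammer_absorb_comp[of a l] by (simp add: add.commute)
  then have "(a - of_nat l) * beta_coeff (a + 1) l = a * rGamma (a + 1) * (pochhammer (1 - a) l / fact l)"
    by (simp add: beta_coeff_def)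
  then show ?thesis by (simp add: rGamma_plus1 beta_coeff_def)
qed

text \<open>
  This is the binomial series of \<open>(1 - 1)\<^sup>a\<close>; up to a constant factor its partial sums are
  \<open>(1 - a)\<^sub>n / n!\<close>, of order \<open>n\<^bsup>- Re a\<^esup>\<close>.
\<close>

lemma beta_coeff_sums_0:
  assumes "Re a > 0"
  shows "beta_coeff (a + 1) sums 0"
proof -
  have hockey: "(\<Sum>l<Suc n. pochhammer (- a) l / fact l) = pochhammer (1 - a) n / fact n" for n
  proof (induction n)
    case (Suc n)
    have "(\<Sum>l<Suc (Suc n). pochhammer (- a) l / fact l) =
          pochhammer (1 - a) n / fact n + pochhammer (- a) (Suc n) / fact (Suc n)"
      using Suc.IH by simp
    also have "\<dots> = pochhammer (1 - a) n * ((of_nat (Suc n) - a) / fact (Suc n))"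
    proof -
      have "pochhammer (1 - a) n / fact n = pochhammer (1 - a) n * of_nat (Suc n) / fact (Suc n)"
        by (simp add: divide_simps del: of_nat_Suc)
      moreover have "pochhammer (- a) (Suc n) = pochhammer (1 - a) n * (- a)"
        by (simp add: pochhammer_rec add.commute)
      ultimately show ?thesis
        by (simp only: add_divide_distrib[symmetric] distrib_left[symmetric] times_divide_eq_right) simp
    qed
    also have "\<dots> = pochhammer (1 - a) (Suc n) / fact (Suc n)"
      by (simp add: pochhammer_Suc)
    finally show ?case .
  qed simp
  obtain C where C: "\<And>l. norm (pochhammer (1 - a) l / fact l) \<le> C * real (Suc l) powr (Re (1 - a) - 1)"
    using norm_pochhammer_fact_le by blast
  have "filterlim (\<lambda>n. real (Suc n)) at_top sequentially"
    by (rule filterlim_compose[OF filterlim_real_sequentially filterlim_Suc])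
  then have "(\<lambda>n. real (Suc n) powr (- Re a)) \<longlonglongrightarrow> 0"
    using assms by (intro tendsto_neg_powr) auto
  then have lim: "(\<lambda>n. C * real (Suc n) powr (- Re a)) \<longlonglongrightarrow> 0"
    by (rule tendsto_mult_right_zero)
  have "\<forall>\<^sub>F n in sequentially. norm (pochhammer (1 - a) n / fact n) \<le> C * real (Suc n) powr (- Re a)"
    using C by (intro always_eventually allI) simp
  from Lim_null_comparison[OF this lim] have "(\<lambda>n. pochhammer (1 - a) n / fact n) \<longlonglongrightarrow> 0" .
  then have "(\<lambda>n. (\<Sum>l<Suc n. pochhammer (- a) l / fact l) * rGamma (a + 1)) \<longlonglongrightarrow> 0 * rGamma (a + 1)"
    unfolding hockey by (intro tendsto_intros)
  moreover have "(\<lambda>n. \<Sum>l<Suc n. beta_coeff (a + 1) l) \<longlonglongrightarrow> 0"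
    if "(\<lambda>n. (\<Sum>l<Suc n. pochhammer (- a) l / fact l) * rGamma (a + 1)) \<longlonglongrightarrow> 0 * rGamma (a + 1)"
  proof -
    have "beta_coeff (a + 1) l = pochhammer (- a) l / fact l * rGamma (a + 1)" for l
      by (simp add: beta_coeff_def)
    then show ?thesis using that by (simp only: sum_distrib_right mult_zero_left)
  qed
  ultimately have "(\<lambda>n. \<Sum>l<Suc n. beta_coeff (a + 1) l) \<longlonglongrightarrow> 0" by blast
  then show ?thesis unfolding sums_def by (rule LIMSEQ_imp_Suc)
qed

text \<open>
  The identity \<open>(z + a) / (z + l) = 1 + (a - l) / (z + l)\<close> leads from \<open>a + 1\<close> to \<open>a\<close>, and thus from
  \<open>Re a \<ge> 1\<close> to \<open>Re a > 0\<close>.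
\<close>

lemma beta_partial_fractions_descend:
  assumes "Re a > 0" "\<And>l. z + of_nat l \<noteq> 0"
    and "(\<Sum>l. beta_coeff (a + 1) l / (z + of_nat l)) = Gamma z * rGamma (z + (a + 1))"
  shows "(\<Sum>l. beta_coeff a l / (z + of_nat l)) = Gamma z * rGamma (z + a)"
proof -
  have "summable (\<lambda>l. beta_coeff (a + 1) l / (z + of_nat l))"
    by (rule summable_norm_cancel, rule beta_summable[OF _ assms(2)]) (use assms(1) in simp)
  then have "(\<lambda>l. beta_coeff (a + 1) l / (z + of_nat l)) sums (Gamma z * rGamma (z + (a + 1)))"
    unfolding assms(3)[symmetric] by (rule summable_sums)
  then have "(\<lambda>l. (z + a) * (beta_coeff (a + 1) l / (z + of_nat l)) - beta_coeff (a + 1) l)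
      sums ((z + a) * (Gamma z * rGamma (z + (a + 1))) - 0)"
    by (intro sums_diff sums_mult beta_coeff_sums_0 assms)
  moreover have "(z + a) * (beta_coeff (a + 1) l / (z + of_nat l)) - beta_coeff (a + 1) l
      = beta_coeff a l / (z + of_nat l)" for l
    unfolding beta_coeff_absorb[of a l, symmetric] using assms(2)[of l] by (simp add: field_simps)
  moreover have "(z + a) * (Gamma z * rGamma (z + (a + 1))) = Gamma z * rGamma (z + a)"
    using rGamma_plus1[of "z + a"] by (simp add: add.assoc mult.left_commute)
  ultimately have "(\<lambda>l. beta_coeff a l / (z + of_nat l)) sums (Gamma z * rGamma (z + a))"
    by (simp only: diff_0_right)
  then show ?thesis by (rule sums_unique[symmetric])
qed

lemma beta_partial_fractions:
  fixes z a :: complex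
  assumes "Re a > 0" and z: "\<And>l. z + of_nat l \<noteq> 0"
  shows "(\<Sum>l. beta_coeff a l / (z + of_nat l)) = Gamma z * rGamma (z + a)"
proof (rule beta_partial_fractions_descend)
  have 1: "Re (a + 1) \<ge> 1" using assms(1) by simp
  show "Re a > 0" "\<And>l. z + of_nat l \<noteq> 0" by fact+
  show "(\<Sum>l. beta_coeff (a + 1) l / (z + of_nat l)) = Gamma z * rGamma (z + (a + 1))"
    by (rule beta_partial_fractions_ge_1[OF 1 z])
qed

section \<open>Sums over arithmetic progressions of poles\<close>

definition pole_series :: "complex \<Rightarrow> (nat \<Rightarrow> complex) \<Rightarrow> complex \<Rightarrow> complex" where
  "pole_series p c s = (\<Sum>l. c l / (p + of_nat l - s))"

abbreviation gap :: "nat \<Rightarrow> nat \<Rightarrow> real" where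
  "gap k l \<equiv> 1 + \<bar>real k - real l\<bar>"

text \<open>
  The case \<open>l = 0\<close> says that \<open>\<Sum> |c\<^sub>k| / (1 + k)\<close> is finite, which is what makes the series of the
  Meijer function integrable.  Uniformity in \<open>l\<close> bounds a pole series on every progression
  \<open>p, p + 1, p + 2, \<dots>\<close> that avoids its own poles modulo \<open>1\<close>; this is what makes products of pole
  series expand into pole series with admissible coefficients.
\<close>

definition admissible :: "(nat \<Rightarrow> complex) \<Rightarrow> bool" where
  "admissible c \<longleftrightarrow> (\<exists>B. \<forall>l n. (\<Sum>k<n. norm (c k) / gap k l) \<le> B)"

lemma sum_abs_diff_powr_le:
  assumes "a > 1"
  shows "(\<Sum>k<n. gap k l powr (- a)) \<le> 2 * (\<Sum>i. real (Suc i) powr (- a))"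
proof -
  let ?g = "\<lambda>i. real (Suc i) powr (- a)"
  have sum: "summable ?g" using assms by (rule summable_Suc_powr)
  have "(\<Sum>k\<in>{..<n} - {..<l}. gap k l powr (- a)) = (\<Sum>i\<in>(\<lambda>k. k - l) ` ({..<n} - {..<l}). ?g i)"
    by (subst sum.reindex) (auto simp: inj_on_def of_nat_diff add_ac intro!: sum.cong)
  also have "\<dots> \<le> (\<Sum>i. ?g i)" by (rule sum_le_suminf[OF sum]) auto
  finally have 1: "(\<Sum>k\<in>{..<n} - {..<l}. gap k l powr (- a)) \<le> (\<Sum>i. ?g i)" .
  have "(\<Sum>k\<in>{..<n} \<inter> {..<l}. gap k l powr (- a)) = (\<Sum>i\<in>(\<lambda>k. l - k) ` ({..<n} \<inter> {..<l}). ?g i)"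
    by (subst sum.reindex) (auto simp: inj_on_def of_nat_diff add_ac intro!: sum.cong)
  also have "\<dots> \<le> (\<Sum>i. ?g i)" by (rule sum_le_suminf[OF sum]) auto
  finally have 2: "(\<Sum>k\<in>{..<n} \<inter> {..<l}. gap k l powr (- a)) \<le> (\<Sum>i. ?g i)" .
  show ?thesis
    using 1 2 sum.Int_Diff[of "{..<n}" "\<lambda>k. gap k l powr (- a)" "{..<l}"] by simp
qed

text \<open>
  The coefficients are \<open>O ((k + 1)\<^bsup>-\<delta>\<^esup>)\<close> with \<open>\<delta> = Re a\<close> possibly small.  The inequality of Young with
  the exponents \<open>1 + 1 / \<delta>\<close> and \<open>1 + \<delta>\<close> splits \<open>(k + 1)\<^bsup>-\<delta>\<^esup> / (1 + |k - l|)\<close> into two terms of exponent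
  \<open>- (1 + \<delta>)\<close>, whose sums over \<open>k\<close> are bounded independently of \<open>l\<close>.
\<close>

lemma admissible_beta_coeff:
  assumes "Re a > 0"
  shows "admissible (beta_coeff a)"
proof -
  define \<delta> where "\<delta> = Re a"
  have \<delta>: "\<delta> > 0" using assms by (simp add: \<delta>_def)
  obtain C where C: "C > 0" "\<And>l. norm (beta_coeff a l) \<le> C * real (Suc l) powr (- \<delta>)"
    using norm_beta_coeff_le unfolding \<delta>_def by blast
  define Z where "Z = (\<Sum>i. real (Suc i) powr (- (\<delta> + 1)))"
  have young: "norm (beta_coeff a k) / gap k l \<le>
     C * (real (Suc k) powr (- (\<delta> + 1)) + gap k l powr (- (\<delta> + 1)))" for k l
  proof -
    define b where "b = 1 + \<bar>real k - real l\<bar>"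
    have b: "b > 0" by (simp add: b_def)
    have "real (Suc k) powr (- \<delta>) * b powr (-1) \<le>
        (real (Suc k) powr (- \<delta>)) powr (1 + 1 / \<delta>) / (1 + 1 / \<delta>) + (b powr (-1)) powr (\<delta> + 1) / (\<delta> + 1)"
      using \<delta> by (intro Youngs_inequality) (auto simp: field_simps)
    also have "(real (Suc k) powr (- \<delta>)) powr (1 + 1 / \<delta>) = real (Suc k) powr (- (\<delta> + 1))"
    proof -
      have "- \<delta> * (1 + 1 / \<delta>) = - (\<delta> + 1)" using \<delta> by (simp add: field_simps)
      then show ?thesis by (simp only: powr_powr)
    qed
    also have "(b powr (-1)) powr (\<delta> + 1) = b powr (- (\<delta> + 1))"
      unfolding powr_powr by simp
    also have "real (Suc k) powr (- (\<delta> + 1)) / (1 + 1 / \<delta>) + b powr (- (\<delta> + 1)) / (\<delta> + 1) \<le>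
       real (Suc k) powr (- (\<delta> + 1)) / 1 + b powr (- (\<delta> + 1)) / 1"
      using \<delta> by (intro add_mono divide_left_mono) (auto simp: add_pos_pos)
    finally have Y: "real (Suc k) powr (- \<delta>) / b \<le> real (Suc k) powr (- (\<delta> + 1)) + b powr (- (\<delta> + 1))"
      using b by (simp add: powr_minus divide_inverse del: of_nat_Suc)
    have "norm (beta_coeff a k) / b \<le> C * (real (Suc k) powr (- \<delta>) / b)"
      using divide_right_mono[OF C(2)[of k], of b] b by simp
    also have "\<dots> \<le> C * (real (Suc k) powr (- (\<delta> + 1)) + b powr (- (\<delta> + 1)))"
      using Y C(1) by (intro mult_left_mono) auto
    finally show ?thesis by (simp only: b_def)
  qed
  have "(\<Sum>k<n. norm (beta_coeff a k) / gap k l) \<le> C * (Z + 2 * Z)" for l n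
  proof -
    have "(\<Sum>k<n. norm (beta_coeff a k) / gap k l) \<le>
       (\<Sum>k<n. C * (real (Suc k) powr (- (\<delta> + 1)) + gap k l powr (- (\<delta> + 1))))"
      by (intro sum_mono young)
    also have "\<dots> = C * ((\<Sum>k<n. real (Suc k) powr (- (\<delta> + 1))) + (\<Sum>k<n. gap k l powr (- (\<delta> + 1))))"
      by (simp only: sum_distrib_left[symmetric] sum.distrib)
    also have "\<dots> \<le> C * (Z + 2 * Z)"
      unfolding Z_def using C(1) \<delta>
      by (intro mult_left_mono add_mono sum_le_suminf summable_Suc_powr sum_abs_diff_powr_le) auto
    finally show ?thesis .
  qed
  then show ?thesis unfolding admissible_def by blast
qed

lemma admissible_summable:
  assumes "admissible c"
  obtains B where "\<And>l. summable (\<lambda>k. norm (c k) / gap k l)"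
    "\<And>l. (\<Sum>k. norm (c k) / gap k l) \<le> B"
proof -
  obtain B where B: "\<And>l n. (\<Sum>k<n. norm (c k) / gap k l) \<le> B"
    using assms unfolding admissible_def by blast
  have sum: "summable (\<lambda>k. norm (c k) / gap k l)" for l
    by (rule summableI_nonneg_bounded[of _ B]) (use B in auto)
  show ?thesis
    by (rule that[OF sum]) (rule suminf_le_const[OF sum B])
qed

lemma admissible_mult_bounded:
  assumes "admissible c" "\<And>l. norm (b l) \<le> M"
  shows "admissible (\<lambda>l. c l * b l)"
proof -
  obtain B where B: "\<And>l n. (\<Sum>k<n. norm (c k) / gap k l) \<le> B"
    using assms(1) unfolding admissible_def by blast
  have M: "M \<ge> 0" using assms(2)[of 0] norm_ge_zero order_trans by blast
  have "(\<Sum>k<n. norm (c k * b k) / gap k l) \<le> M * B" for l n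
  proof -
    have "(\<Sum>k<n. norm (c k * b k) / gap k l) \<le>
          (\<Sum>k<n. M * (norm (c k) / gap k l))"
    proof (rule sum_mono)
      fix k
      have "norm (c k * b k) \<le> M * norm (c k)"
        using mult_right_mono[OF assms(2)[of k], of "norm (c k)"] by (simp add: norm_mult mult.commute)
      then show "norm (c k * b k) / gap k l \<le> M * (norm (c k) / gap k l)"
        by (simp add: divide_right_mono)
    qed
    also have "\<dots> \<le> M * B"
      unfolding sum_distrib_left[symmetric] using B M by (intro mult_left_mono) auto
    finally show ?thesis .
  qed
  then show ?thesis unfolding admissible_def by blast
qed

lemma pole_series_summable:
  assumes "admissible c" "\<And>l. s \<noteq> p + of_nat l"
  shows "summable (\<lambda>l. norm (c l / (p + of_nat l - s)))"
proof -
  have "(p - s) + of_nat l \<noteq> 0" for l using assms(2)[of l] by (metis add_diff_eq add.commute right_minus_eq)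
  then obtain \<kappa> where \<kappa>: "\<kappa> > 0" "\<And>l. \<kappa> * (1 + real l) \<le> norm ((p - s) + of_nat l)"
    using pole_distance_nat[of "p - s"] by metis
  obtain B where B: "\<And>l. summable (\<lambda>k. norm (c k) / gap k l)"
    using admissible_summable[OF assms(1)] by metis
  show ?thesis
  proof (rule summable_comparison_test')
    show "summable (\<lambda>k. (1 / \<kappa>) * (norm (c k) / (1 + \<bar>real k - real 0\<bar>)))"
      by (intro summable_mult B)
    fix l :: nat
    have "norm (c l) / norm (p - s + of_nat l) \<le> norm (c l) / (\<kappa> * (1 + real l))"
      using \<kappa> by (intro frac_le) auto
    then show "norm (norm (c l / (p + of_nat l - s))) \<le> (1 / \<kappa>) * (norm (c l) / (1 + \<bar>real l - real 0\<bar>))"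
      by (simp add: norm_divide algebra_simps)
  qed
qed

lemma nat_diff_nonzero:
  fixes p q :: complex
  assumes "q - p \<notin> \<int>"
  shows "q + of_nat k - (p + of_nat l) \<noteq> 0"
proof
  assume "q + of_nat k - (p + of_nat l) = 0"
  then have "q - p = of_int (int l - int k)" by (simp add: algebra_simps)
  with assms show False by (metis Ints_of_int)
qed

lemma pole_distance_pair:
  fixes p q :: complex
  assumes "q - p \<notin> \<int>"
  obtains \<kappa> where "\<kappa> > 0" "\<And>k l. \<kappa> * gap k l \<le> norm (q + of_nat k - (p + of_nat l))"
proof -
  have "(q - p) + of_int n \<noteq> 0" for n
    using assms by (metis Ints_of_int add.inverse_unique minus_in_Ints_iff add.commute)
  then obtain \<kappa> where \<kappa>: "\<kappa> > 0" "\<And>n. n \<in> UNIV \<Longrightarrow> \<kappa> * (1 + \<bar>of_int n\<bar>) \<le> norm ((q - p) + of_int n)"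
    using pole_distance[of UNIV "q - p"] by metis
  show ?thesis
  proof (rule that[OF \<kappa>(1)])
    fix k l :: nat
    show "\<kappa> * gap k l \<le> norm (q + of_nat k - (p + of_nat l))"
      using \<kappa>(2)[of "int k - int l"] by (simp add: algebra_simps)
  qed
qed

lemma pole_series_bounded:
  assumes "admissible d" "q - p \<notin> \<int>"
  obtains M where "\<And>l. (\<Sum>k. norm (d k / (q + of_nat k - (p + of_nat l)))) \<le> M"
    "\<And>l. norm (pole_series q d (p + of_nat l)) \<le> M"
proof -
  obtain \<kappa> where \<kappa>: "\<kappa> > 0" "\<And>k l. \<kappa> * gap k l \<le> norm (q + of_nat k - (p + of_nat l))"
    using pole_distance_pair[OF assms(2)] by metis
  obtain B where B: "\<And>l. summable (\<lambda>k. norm (d k) / gap k l)"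
    "\<And>l. (\<Sum>k. norm (d k) / gap k l) \<le> B"
    using admissible_summable[OF assms(1)] by metis
  have sum: "summable (\<lambda>k. norm (d k / (q + of_nat k - (p + of_nat l))))" for l
    using nat_diff_nonzero[OF assms(2), of _ l] by (intro pole_series_summable assms(1)) force
  have *: "(\<Sum>k. norm (d k / (q + of_nat k - (p + of_nat l)))) \<le> (1 / \<kappa>) * B" for l
  proof -
    have "(\<Sum>k. norm (d k / (q + of_nat k - (p + of_nat l)))) \<le> (\<Sum>k. (1 / \<kappa>) * (norm (d k) / gap k l))"
    proof (rule suminf_le[OF _ sum summable_mult[OF B(1)]])
      fix k
      have "norm (d k) / norm (q + of_nat k - (p + of_nat l)) \<le> norm (d k) / (\<kappa> * gap k l)"
        using \<kappa> by (intro frac_le) (auto intro!: mult_pos_pos)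
      then show "norm (d k / (q + of_nat k - (p + of_nat l))) \<le> (1 / \<kappa>) * (norm (d k) / gap k l)"
        by (simp add: norm_divide)
    qed
    also have "\<dots> = (1 / \<kappa>) * (\<Sum>k. norm (d k) / gap k l)"
      by (rule suminf_mult[OF B(1)])
    also have "\<dots> \<le> (1 / \<kappa>) * B" using \<kappa>(1) B(2) by (intro mult_left_mono) auto
    finally show ?thesis .
  qed
  have "norm (pole_series q d (p + of_nat l)) \<le> (1 / \<kappa>) * B" for l
    unfolding pole_series_def using summable_norm[OF sum] * order_trans by blast
  with * show ?thesis using that by blast
qed

lemma suminf_eq_infsum:
  fixes f :: "nat \<Rightarrow> complex"
  assumes "summable (\<lambda>n. norm (f n))"
  shows "(\<Sum>\<^sub>\<infinity>n. f n) = (\<Sum>n. f n)"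
  using norm_summable_imp_has_sum[OF assms summable_sums[OF summable_norm_cancel[OF assms]]]
  by (rule infsumI)

lemma suminf_swap:
  fixes f :: "nat \<Rightarrow> nat \<Rightarrow> complex"
  assumes row: "\<And>k. summable (\<lambda>l. norm (f k l))"
    and total: "summable (\<lambda>k. \<Sum>l. norm (f k l))"
  shows "(\<Sum>k. \<Sum>l. f k l) = (\<Sum>l. \<Sum>k. f k l)"
proof -
  have R: "(\<lambda>l. norm (f k l)) summable_on UNIV" for k
    using row[of k] by (simp add: summable_on_UNIV_nonneg_real_iff)
  have Rsum: "(\<Sum>\<^sub>\<infinity>l. norm (f k l)) = (\<Sum>l. norm (f k l))" for k
    using norm_summable_imp_has_sum[of "\<lambda>l. norm (f k l)", OF _ summable_sums[OF row[of k]]] row[of k]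
    by (intro infsumI) simp
  have T: "(\<lambda>k. \<Sum>\<^sub>\<infinity>l. norm (f k l)) summable_on UNIV"
    unfolding Rsum using total by (subst summable_on_UNIV_nonneg_real_iff) (auto intro: suminf_nonneg row)
  have abs: "(\<lambda>x. norm (case x of (k, l) \<Rightarrow> f k l)) summable_on (UNIV \<times> UNIV)"
    using R T by (subst Infinite_Sum.abs_summable_on_Sigma_iff) (simp add: infsum_nonneg)
  have abs': "(\<lambda>x. norm (case x of (l, k) \<Rightarrow> f k l)) summable_on (UNIV \<times> UNIV)"
    by (subst summable_on_swap) (use abs in \<open>simp add: case_prod_unfold\<close>)
  have col: "(\<lambda>k. norm (f k l)) summable_on UNIV" for l
    using abs' by (subst (asm) Infinite_Sum.abs_summable_on_Sigma_iff) auto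
  then have colS: "summable (\<lambda>k. norm (f k l))" for l
    by (simp add: summable_on_UNIV_nonneg_real_iff)
  have swap: "(\<Sum>\<^sub>\<infinity>k. \<Sum>\<^sub>\<infinity>l. f k l) = (\<Sum>\<^sub>\<infinity>l. \<Sum>\<^sub>\<infinity>k. f k l)"
    by (rule infsum_swap_banach) (rule abs_summable_summable[OF abs])
  have inner1: "(\<Sum>\<^sub>\<infinity>l. f k l) = (\<Sum>l. f k l)" for k by (rule suminf_eq_infsum[OF row])
  have inner2: "(\<Sum>\<^sub>\<infinity>k. f k l) = (\<Sum>k. f k l)" for l by (rule suminf_eq_infsum[OF colS])
  have o1: "summable (\<lambda>k. norm (\<Sum>l. f k l))"
    by (rule summable_comparison_test'[OF total]) (use summable_norm[OF row] in auto)
  have "summable (\<lambda>l. \<Sum>k. norm (f k l))"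
  proof -
    have "(\<lambda>l. \<Sum>\<^sub>\<infinity>k. norm (norm (f k l))) summable_on UNIV"
      using abs' by (subst (asm) Infinite_Sum.abs_summable_on_Sigma_iff) (auto simp: infsum_nonneg)
    moreover have "(\<Sum>\<^sub>\<infinity>k. norm (norm (f k l))) = (\<Sum>k. norm (f k l))" for l
      using norm_summable_imp_has_sum[of "\<lambda>k. norm (f k l)", OF _ summable_sums[OF colS[of l]]] colS[of l]
      by (intro infsumI) simp
    ultimately show ?thesis
      by (subst (asm) summable_on_UNIV_nonneg_real_iff) (auto intro: suminf_nonneg colS)
  qed
  then have o2: "summable (\<lambda>l. norm (\<Sum>k. f k l))"
    by (rule summable_comparison_test') (use summable_norm[OF colS] in auto)
  show "(\<Sum>k. \<Sum>l. f k l) = (\<Sum>l. \<Sum>k. f k l)"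
    using swap unfolding inner1 inner2 suminf_eq_infsum[OF o1] suminf_eq_infsum[OF o2] .
qed

text \<open>
  Expand \<open>1 / ((p\<^sub>l - s) (q\<^sub>k - s)) = (1 / (p\<^sub>l - s) - 1 / (q\<^sub>k - s)) / (q\<^sub>k - p\<^sub>l)\<close> and sum both parts over
  \<open>k\<close> and \<open>l\<close>.  In the second part the order of summation has to be reversed; the double series
  converges absolutely, since its sums over \<open>l\<close> are uniformly bounded by admissibility.
\<close>

lemma pole_series_mult:
  assumes c: "admissible c" and d: "admissible d" and pq: "q - p \<notin> \<int>"
    and s: "\<And>l. s \<noteq> p + of_nat l" "\<And>l. s \<noteq> q + of_nat l"
  shows "pole_series p c s * pole_series q d s =
         pole_series p (\<lambda>l. c l * pole_series q d (p + of_nat l)) s +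
         pole_series q (\<lambda>k. d k * pole_series p c (q + of_nat k)) s"
proof -
  have qp: "p - q \<notin> \<int>" using pq by (metis minus_diff_eq minus_in_Ints_iff)
  define P where "P = (\<lambda>l. p + of_nat l :: complex)"
  define Q where "Q = (\<lambda>k. q + of_nat k :: complex)"
  have nz: "P l - s \<noteq> 0" "Q k - s \<noteq> 0" "Q k - P l \<noteq> 0" "P l - Q k \<noteq> 0" for k l
    using s[of l] s[of k] nat_diff_nonzero[OF pq, of k l] nat_diff_nonzero[OF qp, of l k]
    by (auto simp: P_def Q_def)
  obtain M where M: "\<And>k. (\<Sum>l. norm (c l / (P l - Q k))) \<le> M" "\<And>k. norm (pole_series p c (Q k)) \<le> M"
    using pole_series_bounded[OF c qp] unfolding P_def Q_def by metis
  obtain M' where M': "\<And>l. norm (pole_series q d (P l)) \<le> M'"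
    using pole_series_bounded[OF d pq] unfolding P_def Q_def by metis
  have neq: "Q k \<noteq> P l" "P l \<noteq> Q k" "s \<noteq> P l" "s \<noteq> Q k" for k l
    using nz(3)[of k l] s by (auto simp: P_def Q_def)
  have ps_d: "pole_series q d w = (\<Sum>k. d k / (Q k - w))" for w
    by (simp add: pole_series_def Q_def)
  have scQ: "summable (\<lambda>l. norm (c l / (P l - Q k)))" for k
    using pole_series_summable[OF c, of "Q k" p] neq(1) by (simp add: P_def)
  have sdP: "summable (\<lambda>k. norm (d k / (Q k - P l)))" for l
    using pole_series_summable[OF d, of "P l" q] neq(2) by (simp add: Q_def)
  have sds: "summable (\<lambda>k. norm (d k / (Q k - s)))"
    using pole_series_summable[OF d, of s q] neq(4) by (simp add: Q_def)
  have scs: "summable (\<lambda>l. norm (c l / (P l - s)))"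
    using pole_series_summable[OF c, of s p] neq(3) by (simp add: P_def)
  define f where "f = (\<lambda>k l. d k / (Q k - s) * (c l / (P l - Q k)))"
  have row: "summable (\<lambda>l. norm (f k l))" for k
    unfolding f_def norm_mult[of "d k / _"] by (intro summable_mult scQ)
  have rowsum: "(\<Sum>l. norm (f k l)) = norm (d k / (Q k - s)) * (\<Sum>l. norm (c l / (P l - Q k)))" for k
    unfolding f_def norm_mult[of "d k / _"] by (intro suminf_mult scQ)
  have total: "summable (\<lambda>k. \<Sum>l. norm (f k l))"
  proof (rule summable_comparison_test')
    show "summable (\<lambda>k. norm (d k / (Q k - s)) * M)" by (intro summable_mult2 sds)
    fix k
    show "norm (\<Sum>l. norm (f k l)) \<le> norm (d k / (Q k - s)) * M"
      using suminf_nonneg[OF row[of k]] M(1)[of k] unfolding rowsum by (simp add: mult_left_mono)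
  qed
  have f_k: "(\<Sum>l. f k l) = d k * pole_series p c (Q k) / (Q k - s)" for k
  proof -
    have "summable (\<lambda>l. c l / (P l - Q k))"
      by (rule summable_norm_cancel[OF scQ])
    from suminf_mult[OF this, of "d k / (Q k - s)"] show ?thesis
      unfolding f_def by (simp add: pole_series_def P_def)
  qed
  have f_l: "(\<Sum>k. f k l) = c l / (P l - s) * pole_series q d s - c l * pole_series q d (P l) / (P l - s)" for l
  proof -
    have pf: "f k l = c l / (P l - s) * (d k / (Q k - s)) - c l / (P l - s) * (d k / (Q k - P l))" for k
    proof -
      have "1 / (Q k - s) * (1 / (P l - Q k)) = 1 / (P l - s) * (1 / (Q k - s)) - 1 / (P l - s) * (1 / (Q k - P l))"
        using nz(1)[of l] nz(2)[of k] nz(3,4)[of k l] by (simp add: divide_simps) (simp add: algebra_simps)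
      from arg_cong[OF this, of "\<lambda>x. d k * c l * x"] show ?thesis
        by (simp add: f_def algebra_simps)
    qed
    have "(\<lambda>k. f k l) sums (c l / (P l - s) * pole_series q d s - c l / (P l - s) * pole_series q d (P l))"
      unfolding pf ps_d
      by (intro sums_diff sums_mult summable_sums summable_norm_cancel[OF sds] summable_norm_cancel[OF sdP])
    then show ?thesis by (simp add: sums_iff)
  qed
  have "pole_series q (\<lambda>k. d k * pole_series p c (q + of_nat k)) s = (\<Sum>k. \<Sum>l. f k l)"
    unfolding f_k by (simp add: pole_series_def Q_def)
  also have "\<dots> = (\<Sum>l. \<Sum>k. f k l)" by (rule suminf_swap[OF row total])
  also have "\<dots> = pole_series p c s * pole_series q d s - pole_series p (\<lambda>l. c l * pole_series q d (p + of_nat l)) s"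
  proof -
    have "(\<lambda>l. c l * pole_series q d (P l) / (P l - s)) sums pole_series p (\<lambda>l. c l * pole_series q d (p + of_nat l)) s"
    proof -
      have "admissible (\<lambda>l. c l * pole_series q d (p + of_nat l))"
        by (rule admissible_mult_bounded[OF c, of _ M']) (use M' in \<open>simp add: P_def\<close>)
      from summable_sums[OF summable_norm_cancel[OF pole_series_summable[OF this s(1)]]]
      show ?thesis unfolding pole_series_def[of p "\<lambda>l. c l * pole_series q d (p + of_nat l)"] P_def .
    qed
    moreover have "(\<lambda>l. c l / (P l - s) * pole_series q d s) sums (pole_series p c s * pole_series q d s)"
    proof -
      have "pole_series p c s = (\<Sum>l. c l / (P l - s))" by (simp add: pole_series_def P_def)
      then show ?thesis using sums_mult2[OF summable_sums[OF summable_norm_cancel[OF scs]]] by metis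
    qed
    ultimately have "(\<lambda>l. \<Sum>k. f k l) sums (pole_series p c s * pole_series q d s - pole_series p (\<lambda>l. c l * pole_series q d (p + of_nat l)) s)"
      unfolding f_l by (intro sums_diff)
    then show ?thesis by (simp add: sums_iff)
  qed
  finally show ?thesis by simp
qed

text \<open>
  Induction on the number of factors.  As the new progression of poles differs from each old one by
  a non-integer, all poles stay simple, and the new coefficients are the old ones multiplied by
  bounded values of the other series.
\<close>

lemma Gamma_quotient_partial_fractions:
  assumes "finite J" "J \<noteq> {}"
    and "\<And>j. j \<in> J \<Longrightarrow> Re (b j) < Re (a j)"
    and "\<And>i j. i \<in> J \<Longrightarrow> j \<in> J \<Longrightarrow> i \<noteq> j \<Longrightarrow> b i - b j \<notin> \<int>"
  obtains c where "\<And>j. j \<in> J \<Longrightarrow> admissible (c j)"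
    "\<And>s. (\<And>j l. j \<in> J \<Longrightarrow> s \<noteq> b j + of_nat l) \<Longrightarrow>
       (\<Prod>j\<in>J. Gamma (b j - s) / Gamma (a j - s)) = (\<Sum>j\<in>J. pole_series (b j) (c j) s)"
proof -
  have single: "pole_series (b j) (beta_coeff (a j - b j)) s = Gamma (b j - s) / Gamma (a j - s)"
    if "j \<in> J" "\<And>l. s \<noteq> b j + of_nat l" for j s
  proof -
    have 1: "Re (a j - b j) > 0" using assms(3)[OF that(1)] by simp
    have 2: "(b j - s) + of_nat l \<noteq> 0" for l using that(2)[of l] by (auto simp: algebra_simps)
    show ?thesis
      using beta_partial_fractions[OF 1 2] 
      by (simp add: pole_series_def rGamma_inverse_Gamma divide_inverse algebra_simps)
  qed
  have "\<exists>c. (\<forall>j\<in>J. admissible (c j)) \<and> (\<forall>s. (\<forall>j\<in>J. \<forall>l. s \<noteq> b j + of_nat l) \<longrightarrow>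
       (\<Prod>j\<in>J. Gamma (b j - s) / Gamma (a j - s)) = (\<Sum>j\<in>J. pole_series (b j) (c j) s))"
    using assms(1,2,3,4) single
  proof (induction J rule: finite_ne_induct)
    case (singleton i)
    have "admissible (beta_coeff (a i - b i))"
      using singleton.prems(1)[of i] by (intro admissible_beta_coeff) simp
    then show ?case
      using singleton.prems(3) by (intro exI[of _ "\<lambda>_. beta_coeff (a i - b i)"]) auto
  next
    case (insert i J)
    have "\<exists>c. (\<forall>j\<in>J. admissible (c j)) \<and> (\<forall>s. (\<forall>j\<in>J. \<forall>l. s \<noteq> b j + of_nat l) \<longrightarrow>
       (\<Prod>j\<in>J. Gamma (b j - s) / Gamma (a j - s)) = (\<Sum>j\<in>J. pole_series (b j) (c j) s))"
      by (rule insert.IH) (use insert.prems in blast)+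
    then obtain c where c: "\<And>j. j \<in> J \<Longrightarrow> admissible (c j)"
       "\<And>s. (\<And>j l. j \<in> J \<Longrightarrow> s \<noteq> b j + of_nat l) \<Longrightarrow>
       (\<Prod>j\<in>J. Gamma (b j - s) / Gamma (a j - s)) = (\<Sum>j\<in>J. pole_series (b j) (c j) s)"
      by blast
    define d where "d = beta_coeff (a i - b i)"
    have d: "admissible d"
      unfolding d_def using insert.prems(1)[of i] by (intro admissible_beta_coeff) simp
    define C where "C = (\<lambda>j. if j = i then (\<lambda>k. d k * (\<Sum>j\<in>J. pole_series (b j) (c j) (b i + of_nat k)))
        else (\<lambda>l. c j l * pole_series (b i) d (b j + of_nat l)))"
    have ij: "b i - b j \<notin> \<int>" "b j - b i \<notin> \<int>" if "j \<in> J" for j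
      using insert.prems(2)[of i j] insert.prems(2)[of j i] insert.hyps that by auto
    have bd: "\<exists>M. \<forall>k. norm (pole_series (b j) (c j) (b i + of_nat k)) \<le> M" if "j \<in> J" for j
      using pole_series_bounded[OF c(1)[OF that] ij(2)[OF that]] by metis
    then obtain M where M: "\<And>j k. j \<in> J \<Longrightarrow> norm (pole_series (b j) (c j) (b i + of_nat k)) \<le> M j"
      by metis
    have adm: "admissible (C j)" if "j \<in> insert i J" for j
    proof (cases "j = i")
      case True
      have "norm (\<Sum>j\<in>J. pole_series (b j) (c j) (b i + of_nat k)) \<le> (\<Sum>j\<in>J. M j)" for k
        by (intro sum_norm_le M)
      from admissible_mult_bounded[OF d this] show ?thesis using True by (simp add: C_def)
    next
      case False
      then have j: "j \<in> J" using that by simp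
      obtain M' where "\<And>l. norm (pole_series (b i) d (b j + of_nat l)) \<le> M'"
        using pole_series_bounded[OF d ij(1)[OF j]] by metis
      from admissible_mult_bounded[OF c(1)[OF j] this] show ?thesis using False by (simp add: C_def)
    qed
    have "(\<Prod>j\<in>insert i J. Gamma (b j - s) / Gamma (a j - s)) = (\<Sum>j\<in>insert i J. pole_series (b j) (C j) s)"
      if s: "\<And>j l. j \<in> insert i J \<Longrightarrow> s \<noteq> b j + of_nat l" for s
    proof -
      have "(\<Prod>j\<in>insert i J. Gamma (b j - s) / Gamma (a j - s)) = pole_series (b i) d s * (\<Sum>j\<in>J. pole_series (b j) (c j) s)"
        using insert.hyps s c(2)[of s] insert.prems(3)[of i s] by (simp add: d_def)
      also have "\<dots> = (\<Sum>j\<in>J. pole_series (b j) (c j) s * pole_series (b i) d s)"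
        by (simp add: sum_distrib_left mult.commute)
      also have "\<dots> = (\<Sum>j\<in>J. pole_series (b j) (C j) s + pole_series (b i) (\<lambda>k. d k * pole_series (b j) (c j) (b i + of_nat k)) s)"
      proof (intro sum.cong refl)
        fix j assume j: "j \<in> J"
        then have "j \<noteq> i" using insert.hyps by auto
        then show "pole_series (b j) (c j) s * pole_series (b i) d s =
           pole_series (b j) (C j) s + pole_series (b i) (\<lambda>k. d k * pole_series (b j) (c j) (b i + of_nat k)) s"
          using pole_series_mult[OF c(1)[OF j] d ij(1)[OF j] s[OF insertI2[OF j]] s[OF insertI1]] by (simp add: C_def)
      qed
      also have "\<dots> = (\<Sum>j\<in>J. pole_series (b j) (C j) s) + pole_series (b i) (C i) s"
      proof -
        have sm: "summable (\<lambda>k. d k * pole_series (b j) (c j) (b i + of_nat k) / (b i + of_nat k - s))" if j: "j \<in> J" for j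
        proof -
          have "admissible (\<lambda>k. d k * pole_series (b j) (c j) (b i + of_nat k))"
            by (rule admissible_mult_bounded[OF d M[OF j]])
          from summable_norm_cancel[OF pole_series_summable[OF this s[OF insertI1]]] show ?thesis by simp
        qed
        have "(\<Sum>j\<in>J. pole_series (b i) (\<lambda>k. d k * pole_series (b j) (c j) (b i + of_nat k)) s)
            = (\<Sum>k. \<Sum>j\<in>J. d k * pole_series (b j) (c j) (b i + of_nat k) / (b i + of_nat k - s))"
          using suminf_sum[of J "\<lambda>j k. d k * pole_series (b j) (c j) (b i + of_nat k) / (b i + of_nat k - s)", OF sm]
          by (simp only: pole_series_def[of "b i"])
        also have "\<dots> = pole_series (b i) (C i) s"
        proof -
          have "C i = (\<lambda>k. d k * (\<Sum>j\<in>J. pole_series (b j) (c j) (b i + of_nat k)))" by (simp add: C_def)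
          then show ?thesis by (simp only: pole_series_def[of "b i"] sum_distrib_left sum_divide_distrib)
        qed
        finally show ?thesis by (simp add: sum.distrib)
      qed
      also have "\<dots> = (\<Sum>j\<in>insert i J. pole_series (b j) (C j) s)"
        using insert.hyps by simp
      finally show ?thesis .
    qed
    then show ?case using adm by blast
  qed
  then show ?thesis using that by metis
qed

section \<open>The integral over the loop of the Meijer function\<close>

text \<open>
  The loop of the Meijer function, truncated at \<open>Re s = N\<close>.
\<close>

definition hairpin :: "real \<Rightarrow> real \<Rightarrow> real \<Rightarrow> real \<Rightarrow> complex" where
  "hairpin c h N = linepath (Complex N (- h)) (Complex c (- h)) +++
     linepath (Complex c (- h)) (Complex c h) +++ linepath (Complex c h) (Complex N h)"

lemma path_image_hairpin:
  assumes "c \<le> N" "0 \<le> h"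
  shows "path_image (hairpin c h N) =
    {s. Re s = c \<and> \<bar>Im s\<bar> \<le> h} \<union> {s. \<bar>Im s\<bar> = h \<and> c \<le> Re s \<and> Re s \<le> N}"
  using assms unfolding hairpin_def
  by (auto simp: path_image_join closed_segment_same_Re closed_segment_same_Im closed_segment_eq_real_ivl abs_if split: if_splits)

lemma contour_integral_hairpin:
  assumes "continuous_on (path_image (hairpin c h N)) F"
  shows "F contour_integrable_on hairpin c h N"
    "contour_integral (hairpin c h N) F =
      - contour_integral (linepath (Complex c (- h)) (Complex N (- h))) F
      + contour_integral (linepath (Complex c (- h)) (Complex c h)) F
      + contour_integral (linepath (Complex c h) (Complex N h)) F"
proof -
  have "path_image (hairpin c h N) = closed_segment (Complex N (- h)) (Complex c (- h)) \<union>
     closed_segment (Complex c (- h)) (Complex c h) \<union> closed_segment (Complex c h) (Complex N h)"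
    unfolding hairpin_def by (simp add: path_image_join Un_assoc)
  then have cont: "continuous_on (closed_segment (Complex N (- h)) (Complex c (- h))) F"
     "continuous_on (closed_segment (Complex c (- h)) (Complex c h)) F"
     "continuous_on (closed_segment (Complex c h) (Complex N h)) F"
    using assms by (auto intro: continuous_on_subset)
  note int = cont[THEN contour_integrable_continuous_linepath]
  show "F contour_integrable_on hairpin c h N"
    unfolding hairpin_def using int by (intro contour_integrable_joinI) auto
  show "contour_integral (hairpin c h N) F =
      - contour_integral (linepath (Complex c (- h)) (Complex N (- h))) F
      + contour_integral (linepath (Complex c (- h)) (Complex c h)) F
      + contour_integral (linepath (Complex c h) (Complex N h)) F"
    unfolding hairpin_def using int contour_integral_reverse_linepath[OF cont(1)]
    by (simp add: contour_integrable_joinI)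
qed

text \<open>
  The growth \<open>1 + |s|\<close> is what a partial fraction \<open>1 / (p - s)\<close> costs if it is to be bounded by
  \<open>1 / (1 + |p|)\<close> on a contour that passes at bounded distance from the poles.
\<close>

definition dominated :: "real \<Rightarrow> real \<Rightarrow> complex set \<Rightarrow> (complex \<Rightarrow> complex) \<Rightarrow> bool" where
  "dominated t \<eta> S F \<longleftrightarrow>
     continuous_on S F \<and> (\<forall>s\<in>S. norm (F s) \<le> \<eta> * (1 + norm s) * t powr Re s)"

text \<open>
  Exponential decay of \<open>t\<^bsup>Re s\<^esup>\<close> along the leg absorbs the linear factor.  The constant does not
  depend on \<open>N\<close>, so that summation over the poles can be interchanged with \<open>N \<rightarrow> \<infinity>\<close>.
\<close>

lemma leg_integral_bound:
  fixes t c h y :: real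
  assumes t: "0 < t" "t < 1" and y: "\<bar>y\<bar> = h"
  obtains K where "K \<ge> 0" "\<And>\<eta> F N. \<lbrakk>c < N; \<eta> \<ge> 0; dominated t \<eta> (closed_segment (Complex c y) (Complex N y)) F\<rbrakk>
      \<Longrightarrow> norm (contour_integral (linepath (Complex c y) (Complex N y)) F) \<le> K * \<eta>"
proof -
  \<comment> \<open>Half of the decay rate is spent on the linear factor.\<close>
  define r where "r = - ln t / 2"
  have r: "r > 0" using t by (simp add: r_def)
  define K where "K = (1 + h + \<bar>c\<bar> + 1 / r) * exp (- r * c)"
  have h: "h \<ge> 0" using y by auto
  have K: "K \<ge> 0" using r h by (simp add: K_def)
  have growth: "(1 + norm (Complex x y)) * t powr x \<le> K * exp (- r * x)" if "x \<ge> c" for x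
  proof -
    have "norm (Complex x y) \<le> \<bar>x\<bar> + h" using cmod_le[of "Complex x y"] y by simp
    then have "1 + norm (Complex x y) \<le> (1 + h + \<bar>c\<bar>) + 1 / r * (r * (x - c))"
      using that r by simp
    also have "\<dots> \<le> (1 + h + \<bar>c\<bar>) * exp (r * (x - c)) + 1 / r * exp (r * (x - c))"
    proof (rule add_mono)
      have "1 \<le> exp (r * (x - c))" using that r by simp
      then show "1 + h + \<bar>c\<bar> \<le> (1 + h + \<bar>c\<bar>) * exp (r * (x - c))"
        using mult_left_mono[of 1 "exp (r * (x - c))" "1 + h + \<bar>c\<bar>"] h by simp
      have "r * (x - c) \<le> exp (r * (x - c))" using exp_ge_add_one_self[of "r * (x - c)"] by linarith
      then show "1 / r * (r * (x - c)) \<le> 1 / r * exp (r * (x - c))"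
        using r by (intro mult_left_mono) auto
    qed
    finally have "1 + norm (Complex x y) \<le> (1 + h + \<bar>c\<bar> + 1 / r) * exp (r * (x - c))"
      by (simp add: distrib_right)
    then have "(1 + norm (Complex x y)) * t powr x \<le> (1 + h + \<bar>c\<bar> + 1 / r) * exp (r * (x - c)) * t powr x"
      by (rule mult_right_mono) simp
    also have "\<dots> = K * exp (- r * x)"
    proof -
      have "t powr x = exp (- 2 * r * x)" using t by (simp add: powr_def r_def)
      then show ?thesis
        unfolding K_def mult.assoc by (simp add: exp_add[symmetric] algebra_simps)
    qed
    finally show ?thesis .
  qed
  show ?thesis
  proof (rule that[of "K * (exp (- r * c) / r)"])
    show "0 \<le> K * (exp (- r * c) / r)" using K r by simp
    fix \<eta> N :: real and F :: "complex \<Rightarrow> complex"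
    assume N: "c < N" and \<eta>: "\<eta> \<ge> 0" and dom: "dominated t \<eta> (closed_segment (Complex c y) (Complex N y)) F"
    have cont: "continuous_on (closed_segment (Complex c y) (Complex N y)) F"
      and bound: "\<And>s. s \<in> closed_segment (Complex c y) (Complex N y) \<Longrightarrow> norm (F s) \<le> \<eta> * (1 + norm s) * t powr Re s"
      using dom unfolding dominated_def by blast+
    define x where "x = (\<lambda>u. c + u * (N - c))"
    have lp: "linepath (Complex c y) (Complex N y) u = Complex (x u) y" for u
      by (simp add: linepath_def x_def complex_eq_iff algebra_simps)
    have mem: "Complex (x u) y \<in> closed_segment (Complex c y) (Complex N y)" if "u \<in> {0..1}" for u
      using that lp[of u] by (metis linepath_in_path atLeastAtMost_iff)
    have len: "Complex N y - Complex c y = of_real (N - c)"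
      by (simp add: complex_eq_iff)
    have "F contour_integrable_on linepath (Complex c y) (Complex N y)"
      by (rule contour_integrable_continuous_linepath[OF cont])
    then have int: "(\<lambda>u. F (Complex (x u) y) * of_real (N - c)) integrable_on {0..1}"
      and eq: "contour_integral (linepath (Complex c y) (Complex N y)) F = integral {0..1} (\<lambda>u. F (Complex (x u) y) * of_real (N - c))"
      by (simp_all add: contour_integrable_on contour_integral_integral lp len)
    have ftc: "((\<lambda>u. K * \<eta> * exp (- r * x u) * (N - c)) has_integral
        (K * \<eta> * (- exp (- r * x 1) / r) - K * \<eta> * (- exp (- r * x 0) / r))) {0..1}"
      using N r unfolding x_def by (intro fundamental_theorem_of_calculus)
        (auto simp: has_real_derivative_iff_has_vector_derivative[symmetric] intro!: derivative_eq_intros)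
    have "norm (contour_integral (linepath (Complex c y) (Complex N y)) F) \<le> integral {0..1} (\<lambda>u. K * \<eta> * exp (- r * x u) * (N - c))"
      unfolding eq
    proof (rule Henstock_Kurzweil_Integration.integral_norm_bound_integral[OF int has_integral_integrable[OF ftc]])
      fix u :: real assume u: "u \<in> {0..1}"
      then have xu: "x u \<ge> c" using N by (simp add: x_def)
      have "norm (F (Complex (x u) y)) \<le> \<eta> * ((1 + norm (Complex (x u) y)) * t powr x u)"
        using bound[OF mem[OF u]] by (simp add: mult.assoc)
      also have "\<dots> \<le> \<eta> * (K * exp (- r * x u))"
        using growth[OF xu] \<eta> by (intro mult_left_mono) auto
      finally have "norm (F (Complex (x u) y)) * (N - c) \<le> \<eta> * (K * exp (- r * x u)) * (N - c)"
        using N by (intro mult_right_mono) auto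
      moreover have "norm (of_real (N - c) :: complex) = N - c" unfolding norm_of_real using N by simp
      ultimately show "norm (F (Complex (x u) y) * of_real (N - c)) \<le> K * \<eta> * exp (- r * x u) * (N - c)"
        unfolding norm_mult by (simp add: mult_ac)
    qed
    also have "\<dots> = K * \<eta> * (exp (- r * c) / r) - K * \<eta> * (exp (- r * N) / r)"
      using integral_unique[OF ftc] by (simp add: x_def)
    also have "\<dots> \<le> K * \<eta> * (exp (- r * c) / r)" using K \<eta> r by simp
    finally show "norm (contour_integral (linepath (Complex c y) (Complex N y)) F) \<le> K * (exp (- r * c) / r) * \<eta>"
      by (simp add: mult_ac)
  qed
qed

lemma norm_Complex_0: "h \<ge> 0 \<Longrightarrow> norm (Complex 0 (2 * h)) = 2 * h"
  using real_sqrt_abs[of "2 * h"] by (simp add: cmod_def)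

lemma hairpin_integral_bound:
  fixes t c h :: real
  assumes t: "0 < t" "t < 1" and h: "h \<ge> 0"
  obtains K where "K \<ge> 0" "\<And>\<eta> F N. \<lbrakk>c < N; \<eta> \<ge> 0; dominated t \<eta> (path_image (hairpin c h N)) F\<rbrakk>
      \<Longrightarrow> norm (contour_integral (hairpin c h N) F) \<le> K * \<eta>"
proof -
  obtain K1 where K1: "K1 \<ge> 0" "\<And>\<eta> F N. \<lbrakk>c < N; \<eta> \<ge> 0; dominated t \<eta> (closed_segment (Complex c h) (Complex N h)) F\<rbrakk>
      \<Longrightarrow> norm (contour_integral (linepath (Complex c h) (Complex N h)) F) \<le> K1 * \<eta>"
    using leg_integral_bound[OF t, of h h c] h by auto
  obtain K2 where K2: "K2 \<ge> 0" "\<And>\<eta> F N. \<lbrakk>c < N; \<eta> \<ge> 0; dominated t \<eta> (closed_segment (Complex c (-h)) (Complex N (-h))) F\<rbrakk>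
      \<Longrightarrow> norm (contour_integral (linepath (Complex c (-h)) (Complex N (-h))) F) \<le> K2 * \<eta>"
    using leg_integral_bound[OF t, of "-h" h c] h by auto
  define K3 where "K3 = (1 + (\<bar>c\<bar> + h)) * t powr c * (2 * h)"
  have K3: "K3 \<ge> 0" using h by (simp add: K3_def)
  show ?thesis
  proof (rule that[of "K2 + K3 + K1"])
    show "0 \<le> K2 + K3 + K1" using K1(1) K2(1) K3 by simp
    fix \<eta> N :: real and F :: "complex \<Rightarrow> complex"
    assume N: "c < N" and \<eta>: "\<eta> \<ge> 0" and dom: "dominated t \<eta> (path_image (hairpin c h N)) F"
    have cont: "continuous_on (path_image (hairpin c h N)) F"
      using dom unfolding dominated_def by blast
    have im: "path_image (hairpin c h N) = closed_segment (Complex c (- h)) (Complex N (- h)) \<union>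
       closed_segment (Complex c (- h)) (Complex c h) \<union> closed_segment (Complex c h) (Complex N h)"
      unfolding hairpin_def by (simp add: path_image_join Un_assoc closed_segment_commute)
    have dom': "dominated t \<eta> S F" if "S \<subseteq> path_image (hairpin c h N)" for S
      using dom that unfolding dominated_def by (blast intro: continuous_on_subset)
    have cont': "continuous_on (closed_segment (Complex c (-h)) (Complex c h)) F"
      and bound: "\<And>s. s \<in> closed_segment (Complex c (-h)) (Complex c h) \<Longrightarrow> norm (F s) \<le> \<eta> * (1 + norm s) * t powr Re s"
      using dom'[of "closed_segment (Complex c (-h)) (Complex c h)"] unfolding im dominated_def by blast+
    have b1: "norm (contour_integral (linepath (Complex c h) (Complex N h)) F) \<le> K1 * \<eta>"
      by (rule K1(2)[OF N \<eta> dom']) (auto simp: im)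
    have b2: "norm (contour_integral (linepath (Complex c (-h)) (Complex N (-h))) F) \<le> K2 * \<eta>"
      by (rule K2(2)[OF N \<eta> dom']) (auto simp: im)
    have "norm (contour_integral (linepath (Complex c (-h)) (Complex c h)) F) \<le>
       (\<eta> * (1 + (\<bar>c\<bar> + h)) * t powr c) * norm (Complex c h - Complex c (-h))"
    proof (rule contour_integral_bound_linepath[OF contour_integrable_continuous_linepath[OF cont']])
      show "0 \<le> \<eta> * (1 + (\<bar>c\<bar> + h)) * t powr c" using \<eta> h by simp
      fix s assume s: "s \<in> closed_segment (Complex c (-h)) (Complex c h)"
      then have "Re s = c" "\<bar>Im s\<bar> \<le> h"
        using h by (auto simp: closed_segment_same_Re closed_segment_eq_real_ivl)
      then have "norm s \<le> \<bar>c\<bar> + h" using cmod_le[of s] by simp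
      then have "\<eta> * (1 + norm s) * t powr Re s \<le> \<eta> * (1 + (\<bar>c\<bar> + h)) * t powr c"
        using \<open>Re s = c\<close> \<eta> by (simp add: mult_left_mono mult_right_mono)
      then show "norm (F s) \<le> \<eta> * (1 + (\<bar>c\<bar> + h)) * t powr c"
        using bound[OF s] by simp
    qed
    also have "Complex c h - Complex c (-h) = Complex 0 (2 * h)" by (simp add: complex_eq_iff)
    also have "norm (Complex 0 (2 * h)) = 2 * h" using h by (rule norm_Complex_0)
    finally have b3: "norm (contour_integral (linepath (Complex c (-h)) (Complex c h)) F) \<le> K3 * \<eta>"
      by (simp add: K3_def mult_ac)
    have "norm (contour_integral (hairpin c h N) F) \<le> K2 * \<eta> + K3 * \<eta> + K1 * \<eta>"
      unfolding contour_integral_hairpin(2)[OF cont]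
      using b1 b2 b3 by (intro order_trans[OF norm_triangle_ineq] add_mono) auto
    then show "norm (contour_integral (hairpin c h N) F) \<le> (K2 + K3 + K1) * \<eta>"
      by (simp add: algebra_simps)
  qed
qed

text \<open>
  Closing the truncated loop by the vertical segment at \<open>Re s = N\<close> gives a rectangle around \<open>p\<close>, to
  which the formula of Cauchy applies; the segment contributes \<open>O (t\<^sup>N)\<close>.
\<close>

lemma hairpin_integral_simple_pole:
  fixes t c h :: real
  assumes t: "0 < t" "t < 1" and p: "c < Re p" "\<bar>Im p\<bar> < h"
  shows "((\<lambda>N. contour_integral (hairpin c h N) (\<lambda>s. of_real t powr s / (p - s)))
      \<longlongrightarrow> 2 * of_real pi * \<i> * of_real t powr p) at_top"
proof -
  define F where "F = (\<lambda>s. of_real t powr s / (s - p))"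
  define e where "e = (\<lambda>N. contour_integral (linepath (Complex N (- h)) (Complex N h)) F)"
  have eq: "contour_integral (hairpin c h N) (\<lambda>s. of_real t powr s / (p - s)) = 2 * of_real pi * \<i> * of_real t powr p - e N"
    if N: "N > Re p" for N
  proof -
    let ?A = "Complex c (-h)" and ?B = "Complex N (-h)" and ?C = "Complex N h" and ?D = "Complex c h"
    have "p \<in> box ?A ?C"
      using p N by (auto simp: in_box_complex_iff abs_less_iff)
    then have wn: "winding_number (rectpath ?A ?C) p = 1"
      by (rule winding_number_rectpath)
    have off: "path_image (rectpath ?A ?C) \<subseteq> UNIV - {p}"
      using p N by (subst path_image_rectpath) auto
    have hol: "(\<lambda>s. of_real t powr s) holomorphic_on UNIV"
      using t by (intro holomorphic_intros) auto
    have Cauchy: "(F has_contour_integral (2 * pi * \<i> * of_real t powr p)) (rectpath ?A ?C)"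
      unfolding F_def using Cauchy_integral_formula_convex_simple[OF convex_UNIV hol _ _ off] wn by simp
    have im: "path_image (rectpath ?A ?C) =
        closed_segment ?A ?B \<union> closed_segment ?B ?C \<union>
        closed_segment ?C ?D \<union> closed_segment ?D ?A"
      by (simp add: rectpath_def Let_def path_image_join Un_assoc)
    have cont: "continuous_on (UNIV - {p}) F"
      unfolding F_def using t by (intro continuous_intros) auto
    then have seg: "continuous_on (closed_segment ?A ?B) F"
       "continuous_on (closed_segment ?B ?C) F"
       "continuous_on (closed_segment ?C ?D) F"
       "continuous_on (closed_segment ?D ?A) F"
      using off unfolding im by (auto intro: continuous_on_subset)
    note int = seg[THEN contour_integrable_continuous_linepath]
    have "2 * pi * \<i> * of_real t powr p = contour_integral (rectpath ?A ?C) F"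
      using contour_integral_unique[OF Cauchy] by simp
    also have "\<dots> = contour_integral (linepath ?A ?B) F + (e N +
        (contour_integral (linepath ?C ?D) F + contour_integral (linepath ?D ?A) F))"
      unfolding rectpath_def Let_def e_def using int by (simp add: contour_integrable_joinI)
    also have "contour_integral (linepath ?C ?D) F = - contour_integral (linepath ?D ?C) F"
      by (rule contour_integral_reverse_linepath[OF seg(3)])
    also have "contour_integral (linepath ?D ?A) F = - contour_integral (linepath ?A ?D) F"
      by (rule contour_integral_reverse_linepath[OF seg(4)])
    finally have rect: "2 * pi * \<i> * of_real t powr p = contour_integral (linepath ?A ?B) F + (e N +
        (- contour_integral (linepath ?D ?C) F - contour_integral (linepath ?A ?D) F))"
      by simp
    have "path_image (hairpin c h N) \<subseteq> UNIV - {p}"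
      using p N by (subst path_image_hairpin) auto
    then have "continuous_on (path_image (hairpin c h N)) F"
      by (rule continuous_on_subset[OF cont])
    note hp = contour_integral_hairpin[OF this]
    have neg: "(\<lambda>s. of_real t powr s / (p - s)) = (\<lambda>s. - F s)"
      unfolding F_def by (metis minus_diff_eq minus_divide_right)
    show ?thesis
      unfolding neg contour_integral_neg hp(2) using rect by (simp add: algebra_simps)
  qed
  have "(e \<longlongrightarrow> 0) at_top"
  proof (rule Lim_null_comparison)
    have "((\<lambda>N. t powr N * (2 * h)) \<longlongrightarrow> 0 * (2 * h)) at_top"
    proof (intro tendsto_intros)
      have "((\<lambda>N. exp (N * ln t)) \<longlongrightarrow> 0) at_top"
      proof (rule filterlim_compose[OF exp_at_bot])
        have "filterlim (\<lambda>N. ln t * N) at_bot at_top"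
          using t by (intro filterlim_tendsto_neg_mult_at_bot[OF tendsto_const] filterlim_ident) simp
        then show "filterlim (\<lambda>N. N * ln t) at_bot at_top" by (simp only: mult.commute)
      qed
      then show "((\<lambda>N. t powr N) \<longlongrightarrow> 0) at_top" using t by (simp add: powr_def)
    qed
    then show "((\<lambda>N. t powr N * (2 * h)) \<longlongrightarrow> 0) at_top" by simp
    show "\<forall>\<^sub>F N in at_top. norm (e N) \<le> t powr N * (2 * h)"
      using eventually_ge_at_top[of "Re p + 1"]
    proof eventually_elim
      case (elim N)
      have cont: "continuous_on (closed_segment (Complex N (-h)) (Complex N h)) F"
        unfolding F_def using t elim by (intro continuous_intros) (auto simp: closed_segment_same_Re)
      have "norm (e N) \<le> t powr N * norm (Complex N h - Complex N (-h))"
        unfolding e_def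
      proof (rule contour_integral_bound_linepath[OF contour_integrable_continuous_linepath[OF cont]])
        fix s assume "s \<in> closed_segment (Complex N (-h)) (Complex N h)"
        then have "Re s = N" by (auto simp: closed_segment_same_Re)
        then have "norm (s - p) \<ge> 1" using elim complex_Re_le_cmod[of "s - p"] by simp
        then have "norm (of_real t powr s) / norm (s - p) \<le> norm (of_real t powr s) / 1"
          by (intro divide_left_mono) auto
        then show "norm (F s) \<le> t powr N"
          using t \<open>Re s = N\<close> by (simp add: F_def norm_divide norm_powr_real_powr)
      qed simp
      moreover have "norm (Complex N h - Complex N (-h)) = 2 * h"
      proof -
        have "Complex N h - Complex N (-h) = Complex 0 (2 * h)" by (simp add: complex_eq_iff)
        then show ?thesis using norm_Complex_0[of h] p by simp
      qed
      ultimately show ?case by simp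
    qed
  qed
  then have "((\<lambda>N. 2 * of_real pi * \<i> * of_real t powr p - e N) \<longlongrightarrow> 2 * of_real pi * \<i> * of_real t powr p - 0) at_top"
    by (intro tendsto_intros)
  moreover have "\<forall>\<^sub>F N in at_top. 2 * of_real pi * \<i> * of_real t powr p - e N =
      contour_integral (hairpin c h N) (\<lambda>s. of_real t powr s / (p - s))"
    using eventually_gt_at_top[of "Re p"] by eventually_elim (simp add: eq)
  ultimately show ?thesis using Lim_transform_eventually by fastforce
qed

lemma admissible_weighted_summable:
  assumes "admissible c"
  shows "summable (\<lambda>l. norm (c l) / (1 + real l))"
proof -
  obtain B where B: "\<And>l. summable (\<lambda>k. norm (c k) / (1 + \<bar>real k - real l\<bar>))"
    using admissible_summable[OF assms] by metis
  show ?thesis using B[of 0] by simp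
qed

text \<open>
  After removal of the first \<open>L\<close> poles of each progression the integrand is at most
  \<open>\<eta>\<^sub>L (1 + |s|) t\<^bsup>Re s\<^esup>\<close> on the loop, where \<open>\<eta>\<^sub>L\<close> is a tail of a convergent series, because the loop stays
  at distance at least \<open>1\<close> from every pole.  Hence the integrals of the partial sums converge
  uniformly in \<open>N\<close>, and the limits \<open>L \<rightarrow> \<infinity>\<close> and \<open>N \<rightarrow> \<infinity>\<close> may be exchanged.
\<close>

lemma hairpin_integral_pole_series:
  fixes t c h :: real and b :: "'i \<Rightarrow> complex"
  assumes t: "0 < t" "t < 1" and J: "finite J"
    and adm: "\<And>j. j \<in> J \<Longrightarrow> admissible (d j)"
    and b: "\<And>j. j \<in> J \<Longrightarrow> c + 1 \<le> Re (b j)" "\<And>j. j \<in> J \<Longrightarrow> \<bar>Im (b j)\<bar> + 1 \<le> h" "h \<ge> 0"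
    and cont: "\<And>N. c < N \<Longrightarrow> continuous_on (path_image (hairpin c h N)) \<Phi>"
    and \<Phi>: "\<And>s N. c < N \<Longrightarrow> s \<in> path_image (hairpin c h N) \<Longrightarrow> \<Phi> s = (\<Sum>j\<in>J. pole_series (b j) (d j) s)"
    and sum: "\<And>j. j \<in> J \<Longrightarrow> summable (\<lambda>l. d j l * of_real t powr (b j + of_nat l))"
  shows "((\<lambda>N. contour_integral (hairpin c h N) (\<lambda>s. \<Phi> s * of_real t powr s)) \<longlongrightarrow>
     2 * of_real pi * \<i> * (\<Sum>j\<in>J. \<Sum>l. d j l * of_real t powr (b j + of_nat l))) at_top"
proof -
  let ?I = "\<lambda>N. contour_integral (hairpin c h N)" and ?S = "\<lambda>N. path_image (hairpin c h N)"
  let ?p = "\<lambda>j l. b j + of_nat l" and ?E = "\<lambda>s. of_real t powr s :: complex"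
  define f where "f = (\<lambda>L N. ?I N
     (\<lambda>s. (\<Sum>j\<in>J. \<Sum>l<L. d j l * (?E s / (?p j l - s)))))"
  obtain K where K: "K \<ge> 0" "\<And>\<eta> F N. \<lbrakk>c < N; \<eta> \<ge> 0; dominated t \<eta> (?S N) F\<rbrakk>
      \<Longrightarrow> norm (?I N F) \<le> K * \<eta>"
    using hairpin_integral_bound[OF t b(3), of c] by metis
  have dist: "norm (?p j l - s) \<ge> 1" if "j \<in> J" "s \<in> ?S N" "c < N" for j l s N
  proof -
    have "Re s = c \<or> \<bar>Im s\<bar> = h"
      using that(2) path_image_hairpin[of c N h] that(3) b(3) by auto
    then show ?thesis
      using complex_Re_le_cmod[of "?p j l - s"] abs_Im_le_cmod[of "?p j l - s"]
        b(1,2)[OF that(1)] by auto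
  qed
  have ne: "?p j l \<noteq> s" if "j \<in> J" "s \<in> ?S N" "c < N" for j l s N
    using dist[OF that, of l] by auto
  have cont_term: "continuous_on (?S N) (\<lambda>s. ?E s / (?p j l - s))"
    if "j \<in> J" "c < N" for j l N
  proof (intro continuous_intros ballI)
    fix s assume "s \<in> ?S N"
    then show "?p j l - s \<noteq> 0" using ne[OF that(1) _ that(2), of s l] by simp
  qed (use t in auto)
  have f_sum: "f L N = (\<Sum>j\<in>J. \<Sum>l<L. d j l * ?I N (\<lambda>s. ?E s / (?p j l - s)))"
    if "c < N" for L N
  proof -
    have i0: "(\<lambda>s. ?E s / (?p j l - s)) contour_integrable_on hairpin c h N"
      if "j \<in> J" for j l
      using cont_term[OF that \<open>c < N\<close>] by (rule contour_integral_hairpin(1))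
    have i1: "(\<lambda>s. d j l * (?E s / (?p j l - s))) contour_integrable_on hairpin c h N"
      if "j \<in> J" for j l
      using i0[OF that] by (rule contour_integrable_lmul)
    have i2: "(\<lambda>s. \<Sum>l<L. d j l * (?E s / (?p j l - s))) contour_integrable_on hairpin c h N"
      if "j \<in> J" for j
      by (intro contour_integrable_sum i1 that) auto
    have "f L N = (\<Sum>j\<in>J. ?I N (\<lambda>s. \<Sum>l<L. d j l * (?E s / (?p j l - s))))"
      unfolding f_def by (rule contour_integral_sum[OF J i2])
    also have "\<dots> = (\<Sum>j\<in>J. \<Sum>l<L. ?I N (\<lambda>s. d j l * (?E s / (?p j l - s))))"
      by (intro sum.cong refl contour_integral_sum i1) auto
    also have "\<dots> = (\<Sum>j\<in>J. \<Sum>l<L. d j l * ?I N (\<lambda>s. ?E s / (?p j l - s)))"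
      by (intro sum.cong refl contour_integral_lmul i0)
    finally show ?thesis .
  qed
  define g where "g = (\<lambda>L. \<Sum>j\<in>J. \<Sum>l<L. d j l * (2 * of_real pi * \<i> * ?E (?p j l)))"
  have lim_N: "((\<lambda>N. f L N) \<longlongrightarrow> g L) at_top" for L
  proof -
    have "((\<lambda>N. \<Sum>j\<in>J. \<Sum>l<L. d j l * ?I N (\<lambda>s. ?E s / (?p j l - s))) \<longlongrightarrow> g L) at_top"
      unfolding g_def
    proof (intro tendsto_sum tendsto_mult tendsto_const hairpin_integral_simple_pole t)
      fix j l assume "j \<in> J"
      then show "c < Re (?p j l)" "\<bar>Im (?p j l)\<bar> < h"
        using b(1)[of j] b(2)[of j] by auto
    qed
    moreover have "\<forall>\<^sub>F N in at_top. (\<Sum>j\<in>J. \<Sum>l<L. d j l * ?I N (\<lambda>s. ?E s / (?p j l - s))) = f L N"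
      using eventually_gt_at_top[of c] by eventually_elim (simp add: f_sum)
    ultimately show ?thesis by (rule Lim_transform_eventually)
  qed
  have lim_L: "g \<longlonglongrightarrow> (\<Sum>j\<in>J. \<Sum>l. d j l * (2 * of_real pi * \<i> * ?E (?p j l)))"
    unfolding g_def
  proof (intro tendsto_sum summable_LIMSEQ)
    fix j assume "j \<in> J"
    from summable_mult[OF sum[OF this], of "2 * of_real pi * \<i>"]
    show "summable (\<lambda>l. d j l * (2 * of_real pi * \<i> * ?E (?p j l)))"
      by (simp add: mult_ac)
  qed
  define \<eta> where "\<eta> = (\<lambda>L. \<Sum>j\<in>J. (2 + norm (b j)) * (\<Sum>l. norm (d j (l + L)) / (1 + real (l + L))))"
  have \<eta>: "\<eta> \<longlonglongrightarrow> (\<Sum>j\<in>J. (2 + norm (b j)) * 0)"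
    unfolding \<eta>_def
    by (intro tendsto_sum tendsto_mult tendsto_const suminf_exist_split2 admissible_weighted_summable adm)
  have \<eta>_nonneg: "\<eta> L \<ge> 0" for L
    unfolding \<eta>_def
    by (intro sum_nonneg mult_nonneg_nonneg suminf_nonneg summable_ignore_initial_segment admissible_weighted_summable adm) auto
  have rem: "norm (?I N (\<lambda>s. \<Phi> s * ?E s) - f L N) \<le> K * \<eta> L"
    if N: "c < N" for L N
  proof -
    define R where "R = (\<lambda>s. \<Phi> s * ?E s - (\<Sum>j\<in>J. \<Sum>l<L. d j l * (?E s / (?p j l - s))))"
    have c1: "continuous_on (?S N) (\<lambda>s. \<Phi> s * ?E s)"
      using t by (intro continuous_intros cont N) auto
    have c2: "continuous_on (?S N) (\<lambda>s. \<Sum>j\<in>J. \<Sum>l<L. d j l * (?E s / (?p j l - s)))"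
      by (intro continuous_on_sum continuous_on_mult continuous_on_const cont_term N)
    have "?I N (\<lambda>s. \<Phi> s * ?E s) - f L N = ?I N R"
      unfolding f_def R_def
      by (rule contour_integral_diff[symmetric]) (intro contour_integral_hairpin(1) c1 c2)+
    also have "norm \<dots> \<le> K * \<eta> L"
    proof (rule K(2)[OF N \<eta>_nonneg], unfold dominated_def, intro conjI ballI)
      show "continuous_on (?S N) R"
        unfolding R_def by (intro continuous_on_diff c1 c2)
      fix s assume s: "s \<in> ?S N"
      have sm: "summable (\<lambda>l. norm (d j l / (?p j l - s)))" if "j \<in> J" for j
        by (rule pole_series_summable[OF adm[OF that]]) (rule ne[OF that s N, symmetric])
      have "pole_series (b j) (d j) s - (\<Sum>l<L. d j l / (?p j l - s)) =
          (\<Sum>l. d j (l + L) / (?p j (l + L) - s))" if "j \<in> J" for j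
        unfolding pole_series_def
        by (rule suminf_minus_initial_segment[OF summable_norm_cancel[OF sm[OF that]], symmetric])
      then have "R s = (\<Sum>j\<in>J. \<Sum>l. d j (l + L) / (?p j (l + L) - s)) * ?E s"
      proof -
        assume *: "\<And>j. j \<in> J \<Longrightarrow> pole_series (b j) (d j) s - (\<Sum>l<L. d j l / (?p j l - s)) =
          (\<Sum>l. d j (l + L) / (?p j (l + L) - s))"
        have "R s = (\<Sum>j\<in>J. pole_series (b j) (d j) s - (\<Sum>l<L. d j l / (?p j l - s))) * ?E s"
          unfolding R_def \<Phi>[OF N s] by (simp add: sum_subtractf sum_distrib_right left_diff_distrib)
        then show ?thesis using * by simp
      qed
      moreover have "norm (\<Sum>j\<in>J. \<Sum>l. d j (l + L) / (?p j (l + L) - s)) \<le> \<eta> L * (1 + norm s)"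
        unfolding \<eta>_def sum_distrib_right
      proof (rule sum_norm_le)
        fix j assume j: "j \<in> J"
        have sm': "summable (\<lambda>l. norm (d j (l + L) / (?p j (l + L) - s)))"
          using summable_ignore_initial_segment[OF sm[OF j], of L] by simp
        have sw: "summable (\<lambda>l. norm (d j (l + L)) / (1 + real (l + L)))"
          using summable_ignore_initial_segment[OF admissible_weighted_summable[OF adm[OF j]], of L] by simp
        have "norm (\<Sum>l. d j (l + L) / (?p j (l + L) - s)) \<le> (\<Sum>l. norm (d j (l + L) / (?p j (l + L) - s)))"
          by (rule summable_norm[OF sm'])
        also have "\<dots> \<le> (\<Sum>l. (2 + norm (b j)) * (1 + norm s) * (norm (d j (l + L)) / (1 + real (l + L))))"
        proof (rule suminf_le[OF _ sm' summable_mult[OF sw]])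
          fix l
          define k where "k = l + L"
          define D where "D = norm (?p j k - s)"
          have D: "D \<ge> 1" using dist[OF j s N] by (simp add: D_def)
          have "real k = norm ((?p j k - s) + s - b j)" by simp
          also have "\<dots> \<le> D + norm s + norm (b j)" unfolding D_def
            by (intro order_trans[OF norm_triangle_ineq4] add_mono norm_triangle_ineq order_refl)
          finally have "1 + real k \<le> (2 + norm s + norm (b j)) * D"
            using D mult_left_mono[of 1 D "norm s + norm (b j)"] by (simp add: algebra_simps)
          also have "\<dots> \<le> ((2 + norm (b j)) * (1 + norm s)) * D"
            using D by (intro mult_right_mono) (simp_all add: algebra_simps)
          finally have "1 / D \<le> ((2 + norm (b j)) * (1 + norm s)) / (1 + real k)"
            using D by (simp add: field_simps)
          then have "norm (d j k) * (1 / D) \<le> norm (d j k) * (((2 + norm (b j)) * (1 + norm s)) / (1 + real k))"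
            by (intro mult_left_mono) auto
          then show "norm (d j (l + L) / (?p j (l + L) - s)) \<le> (2 + norm (b j)) * (1 + norm s) * (norm (d j (l + L)) / (1 + real (l + L)))"
            unfolding k_def[symmetric] norm_divide D_def[symmetric] by (simp add: mult_ac)
        qed
        also have "\<dots> = (2 + norm (b j)) * (\<Sum>l. norm (d j (l + L)) / (1 + real (l + L))) * (1 + norm s)"
          using suminf_mult[OF sw, of "(2 + norm (b j)) * (1 + norm s)"] by (simp add: mult_ac)
        finally show "norm (\<Sum>l. d j (l + L) / (?p j (l + L) - s)) \<le>
           (2 + norm (b j)) * (\<Sum>l. norm (d j (l + L)) / (1 + real (l + L))) * (1 + norm s)" .
      qed
      ultimately show "norm (R s) \<le> \<eta> L * (1 + norm s) * t powr Re s"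
        using t by (simp add: norm_mult norm_powr_real_powr mult_right_mono)
    qed
    finally show ?thesis .
  qed
  have "uniform_limit {c<..} f (\<lambda>N. ?I N (\<lambda>s. \<Phi> s * ?E s)) sequentially"
  proof (rule uniform_limitI)
    fix e :: real assume "e > 0"
    have "(\<lambda>L. K * \<eta> L) \<longlonglongrightarrow> K * (\<Sum>j\<in>J. (2 + norm (b j)) * 0)" by (intro tendsto_mult tendsto_const \<eta>)
    then have "\<forall>\<^sub>F L in sequentially. K * \<eta> L < e" using \<open>e > 0\<close> by (intro order_tendstoD(2)) auto
    then show "\<forall>\<^sub>F L in sequentially. \<forall>N\<in>{c<..}. dist (f L N) (?I N (\<lambda>s. \<Phi> s * ?E s)) < e"
    proof eventually_elim
      case (elim L)
      then show ?case using rem[of _ L] by (force simp: dist_norm norm_minus_commute)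
    qed
  qed
  then have "((\<lambda>N. ?I N (\<lambda>s. \<Phi> s * ?E s)) \<longlongrightarrow>
     (\<Sum>j\<in>J. \<Sum>l. d j l * (2 * of_real pi * \<i> * ?E (?p j l)))) at_top"
    using always_eventually[of "\<lambda>L. ((\<lambda>N. f L N) \<longlongrightarrow> g L) at_top" sequentially] lim_N lim_L
    by (intro swap_uniform_limit'[where f = f and g = g and F = sequentially and S = "{c<..}"])
       (simp_all add: eventually_gt_at_top)
  moreover have "(\<Sum>l. d j l * (2 * of_real pi * \<i> * ?E (?p j l))) =
      2 * of_real pi * \<i> * (\<Sum>l. d j l * ?E (?p j l))" if "j \<in> J" for j
    using suminf_mult[OF sum[OF that], of "2 * of_real pi * \<i>"] by (simp add: mult_ac)
  ultimately show ?thesis by (simp add: sum_distrib_left)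
qed

section \<open>Moments of the Meijer function\<close>

lemma powr_integral_unit:
  fixes z :: complex
  assumes "Re z > -1"
  shows "set_integrable lborel {0<..<1} (\<lambda>t. of_real t powr z)"
    "(LINT t:{0<..<1}|lborel. of_real t powr z) = 1 / (z + 1)"
    "(LINT t:{0<..<1}|lborel. norm (of_real t powr z)) = 1 / (Re z + 1)"
proof -
  have real: "((\<lambda>t. t powr Re z) has_integral (1 / (Re z + 1))) {0<..<1}"
    using has_integral_powr_from_0[of "Re z" 1] assms by (simp add: has_integral_Icc_iff_Ioo)
  then have "(\<lambda>t. t powr Re z) absolutely_integrable_on {0<..<1}"
    by (subst absolutely_integrable_on_iff_nonneg) (auto simp: has_integral_integrable)
  then have realL: "set_integrable lborel {0<..<1} (\<lambda>t. t powr Re z)"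
    unfolding set_integrable_def by (subst (asm) integrable_completion) auto
  show int: "set_integrable lborel {0<..<1} (\<lambda>t. of_real t powr z)"
  proof (rule set_integrable_bound[OF realL])
    have "continuous_on {0<..<1} (\<lambda>t::real. (of_real t :: complex) powr z)"
      by (intro continuous_intros) auto
    then show "set_borel_measurable lborel {0<..<1} (\<lambda>t::real. of_real t powr z)"
      unfolding set_borel_measurable_def by (simp add: borel_measurable_continuous_on_indicator)
    show "AE t in lborel. t \<in> {0<..<1} \<longrightarrow> norm (of_real t powr z) \<le> norm (t powr Re z)"
      by (simp add: norm_powr_real_powr)
  qed
  have "((\<lambda>t. of_real t powr z) has_integral (of_real 1 powr (z + 1) / (z + 1) - of_real 0 powr (z + 1) / (z + 1))) {0..1::real}"
  proof (rule fundamental_theorem_of_calculus_interior)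
    show "continuous_on {0..1} (\<lambda>t::real. of_real t powr (z + 1) / (z + 1))"
      using assms by (intro continuous_intros) (auto simp: complex_eq_iff)
    fix t :: real assume t: "t \<in> {0<..<1}"
    have nz: "z + 1 \<noteq> 0" using assms by (auto simp: complex_eq_iff)
    have "((\<lambda>w. w powr (z + 1) / (z + 1)) has_field_derivative (z + 1) * of_real t powr (z + 1 - 1) / (z + 1)) (at (of_real t))"
      using t by (intro DERIV_cdivide has_field_derivative_powr) auto
    then have "((\<lambda>w. w powr (z + 1) / (z + 1)) has_field_derivative of_real t powr z) (at (of_real t))"
      using nz by simp
    then show "((\<lambda>t. of_real t powr (z + 1) / (z + 1)) has_vector_derivative of_real t powr z) (at t)"
      by (rule has_vector_derivative_real_field)
  qed simp
  then have "((\<lambda>t. of_real t powr z) has_integral (1 / (z + 1))) {0<..<1::real}"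
    using assms by (simp add: has_integral_Icc_iff_Ioo)
  then show "(LINT t:{0<..<1}|lborel. of_real t powr z) = 1 / (z + 1)"
    using set_borel_integral_eq_integral(2)[OF int] by (simp add: integral_unique)
  have "(LINT t:{0<..<1}|lborel. norm (of_real t powr z)) = (LINT t:{0<..<1}|lborel. t powr Re z)"
    by (rule set_lebesgue_integral_cong) (auto simp: norm_powr_real_powr)
  also have "\<dots> = 1 / (Re z + 1)"
    using set_borel_integral_eq_integral(2)[OF realL] real by (simp add: integral_unique)
  finally show "(LINT t:{0<..<1}|lborel. norm (of_real t powr z)) = 1 / (Re z + 1)" .
qed

lemma admissible_power_series:
  fixes t :: real
  assumes "admissible d" "0 < t" "t < 1"
  shows "summable (\<lambda>l. norm (d l * of_real t powr (b + of_nat l)))"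
proof -
  have "(\<lambda>l. real l * t ^ l + t ^ l) \<longlonglongrightarrow> 0 + 0"
    using assms by (intro tendsto_add powser_times_n_limit_0 LIMSEQ_power_zero) auto
  then have "Bseq (\<lambda>l. real l * t ^ l + t ^ l)"
    by (rule convergent_imp_Bseq[OF convergentI])
  then obtain M where M: "M > 0" "\<And>l. norm (real l * t ^ l + t ^ l) \<le> M"
    by (elim BseqE) blast
  show ?thesis
  proof (rule summable_comparison_test')
    show "summable (\<lambda>l. t powr Re b * M * (norm (d l) / (1 + real l)))"
      by (intro summable_mult admissible_weighted_summable assms)
    fix l
    have "t powr (Re b + real l) = t powr Re b * t ^ l"
      using assms by (simp add: powr_add powr_realpow)
    moreover have "t ^ l \<le> M / (1 + real l)"
      using M(2)[of l] assms by (simp add: field_simps)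
    ultimately have "norm (d l) * t powr (Re b + real l) \<le> norm (d l) * (t powr Re b * (M / (1 + real l)))"
      using mult_left_mono[of "t ^ l" "M / (1 + real l)" "t powr Re b"] by (intro mult_left_mono) auto
    then show "norm (norm (d l * of_real t powr (b + of_nat l))) \<le> t powr Re b * M * (norm (d l) / (1 + real l))"
      using assms by (simp add: norm_mult norm_powr_real_powr mult_ac)
  qed
qed

text \<open>
  Termwise integration is justified by \<open>\<integral> |t\<^bsup>b+l+k\<^esup>| dt = 1 / (Re b + l + k + 1)\<close> and admissibility of
  the coefficients.
\<close>

lemma power_series_moment:
  assumes d: "admissible d" and b: "Re b > -1"
  shows "set_integrable lborel {0<..<1} (\<lambda>t. (\<Sum>l. d l * of_real t powr (b + of_nat l)) * of_real t ^ k)"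
    "(LINT t:{0<..<1}|lborel. (\<Sum>l. d l * of_real t powr (b + of_nat l)) * of_real t ^ k) = pole_series b d (- of_nat k - 1)"
proof -
  define f where "f = (\<lambda>l t. indicator {0<..<1::real} t *\<^sub>R (d l * of_real t powr (b + of_nat l + of_nat k)))"
  have re: "Re (b + of_nat l + of_nat k) > -1" for l using b by simp
  have int: "integrable lborel (f l)" for l
    using set_integrable_mult_right[OF powr_integral_unit(1)[OF re[of l]], of "d l"]
    unfolding f_def set_integrable_def by simp
  have norm_f: "(LINT t|lborel. norm (f l t)) = norm (d l) * (1 / (Re (b + of_nat l + of_nat k) + 1))" for l
  proof -
    have "(LINT t|lborel. norm (f l t)) = (LINT t:{0<..<1}|lborel. norm (d l) * norm (of_real t powr (b + of_nat l + of_nat k)))"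
      unfolding f_def set_lebesgue_integral_def by (simp add: norm_mult)
    also have "\<dots> = norm (d l) * (1 / (Re (b + of_nat l + of_nat k) + 1))"
      unfolding set_integral_mult_right powr_integral_unit(3)[OF re] by simp
    finally show ?thesis .
  qed
  have s: "- of_nat k - 1 \<noteq> b + of_nat l" for l
  proof
    assume "- of_nat k - 1 = b + of_nat l"
    from arg_cong[OF this, of Re] b show False by simp
  qed
  have sum1: "summable (\<lambda>l. LINT t|lborel. norm (f l t))"
    unfolding norm_f
  proof (rule summable_comparison_test')
    define \<kappa> where "\<kappa> = min 1 (Re b + 1)"
    have \<kappa>: "\<kappa> > 0" "\<kappa> \<le> 1" "\<kappa> \<le> Re b + 1"
      using b by (auto simp: \<kappa>_def)
    show "summable (\<lambda>l. 1 / \<kappa> * (norm (d l) / (1 + real l)))"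
      by (intro summable_mult admissible_weighted_summable d)
    fix l :: nat
    have "\<kappa> * (1 + real l) \<le> Re b + 1 + real l"
      using \<kappa> mult_right_mono[OF \<kappa>(2), of "real l"] by (simp add: distrib_left)
    then have le: "\<kappa> * (1 + real l) \<le> Re (b + of_nat l + of_nat k) + 1"
      by simp
    have "norm (d l) / (Re (b + of_nat l + of_nat k) + 1) \<le> norm (d l) / (\<kappa> * (1 + real l))"
      using \<kappa>(1) le re[of l] by (intro divide_left_mono) (auto intro!: mult_pos_pos)
    then show "norm (norm (d l) * (1 / (Re (b + of_nat l + of_nat k) + 1))) \<le> 1 / \<kappa> * (norm (d l) / (1 + real l))"
      using b by simp
  qed
  have eq: "d l * of_real t powr (b + of_nat l) * of_real t ^ k = d l * of_real t powr (b + of_nat l + of_nat k)"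
    if "t \<in> {0<..<1}" for l and t :: real
    using that by (simp add: powr_add powr_nat')
  have sum2: "AE t in lborel. summable (\<lambda>l. norm (f l t))"
  proof (rule AE_I2)
    fix t :: real
    show "summable (\<lambda>l. norm (f l t))"
    proof (cases "t \<in> {0<..<1}")
      case True
      then have "summable (\<lambda>l. norm (d l * of_real t powr (b + of_nat l)) * norm (of_real t ^ k :: complex))"
        by (intro summable_mult2 admissible_power_series d) auto
      moreover have "norm (d l * of_real t powr (b + of_nat l)) * norm (of_real t ^ k :: complex) = norm (f l t)" for l
        unfolding norm_mult[symmetric] eq[OF True] using True by (simp add: f_def)
      ultimately show ?thesis by simp
    qed (simp add: f_def)
  qed
  have pt: "(\<Sum>l. f l t) = indicator {0<..<1} t *\<^sub>R ((\<Sum>l. d l * of_real t powr (b + of_nat l)) * of_real t ^ k)" for t :: real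
  proof (cases "t \<in> {0<..<1}")
    case True
    then have "summable (\<lambda>l. d l * of_real t powr (b + of_nat l))"
      by (intro summable_norm_cancel[OF admissible_power_series[OF d]]) auto
    from suminf_mult2[OF this, of "of_real t ^ k"] eq[OF True] show ?thesis
      using True by (simp add: f_def)
  qed (simp add: f_def)
  note sums = integrable_suminf[OF int sum2 sum1] integral_suminf[OF int sum2 sum1]
  show "set_integrable lborel {0<..<1} (\<lambda>t. (\<Sum>l. d l * of_real t powr (b + of_nat l)) * of_real t ^ k)"
    using sums(1) unfolding pt set_integrable_def .
  have "(LINT t|lborel. f l t) = d l / (b + of_nat l - (- of_nat k - 1))" for l
  proof -
    have "(LINT t|lborel. f l t) = (LINT t:{0<..<1}|lborel. d l * of_real t powr (b + of_nat l + of_nat k))"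
      unfolding f_def set_lebesgue_integral_def ..
    also have "\<dots> = d l * (1 / (b + of_nat l + of_nat k + 1))"
      unfolding set_integral_mult_right powr_integral_unit(2)[OF re] by simp
    finally show ?thesis by (simp add: algebra_simps)
  qed
  then show "(LINT t:{0<..<1}|lborel. (\<Sum>l. d l * of_real t powr (b + of_nat l)) * of_real t ^ k) = pole_series b d (- of_nat k - 1)"
    using sums(2) unfolding pt set_lebesgue_integral_def pole_series_def by simp
qed

lemma meijer_loop_eq_hairpin:
  "meijer_loop n b N = hairpin (Min ((\<lambda>j. Re (b j)) ` {1..n}) - 1) (Max ((\<lambda>j. \<bar>Im (b j)\<bar>) ` {1..n}) + 1) N"
  by (simp add: meijer_loop_def hairpin_def Let_def)

text \<open>
  The conditions on \<open>b\<close> make all poles simple and keep them to the right of \<open>- 1\<close>, so that the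
  powers \<open>t\<^bsup>b+l\<^esup>\<close> are integrable and no point \<open>- k - 1\<close> is a pole.
\<close>

theorem meijer_G_moments:
  assumes n: "n \<ge> 1" and ab: "\<And>j. j \<in> {1..n} \<Longrightarrow> Re (b j) < Re (a j)"
    and b: "\<And>j. j \<in> {1..n} \<Longrightarrow> Re (b j) > -1"
    and gen: "\<And>i j. i \<in> {1..n} \<Longrightarrow> j \<in> {1..n} \<Longrightarrow> i \<noteq> j \<Longrightarrow> b i - b j \<notin> \<int>"
  shows "set_integrable lborel {0<..<1} (\<lambda>t. meijer_G n a b t)"
    "(LINT t:{0<..<1}|lborel. meijer_G n a b t * of_real t ^ k) =
       (\<Prod>j=1..n. Gamma (b j + of_nat k + 1) / Gamma (a j + of_nat k + 1))"
proof -
  obtain d where d: "\<And>j. j \<in> {1..n} \<Longrightarrow> admissible (d j)"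
    "\<And>s. (\<And>j l. j \<in> {1..n} \<Longrightarrow> s \<noteq> b j + of_nat l) \<Longrightarrow>
       (\<Prod>j=1..n. Gamma (b j - s) / Gamma (a j - s)) = (\<Sum>j=1..n. pole_series (b j) (d j) s)"
    using Gamma_quotient_partial_fractions[of "{1..n}" b a] n ab gen by (auto simp: not_le)
  define c where "c = Min ((\<lambda>j. Re (b j)) ` {1..n}) - 1"
  define h where "h = Max ((\<lambda>j. \<bar>Im (b j)\<bar>) ` {1..n}) + 1"
  have c: "c + 1 \<le> Re (b j)" if "j \<in> {1..n}" for j
    using that by (auto simp: c_def intro!: Min_le)
  have h: "\<bar>Im (b j)\<bar> + 1 \<le> h" if "j \<in> {1..n}" for j
    using that by (auto simp: h_def intro!: Max_ge)
  have h0: "h \<ge> 0" using h[of 1] n by simp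
  have series: "meijer_G n a b t = (\<Sum>j=1..n. \<Sum>l. d j l * of_real t powr (b j + of_nat l))"
    if t: "t \<in> {0<..<1}" for t
  proof -
    define \<Phi> where "\<Phi> = (\<lambda>s. \<Prod>j=1..n. Gamma (b j - s) / Gamma (a j - s))"
    have off: "b j - s \<notin> \<int>\<^sub>\<le>\<^sub>0" if s: "s \<in> path_image (hairpin c h N)" and N: "c < N" and j: "j \<in> {1..n}" for s N j
    proof
      assume "b j - s \<in> \<int>\<^sub>\<le>\<^sub>0"
      then obtain l where "b j - s = - of_nat l" by (elim nonpos_Ints_cases')
      then have "Re s = Re (b j) + real l" "Im s = Im (b j)"
        by (auto simp: complex_eq_iff)
      then show False
        using s path_image_hairpin[of c N h] N h0 c[OF j] h[OF j] by auto
    qed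
    have "((\<lambda>N. contour_integral (hairpin c h N) (\<lambda>s. \<Phi> s * of_real t powr s)) \<longlongrightarrow>
       2 * of_real pi * \<i> * (\<Sum>j=1..n. \<Sum>l. d j l * of_real t powr (b j + of_nat l))) at_top"
    proof (rule hairpin_integral_pole_series[OF _ _ _ d(1) c h h0])
      show "0 < t" "t < 1" "finite {1..n}" using t by simp_all
    next
      fix N assume N: "c < N"
      have "\<Phi> = (\<lambda>s. \<Prod>j=1..n. Gamma (b j - s) * rGamma (a j - s))"
        by (simp add: \<Phi>_def rGamma_inverse_Gamma divide_inverse)
      then show "continuous_on (path_image (hairpin c h N)) \<Phi>"
        using off[OF _ N] by (auto intro!: continuous_at_imp_continuous_on continuous_intros)
      fix s assume s: "s \<in> path_image (hairpin c h N)"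
      show "\<Phi> s = (\<Sum>j=1..n. pole_series (b j) (d j) s)"
        unfolding \<Phi>_def
      proof (rule d(2))
        fix j l assume "j \<in> {1..n}"
        then have "b j - s \<noteq> - of_nat l" using off[OF s N] by (metis minus_of_nat_in_nonpos_Ints)
        then show "s \<noteq> b j + of_nat l" by auto
      qed
    next
      fix j assume "j \<in> {1..n}"
      from admissible_power_series[OF d(1)[OF this], of t "b j"] t
      have "summable (\<lambda>l. norm (d j l * of_real t powr (b j + of_nat l)))" by simp
      then show "summable (\<lambda>l. d j l * of_real t powr (b j + of_nat l))"
        by (rule summable_norm_cancel)
    qed
    then have "Lim at_top (\<lambda>N. contour_integral (hairpin c h N) (\<lambda>s. \<Phi> s * of_real t powr s)) =
       2 * of_real pi * \<i> * (\<Sum>j=1..n. \<Sum>l. d j l * of_real t powr (b j + of_nat l))"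
      by (rule tendsto_Lim[OF trivial_limit_at_top_linorder])
    then show ?thesis
      unfolding meijer_G_def meijer_loop_eq_hairpin c_def[symmetric] h_def[symmetric] \<Phi>_def by simp
  qed
  have int: "set_integrable lborel {0<..<1} (\<lambda>t. meijer_G n a b t * of_real t ^ k)"
    and val: "(LINT t:{0<..<1}|lborel. meijer_G n a b t * of_real t ^ k) = (\<Sum>j=1..n. pole_series (b j) (d j) (- of_nat k - 1))"
    for k
  proof -
    have eq: "meijer_G n a b t * of_real t ^ k = (\<Sum>j=1..n. (\<Sum>l. d j l * of_real t powr (b j + of_nat l)) * of_real t ^ k)"
      if "t \<in> {0<..<1}" for t
      unfolding series[OF that] by (simp add: sum_distrib_right)
    have int': "set_integrable lborel {0<..<1} (\<lambda>t. (\<Sum>l. d j l * of_real t powr (b j + of_nat l)) * of_real t ^ k)"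
      if "j \<in> {1..n}" for j
      by (rule power_series_moment(1)[OF d(1)[OF that] b[OF that]])
    have "set_integrable lborel {0<..<1} (\<lambda>t. \<Sum>j=1..n. (\<Sum>l. d j l * of_real t powr (b j + of_nat l)) * of_real t ^ k)"
      using int' unfolding set_integrable_def scaleR_sum_right
      by (intro Bochner_Integration.integrable_sum) auto
    then show "set_integrable lborel {0<..<1} (\<lambda>t. meijer_G n a b t * of_real t ^ k)"
      by (subst set_integrable_cong[OF refl refl eq]) auto
    have "(LINT t:{0<..<1}|lborel. meijer_G n a b t * of_real t ^ k) =
        (LINT t:{0<..<1}|lborel. \<Sum>j=1..n. (\<Sum>l. d j l * of_real t powr (b j + of_nat l)) * of_real t ^ k)"
      by (rule set_lebesgue_integral_cong) (use eq in auto)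
    also have "\<dots> = (\<Sum>j=1..n. LINT t:{0<..<1}|lborel. (\<Sum>l. d j l * of_real t powr (b j + of_nat l)) * of_real t ^ k)"
      using int' unfolding set_lebesgue_integral_def set_integrable_def scaleR_sum_right
      by (intro Bochner_Integration.integral_sum) auto
    also have "\<dots> = (\<Sum>j=1..n. pole_series (b j) (d j) (- of_nat k - 1))"
      by (intro sum.cong refl power_series_moment(2) d b)
    finally show "(LINT t:{0<..<1}|lborel. meijer_G n a b t * of_real t ^ k) = (\<Sum>j=1..n. pole_series (b j) (d j) (- of_nat k - 1))" .
  qed
  show "set_integrable lborel {0<..<1} (\<lambda>t. meijer_G n a b t)" using int[of 0] by simp
  have s: "- of_nat k - 1 \<noteq> b j + of_nat l" if "j \<in> {1..n}" for j l
  proof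
    assume "- of_nat k - 1 = b j + of_nat l"
    from arg_cong[OF this, of Re] b[OF that] show False by simp
  qed
  show "(LINT t:{0<..<1}|lborel. meijer_G n a b t * of_real t ^ k) =
       (\<Prod>j=1..n. Gamma (b j + of_nat k + 1) / Gamma (a j + of_nat k + 1))"
  proof -
    have "(\<Prod>j=1..n. Gamma (b j - (- of_nat k - 1)) / Gamma (a j - (- of_nat k - 1))) =
        (\<Sum>j=1..n. pole_series (b j) (d j) (- of_nat k - 1))"
      by (rule d(2)) (rule s)
    moreover have "z - (- of_nat k - 1) = z + of_nat k + 1" for z :: complex by simp
    ultimately show ?thesis unfolding val by simp
  qed
qed

section \<open>Smooth functions on the union of lines\<close>

lemma eps_power: "eps m ^ j = exp (2 * of_real pi * \<i> * of_nat j / of_nat m)"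
  by (simp add: eps_def exp_of_nat_mult[symmetric] mult_ac)

lemma eps_power_eq_1_iff: "m \<ge> 1 \<Longrightarrow> eps m ^ j = 1 \<longleftrightarrow> m dvd j"
  unfolding eps_power by (rule complex_root_unity_eq_1)

lemma eps_nonzero [simp]: "eps m \<noteq> 0"
  by (simp add: eps_def)

definition line :: "nat \<Rightarrow> nat \<Rightarrow> complex set" where
  "line m j = range (\<lambda>r::real. eps m ^ j * of_real r)"

lemma lines_eq_Union_line: "lines m = (\<Union>j\<in>{1..m}. line m j)"
  by (simp add: lines_def line_def)

lemma line_closed: "closed (line m j)"
proof -
  have "line m j = {z. Im (z / eps m ^ j) = 0}"
  proof (intro set_eqI iffI)
    fix z assume "z \<in> {z. Im (z / eps m ^ j) = 0}"
    then have "z / eps m ^ j = of_real (Re (z / eps m ^ j))" by (simp add: complex_eq_iff)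
    then have "z = eps m ^ j * of_real (Re (z / eps m ^ j))" by (simp add: field_simps)
    then show "z \<in> line m j" unfolding line_def by blast
  qed (auto simp: line_def)
  then show ?thesis by (simp only:) (intro closed_Collect_eq continuous_intros, auto)
qed

lemma line_convex: "convex (line m j)"
  unfolding convex_alt
proof (intro ballI allI impI)
  fix x y and u :: real assume "x \<in> line m j" "y \<in> line m j"
  then obtain r s where "x = eps m ^ j * of_real r" "y = eps m ^ j * of_real s"
    unfolding line_def by blast
  then have "(1 - u) *\<^sub>R x + u *\<^sub>R y = eps m ^ j * of_real ((1 - u) * r + u * s)"
    by (simp add: scaleR_conv_of_real algebra_simps)
  then show "(1 - u) *\<^sub>R x + u *\<^sub>R y \<in> line m j" unfolding line_def by blast
qed

lemma lines_scale: "x \<in> lines m \<Longrightarrow> x * of_real r \<in> lines m"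
  unfolding lines_def by (fastforce simp: mult.assoc simp flip: of_real_mult)

lemma lines_zero: "m \<ge> 1 \<Longrightarrow> 0 \<in> lines m"
  unfolding lines_def by (auto intro!: bexI[of _ 1] image_eqI[of _ _ 0])

lemma lines_nonempty_imp: "x \<in> lines m \<Longrightarrow> m \<ge> 1"
  unfolding lines_def by auto

lemma lines_eps:
  assumes "x \<in> lines m"
  shows "eps m * x \<in> lines m"
proof -
  obtain j r where j: "j \<in> {1..m}" and x: "x = eps m ^ j * of_real r"
    using assms unfolding lines_def by auto
  show ?thesis
  proof (cases "j = m")
    case True
    then have "eps m ^ j = 1" using j by (simp add: eps_power_eq_1_iff)
    then have "eps m * x = eps m ^ 1 * of_real r" using x by simp
    then show ?thesis using j unfolding lines_def by (auto intro!: bexI[of _ 1])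
  next
    case False
    then have "Suc j \<in> {1..m}" "eps m * x = eps m ^ Suc j * of_real r" using j x by auto
    then show ?thesis unfolding lines_def by blast
  qed
qed

lemma lines_eps_power: "x \<in> lines m \<Longrightarrow> eps m ^ i * x \<in> lines m"
  by (induction i) (use lines_eps in \<open>auto simp: mult.assoc\<close>)

lemma closed_lines: "closed (lines m)"
  unfolding lines_eq_Union_line using line_closed by (intro closed_UN) auto

lemma segment_0_lines: "x \<in> lines m \<Longrightarrow> closed_segment 0 x \<subseteq> lines m"
  using lines_scale[of x m] by (auto simp: closed_segment_def scaleR_conv_of_real mult.commute)

text \<open>
  Lines that miss \<open>x\<close> stay away from it, so a point of the union close to \<open>x\<close> lies on a common line with
  \<open>x\<close>.  Mean value estimates are thus available although the union of the lines is not convex.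
\<close>

lemma eventually_segment_lines:
  assumes "x \<in> lines m"
  shows "\<forall>\<^sub>F y in at x within lines m. closed_segment x y \<subseteq> lines m"
proof -
  have "\<forall>\<^sub>F y in at x within lines m. x \<notin> line m j \<longrightarrow> y \<notin> line m j" for j
  proof (cases "x \<in> line m j")
    case False
    have "\<forall>\<^sub>F y in at x within lines m. y \<in> - line m j"
      using False line_closed[of m j] by (intro topological_tendstoD[OF tendsto_ident_at]) auto
    then show ?thesis by eventually_elim simp
  qed simp
  then have "\<forall>\<^sub>F y in at x within lines m. \<forall>j\<in>{1..m}. x \<notin> line m j \<longrightarrow> y \<notin> line m j"
    by (intro eventually_ball_finite) auto
  moreover have "\<forall>\<^sub>F y in at x within lines m. y \<in> lines m"
    by (simp add: eventually_at_filter)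
  ultimately show ?thesis
  proof eventually_elim
    case (elim y)
    then obtain j where j: "j \<in> {1..m}" "y \<in> line m j" unfolding lines_eq_Union_line by blast
    then have "closed_segment x y \<subseteq> line m j"
      using elim(1) line_convex by (intro closed_segment_subset) auto
    then show ?case using j(1) unfolding lines_eq_Union_line by blast
  qed
qed

lemma at_within_lines_nontrivial:
  assumes "x \<in> lines m"
  shows "at x within lines m \<noteq> bot"
proof -
  obtain j where j: "j \<in> {1..m}" "x \<in> line m j"
    using assms unfolding lines_eq_Union_line by blast
  have "eps m ^ j * of_real 0 \<in> line m j" "eps m ^ j * of_real 1 \<in> line m j"
    unfolding line_def by blast+
  then have "line m j \<noteq> {z}" for z by auto
  then have "x islimpt line m j"
    using j(2) convex_connected[OF line_convex] by (intro connected_imp_perfect) auto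
  then have "x islimpt lines m"
    by (rule islimpt_subset) (use j(1) in \<open>auto simp: lines_eq_Union_line\<close>)
  then show ?thesis by (simp add: trivial_limit_within)
qed

abbreviation derivs :: "nat \<Rightarrow> nat \<Rightarrow> (complex \<Rightarrow> complex) \<Rightarrow> complex \<Rightarrow> complex" where
  "derivs m n \<equiv> deriv_U m ^^ n"

abbreviation has_U_derivative ::
  "(complex \<Rightarrow> complex) \<Rightarrow> complex \<Rightarrow> nat \<Rightarrow> complex \<Rightarrow> bool" where
  "has_U_derivative f D m x \<equiv> (f has_field_derivative D) (at x within lines m)"

lemma deriv_U_eqI: "has_U_derivative f D m x \<Longrightarrow> x \<in> lines m \<Longrightarrow> deriv_U m f x = D"
  unfolding deriv_U_def has_field_derivative_iff by (rule tendsto_Lim[OF at_within_lines_nontrivial])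

lemma has_U_derivative_cong:
  assumes "has_U_derivative f D m x" "x \<in> lines m" "\<And>y. y \<in> lines m \<Longrightarrow> f y = g y"
  shows "has_U_derivative g D m x"
  using has_field_derivative_transform_within[OF assms(1) zero_less_one assms(2)] assms(3) by blast

lemma smooth_U_derivative:
  assumes "f \<in> smooth_U m" "x \<in> lines m"
  shows "has_U_derivative f (deriv_U m f x) m x"
proof -
  have "derivs m 0 f field_differentiable (at x within lines m)"
    using assms unfolding smooth_U_def by blast
  then obtain D where "has_U_derivative f D m x" by (auto simp: field_differentiable_def)
  with deriv_U_eqI[OF this assms(2)] show ?thesis by simp
qed

lemma smooth_U_deriv:
  assumes "f \<in> smooth_U m"
  shows "deriv_U m f \<in> smooth_U m"
  unfolding smooth_U_def
proof (intro CollectI allI ballI)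
  fix n x assume "x \<in> lines m"
  then have "derivs m (Suc n) f field_differentiable (at x within lines m)"
    using assms unfolding smooth_U_def by blast
  then show "derivs m n (deriv_U m f) field_differentiable (at x within lines m)"
    by (simp add: funpow_Suc_right del: funpow.simps)
qed

lemma smooth_U_derivs: "f \<in> smooth_U m \<Longrightarrow> derivs m n f \<in> smooth_U m"
  by (induction n) (simp_all add: smooth_U_deriv)

lemma smooth_U_I:
  assumes d: "\<And>n x. x \<in> lines m \<Longrightarrow> has_U_derivative (F n) (F (Suc n) x) m x"
    and f: "\<And>x. x \<in> lines m \<Longrightarrow> F 0 x = f x"
  shows "f \<in> smooth_U m" "\<And>x. x \<in> lines m \<Longrightarrow> derivs m n f x = F n x"
proof -
  have eq: "\<forall>x\<in>lines m. F n x = derivs m n f x" for n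
  proof (induction n)
    case (Suc n)
    show ?case
    proof
      fix x assume x: "x \<in> lines m"
      have "has_U_derivative (derivs m n f) (F (Suc n) x) m x"
        by (rule has_U_derivative_cong[OF d[OF x] x]) (use Suc.IH in auto)
      from deriv_U_eqI[OF this x] show "F (Suc n) x = derivs m (Suc n) f x" by simp
    qed
  qed (use f in auto)
  then show "\<And>x. x \<in> lines m \<Longrightarrow> derivs m n f x = F n x" by simp
  have "has_U_derivative (derivs m n f) (F (Suc n) x) m x" if x: "x \<in> lines m" for n x
    by (rule has_U_derivative_cong[OF d[OF x] x]) (use eq in auto)
  then show "f \<in> smooth_U m" unfolding smooth_U_def field_differentiable_def by blast
qed

text \<open>
  Meant for functions such as averages, rotated functions and products with \<open>x\<close>, whose derivatives are of the
  same form again, so that the higher derivatives need not be computed.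
\<close>

lemma smooth_U_coinduct:
  assumes "f \<in> X" "\<And>g. g \<in> X \<Longrightarrow> \<exists>g'\<in>X. \<forall>x\<in>lines m. has_U_derivative g (g' x) m x"
  shows "f \<in> smooth_U m"
proof -
  obtain d where d: "\<And>g. g \<in> X \<Longrightarrow> d g \<in> X \<and> (\<forall>x\<in>lines m. has_U_derivative g (d g x) m x)"
    using assms(2) by metis
  have X: "(d ^^ n) f \<in> X" for n by (induction n) (use assms(1) d in auto)
  show ?thesis
  proof (rule smooth_U_I(1)[of m "\<lambda>n. (d ^^ n) f"])
    fix n x assume "x \<in> lines m"
    then show "has_U_derivative ((d ^^ n) f) ((d ^^ Suc n) f x) m x" using d[OF X[of n]] by simp
  qed simp
qed

lemma smooth_U_cong:
  assumes "f \<in> smooth_U m" "\<And>x. x \<in> lines m \<Longrightarrow> f x = g x"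
  shows "g \<in> smooth_U m" "\<And>x. x \<in> lines m \<Longrightarrow> derivs m n g x = derivs m n f x"
proof -
  have d: "has_U_derivative (derivs m n f) (derivs m (Suc n) f x) m x" if "x \<in> lines m" for n x
    using smooth_U_derivative[OF smooth_U_derivs[OF assms(1)] that] by simp
  show "g \<in> smooth_U m" "\<And>x. x \<in> lines m \<Longrightarrow> derivs m n g x = derivs m n f x"
    using smooth_U_I[of m "\<lambda>n. derivs m n f" g] d assms(2) by auto
qed

lemma deriv_U_cong:
  assumes "\<And>x. x \<in> lines m \<Longrightarrow> f x = g x" "x \<in> lines m"
  shows "deriv_U m f x = deriv_U m g x"
proof -
  have "\<forall>\<^sub>F y in at x within lines m. y \<in> lines m" by (simp add: eventually_at_filter)
  then have "\<forall>\<^sub>F y in at x within lines m. (f y - f x) / (y - x) = (g y - g x) / (y - x)"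
    by eventually_elim (use assms in simp)
  from tendsto_cong[OF this] show ?thesis
    unfolding deriv_U_def Topological_Spaces.Lim_def by (simp only:)
qed

lemma Lim_lines_cong:
  assumes "\<And>x. x \<in> lines m \<Longrightarrow> x \<noteq> a \<Longrightarrow> f x = g x"
  shows "Lim (at a within lines m) f = Lim (at a within lines m) g"
proof -
  have "\<forall>\<^sub>F y in at a within lines m. f y = g y"
    unfolding eventually_at_filter using assms by simp
  from tendsto_cong[OF this] show ?thesis
    unfolding Topological_Spaces.Lim_def by (simp only:)
qed

lemma smooth_U_continuous: "f \<in> smooth_U m \<Longrightarrow> continuous_on (lines m) f"
  by (rule DERIV_continuous_on[OF smooth_U_derivative])

lemma smooth_U_add:
  assumes "f \<in> smooth_U m" "g \<in> smooth_U m"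
  shows "(\<lambda>x. f x + g x) \<in> smooth_U m"
    "\<And>x. x \<in> lines m \<Longrightarrow> derivs m n (\<lambda>x. f x + g x) x = derivs m n f x + derivs m n g x"
proof -
  have "has_U_derivative (\<lambda>x. derivs m n f x + derivs m n g x) (derivs m (Suc n) f x + derivs m (Suc n) g x) m x"
    if "x \<in> lines m" for n x
    using smooth_U_derivative[OF smooth_U_derivs[OF assms(1)] that] smooth_U_derivative[OF smooth_U_derivs[OF assms(2)] that]
    by (simp add: DERIV_add)
  from smooth_U_I[of m "\<lambda>n x. derivs m n f x + derivs m n g x", OF this]
  show "(\<lambda>x. f x + g x) \<in> smooth_U m"
    "\<And>x. x \<in> lines m \<Longrightarrow> derivs m n (\<lambda>x. f x + g x) x = derivs m n f x + derivs m n g x"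
    by auto
qed

lemma smooth_U_cmult:
  assumes "f \<in> smooth_U m"
  shows "(\<lambda>x. c * f x) \<in> smooth_U m"
    "\<And>x. x \<in> lines m \<Longrightarrow> derivs m n (\<lambda>x. c * f x) x = c * derivs m n f x"
proof -
  have "has_U_derivative (\<lambda>x. c * derivs m n f x) (c * derivs m (Suc n) f x) m x"
    if "x \<in> lines m" for n x
    using DERIV_cmult[OF smooth_U_derivative[OF smooth_U_derivs[OF assms] that], of c] by simp
  from smooth_U_I[of m "\<lambda>n x. c * derivs m n f x", OF this]
  show "(\<lambda>x. c * f x) \<in> smooth_U m"
    "\<And>x. x \<in> lines m \<Longrightarrow> derivs m n (\<lambda>x. c * f x) x = c * derivs m n f x"
    by auto
qed

lemma smooth_U_const: "(\<lambda>x. c) \<in> smooth_U m"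
  by (rule smooth_U_I(1)[of m "\<lambda>n x. if n = 0 then c else 0"]) auto

lemma smooth_U_mult_ident:
  assumes "f \<in> smooth_U m"
  shows "(\<lambda>x. x * f x) \<in> smooth_U m"
proof (rule smooth_U_coinduct[of _ "{\<lambda>x. x * g x + h x | g h. g \<in> smooth_U m \<and> h \<in> smooth_U m}"])
  show "(\<lambda>x. x * f x) \<in> {\<lambda>x. x * g x + h x | g h. g \<in> smooth_U m \<and> h \<in> smooth_U m}"
    using assms smooth_U_const[of 0 m] by force
  fix k assume "k \<in> {\<lambda>x. x * g x + h x | g h. g \<in> smooth_U m \<and> h \<in> smooth_U m}"
  then obtain g h where k: "k = (\<lambda>x. x * g x + h x)" and g: "g \<in> smooth_U m" and h: "h \<in> smooth_U m"
    by blast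
  have d: "has_U_derivative k (x * deriv_U m g x + (g x + deriv_U m h x)) m x" if "x \<in> lines m" for x
    unfolding k using smooth_U_derivative[OF g that] smooth_U_derivative[OF h that]
    by (auto intro!: derivative_eq_intros)
  have "(\<lambda>x. x * deriv_U m g x + (g x + deriv_U m h x)) \<in> {\<lambda>x. x * g x + h x | g h. g \<in> smooth_U m \<and> h \<in> smooth_U m}"
    using smooth_U_deriv[OF g] smooth_U_add(1)[OF g smooth_U_deriv[OF h]]
    by (intro CollectI exI[of _ "deriv_U m g"] exI[of _ "\<lambda>x. g x + deriv_U m h x"] conjI) simp_all
  then show "\<exists>g'\<in>{\<lambda>x. x * g x + h x | g h. g \<in> smooth_U m \<and> h \<in> smooth_U m}. \<forall>x\<in>lines m. has_U_derivative k (g' x) m x"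
    by (rule bexI[rotated]) (intro ballI d)
qed

lemma smooth_U_power: "(\<lambda>x. x ^ n) \<in> smooth_U m"
proof (induction n)
  case (Suc n)
  from smooth_U_mult_ident[OF this] show ?case by simp
qed (simp add: smooth_U_const)

lemma smooth_U_rotate:
  assumes "f \<in> smooth_U m"
  shows "(\<lambda>x. f (eps m ^ i * x)) \<in> smooth_U m"
    "\<And>x. x \<in> lines m \<Longrightarrow> deriv_U m (\<lambda>x. f (eps m ^ i * x)) x = eps m ^ i * deriv_U m f (eps m ^ i * x)"
proof -
  have d: "has_U_derivative (\<lambda>x. g (eps m ^ i * x)) (eps m ^ i * deriv_U m g (eps m ^ i * x)) m x"
    if g: "g \<in> smooth_U m" and x: "x \<in> lines m" for g x
  proof -
    have "(g has_field_derivative deriv_U m g (eps m ^ i * x)) (at (eps m ^ i * x) within (\<lambda>x. eps m ^ i * x) ` lines m)"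
      by (rule DERIV_subset[OF smooth_U_derivative[OF g lines_eps_power[OF x]]]) (use lines_eps_power in auto)
    moreover have "((\<lambda>x. eps m ^ i * x) has_field_derivative eps m ^ i) (at x within lines m)"
      by (auto intro!: derivative_eq_intros)
    ultimately have "((g \<circ> (\<lambda>x. eps m ^ i * x)) has_field_derivative deriv_U m g (eps m ^ i * x) * eps m ^ i) (at x within lines m)"
      by (rule DERIV_image_chain)
    then show ?thesis by (simp add: o_def mult.commute)
  qed
  then show "\<And>x. x \<in> lines m \<Longrightarrow> deriv_U m (\<lambda>x. f (eps m ^ i * x)) x = eps m ^ i * deriv_U m f (eps m ^ i * x)"
    by (intro deriv_U_eqI d assms)
  show "(\<lambda>x. f (eps m ^ i * x)) \<in> smooth_U m"
  proof (rule smooth_U_coinduct[of _ "{\<lambda>x. g (eps m ^ i * x) | g. g \<in> smooth_U m}"])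
    fix k assume "k \<in> {\<lambda>x. g (eps m ^ i * x) | g. g \<in> smooth_U m}"
    then obtain g where k: "k = (\<lambda>x. g (eps m ^ i * x))" and g: "g \<in> smooth_U m" by blast
    have "(\<lambda>x. eps m ^ i * deriv_U m g (eps m ^ i * x)) \<in> {\<lambda>x. g (eps m ^ i * x) | g. g \<in> smooth_U m}"
      using smooth_U_cmult(1)[OF smooth_U_deriv[OF g], of "eps m ^ i"]
      by (intro CollectI exI[of _ "\<lambda>x. eps m ^ i * deriv_U m g x"] conjI) simp_all
    then show "\<exists>g'\<in>{\<lambda>x. g (eps m ^ i * x) | g. g \<in> smooth_U m}. \<forall>x\<in>lines m. has_U_derivative k (g' x) m x"
      by (rule bexI[rotated]) (unfold k, intro ballI d[OF g])
  next
    show "(\<lambda>x. f (eps m ^ i * x)) \<in> {\<lambda>x. g (eps m ^ i * x) | g. g \<in> smooth_U m}"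
      by (intro CollectI exI[of _ f] conjI refl assms)
  qed
qed

section \<open>Averages of dilates\<close>

text \<open>
  Both \<^const>\<open>op_R\<close>, with \<open>\<rho>(t) = t\<^bsup>1/m\<^esup>\<close>, and the regularised quotient \<open>(f(x) - f(0)) / x\<close>, with
  \<open>\<rho>(t) = t\<close>, are of this form.
\<close>

definition avg :: "(real \<Rightarrow> real) \<Rightarrow> (real \<Rightarrow> complex) \<Rightarrow> (complex \<Rightarrow> complex) \<Rightarrow> complex \<Rightarrow> complex" where
  "avg \<rho> w f x = (LINT t:{0<..<1}|lborel. w t * f (x * of_real (\<rho> t)))"

definition unit_scale :: "(real \<Rightarrow> real) \<Rightarrow> bool" where
  "unit_scale \<rho> \<longleftrightarrow> \<rho> \<in> borel_measurable borel \<and> (\<forall>t\<in>{0<..<1}. 0 \<le> \<rho> t \<and> \<rho> t \<le> 1)"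

abbreviation weight :: "(real \<Rightarrow> complex) \<Rightarrow> bool" where
  "weight w \<equiv> set_integrable lborel {0<..<1} w"

lemma scale_in_segment:
  fixes x :: complex
  assumes "unit_scale \<rho>" "t \<in> {0<..<1}"
  shows "x * of_real (\<rho> t) \<in> closed_segment 0 x"
  using assms unfolding unit_scale_def closed_segment_def
  by (auto simp: scaleR_conv_of_real mult.commute intro!: exI[of _ "\<rho> t"])

lemma weight_mult_bounded:
  assumes w: "weight w" and g: "g \<in> borel_measurable borel"
    and bound: "\<And>t. t \<in> {0<..<1} \<Longrightarrow> norm (g t :: complex) \<le> M"
  shows "weight (\<lambda>t. w t * g t)"
proof (rule set_integrable_bound[of _ _ "\<lambda>t. w t * of_real M"])
  show "weight (\<lambda>t. w t * of_real M)" using w by (rule set_integrable_mult_left)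
  have "(\<lambda>t. (indicator {0<..<1} t *\<^sub>R w t) * g t) \<in> borel_measurable lborel"
    using w g unfolding set_integrable_def by (intro borel_measurable_times) auto
  then show "set_borel_measurable lborel {0<..<1} (\<lambda>t. w t * g t)"
    unfolding set_borel_measurable_def by simp
  show "AE t in lborel. t \<in> {0<..<1} \<longrightarrow> norm (w t * g t) \<le> norm (w t * of_real M)"
    using bound by (auto simp: norm_mult intro!: mult_left_mono order_trans[OF bound])
qed

lemma weight_mult_scale:
  assumes "weight w" "unit_scale \<rho>"
  shows "weight (\<lambda>t. w t * of_real (\<rho> t))"
  using assms(2) unfolding unit_scale_def by (intro weight_mult_bounded[OF assms(1), of _ 1]) auto

lemma scaled_measurable:
  fixes f :: "complex \<Rightarrow> complex"
  assumes "continuous_on (lines m) f" "x \<in> lines m" "unit_scale \<rho>"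
  shows "(\<lambda>t. f (x * of_real (\<rho> t))) \<in> borel_measurable borel"
proof -
  have "(\<lambda>z. indicator (lines m) z *\<^sub>R f z) \<in> borel_measurable borel"
    by (rule borel_measurable_continuous_on_indicator[OF _ assms(1)]) (simp add: closed_lines borel_closed)
  moreover have "(\<lambda>t. x * of_real (\<rho> t)) \<in> borel_measurable borel"
    using assms(3) unfolding unit_scale_def by (intro borel_measurable_times) auto
  ultimately have "(\<lambda>t. indicator (lines m) (x * of_real (\<rho> t)) *\<^sub>R f (x * of_real (\<rho> t))) \<in> borel_measurable borel"
    by (rule measurable_compose_rev)
  then show ?thesis using lines_scale[OF assms(2)] by simp
qed

lemma bounded_on_segment:
  fixes f :: "complex \<Rightarrow> complex"
  assumes "continuous_on (lines m) f" "x \<in> lines m"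
  obtains M where "M \<ge> 0" "\<And>y. y \<in> closed_segment 0 x \<Longrightarrow> norm (f y) \<le> M"
proof -
  have "compact (f ` closed_segment 0 x)"
    by (rule compact_continuous_image[OF continuous_on_subset[OF assms(1) segment_0_lines[OF assms(2)]]]) simp
  then obtain M where "\<forall>z\<in>f ` closed_segment 0 x. norm z \<le> M"
    using compact_imp_bounded bounded_iff by blast
  then have "\<And>y. y \<in> closed_segment 0 x \<Longrightarrow> norm (f y) \<le> max 0 M" by force
  then show ?thesis using that[of "max 0 M"] by simp
qed

lemma avg_integrable:
  assumes "weight w" "unit_scale \<rho>" "continuous_on (lines m) f" "x \<in> lines m"
  shows "weight (\<lambda>t. w t * f (x * of_real (\<rho> t)))"
proof -
  obtain M where "\<And>y. y \<in> closed_segment 0 x \<Longrightarrow> norm (f y) \<le> M"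
    using bounded_on_segment[OF assms(3,4)] by metis
  then show ?thesis
    using scale_in_segment[OF assms(2)] by (intro weight_mult_bounded[OF assms(1) scaled_measurable[OF assms(3,4,2)]]) blast
qed

lemma avg_cong:
  assumes "x \<in> lines m" "\<And>y. y \<in> lines m \<Longrightarrow> f y = g y"
  shows "avg \<rho> w f x = avg \<rho> w g x"
  unfolding avg_def using assms(2)[OF lines_scale[OF assms(1)]] by simp

lemma avg_add:
  assumes "weight w" "unit_scale \<rho>" "continuous_on (lines m) f" "continuous_on (lines m) g" "x \<in> lines m"
  shows "avg \<rho> w (\<lambda>y. f y + g y) x = avg \<rho> w f x + avg \<rho> w g x"
  unfolding avg_def distrib_left
  by (intro set_integral_add(2) avg_integrable[OF assms(1,2) _ assms(5)] assms(3,4))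

lemma avg_cmult: "avg \<rho> w (\<lambda>y. c * f y) x = c * avg \<rho> w f x"
  unfolding avg_def set_integral_mult_right[symmetric] by (simp only: mult.left_commute)

lemma avg_norm_le:
  assumes "unit_scale \<rho>" "x \<in> lines m" "\<And>y. y \<in> closed_segment 0 x \<Longrightarrow> norm (f y) \<le> M"
    and "weight w" "continuous_on (lines m) f"
  shows "norm (avg \<rho> w f x) \<le> (LINT t:{0<..<1}|lborel. norm (w t)) * M"
proof -
  have "norm (avg \<rho> w f x) \<le> (LINT t:{0<..<1}|lborel. norm (w t * f (x * of_real (\<rho> t))))"
    unfolding avg_def by (rule set_integral_norm_bound[OF avg_integrable[OF assms(4,1,5,2)]])
  also have "\<dots> \<le> (LINT t:{0<..<1}|lborel. norm (w t) * M)"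
    using assms(3)[OF scale_in_segment[OF assms(1)]]
    by (intro set_integral_mono set_integrable_norm avg_integrable[OF assms(4,1,5,2)] set_integrable_mult_left assms(4))
       (auto simp: norm_mult intro!: mult_left_mono)
  finally show ?thesis by simp
qed

lemma norm_segment_le: "y \<in> closed_segment 0 x \<Longrightarrow> norm y \<le> norm x" for x :: complex
  by (auto simp: closed_segment_def mult_left_le_one_le)

text \<open>
  Differentiation under the integral by dominated convergence.  The difference quotients of
  \<open>f (y \<rho>(t))\<close> are bounded uniformly in \<open>t\<close> by the mean value theorem on the segment from \<open>x \<rho>(t)\<close> to
  \<open>y \<rho>(t)\<close>, which lies in the union of the lines as soon as \<open>y\<close> is close to \<open>x\<close>.
\<close>

lemma avg_has_U_derivative:
  assumes w: "weight w" and \<rho>: "unit_scale \<rho>" and x: "x \<in> lines m"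
    and f: "\<And>y. y \<in> lines m \<Longrightarrow> has_U_derivative f (f' y) m y" and f': "continuous_on (lines m) f'"
  shows "has_U_derivative (avg \<rho> w f) (avg \<rho> (\<lambda>t. w t * of_real (\<rho> t)) f' x) m x"
proof -
  have contf: "continuous_on (lines m) f" by (rule DERIV_continuous_on[OF f])
  define Q where "Q = (\<lambda>y t. w t * ((f (y * of_real (\<rho> t)) - f (x * of_real (\<rho> t))) / (y - x)))"
  define D where "D = (\<lambda>t. (w t * of_real (\<rho> t)) * f' (x * of_real (\<rho> t)))"
  have compact: "compact (lines m \<inter> cball 0 (norm x + 1))"
    using closed_lines by (intro closed_Int_compact) auto
  then have "compact (f' ` (lines m \<inter> cball 0 (norm x + 1)))"
    by (intro compact_continuous_image continuous_on_subset[OF f']) auto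
  then obtain M where M: "\<And>y. y \<in> lines m \<Longrightarrow> norm y \<le> norm x + 1 \<Longrightarrow> norm (f' y) \<le> M"
    using compact_imp_bounded bounded_iff by (metis (no_types, lifting) IntI image_eqI mem_cball_0)
  have M0: "M \<ge> 0" using order_trans[OF norm_ge_zero M[OF x]] by simp
  have lip: "norm ((f (y * of_real r) - f (x * of_real r)) / (y - x)) \<le> M"
    if y: "closed_segment x y \<subseteq> lines m" "norm (y - x) \<le> 1" and r: "0 \<le> r" "r \<le> 1" for y r
  proof -
    have seg: "closed_segment (x * of_real r) (y * of_real r) \<subseteq> lines m"
    proof
      fix z assume "z \<in> closed_segment (x * of_real r) (y * of_real r)"
      then obtain u where u: "0 \<le> u" "u \<le> 1" "z = (1 - u) *\<^sub>R (x * of_real r) + u *\<^sub>R (y * of_real r)"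
        by (auto simp: closed_segment_def)
      then have "z = ((1 - u) *\<^sub>R x + u *\<^sub>R y) * of_real r" by (simp add: scaleR_conv_of_real algebra_simps)
      moreover have "(1 - u) *\<^sub>R x + u *\<^sub>R y \<in> closed_segment x y" using u by (auto simp: closed_segment_def)
      ultimately show "z \<in> lines m" using lines_scale y(1) by blast
    qed
    have small: "norm z \<le> norm x + 1" if "z \<in> closed_segment (x * of_real r) (y * of_real r)" for z
    proof -
      have "norm y \<le> norm x + 1" using y(2) norm_triangle_sub[of y x] by simp
      then have "y * of_real r \<in> cball 0 (norm x + 1)" "x * of_real r \<in> cball 0 (norm x + 1)"
        using r mult_left_le[of r "norm y"] mult_left_le[of r "norm x"] by (auto simp: norm_mult)
      then have "closed_segment (x * of_real r) (y * of_real r) \<subseteq> cball 0 (norm x + 1)"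
        by (intro closed_segment_subset) auto
      then show ?thesis using that by auto
    qed
    have "norm (f (y * of_real r) - f (x * of_real r)) \<le> M * norm (y * of_real r - x * of_real r)"
      by (rule field_differentiable_bound[OF convex_closed_segment, of "x * of_real r" "y * of_real r" f f'])
         (use seg small M DERIV_subset[OF f seg] in auto)
    also have "\<dots> \<le> M * norm (y - x)"
      using M0 r mult_left_le[of r "norm (y - x)"] by (intro mult_left_mono) (auto simp: norm_mult left_diff_distrib[symmetric])
    finally show ?thesis using M0 by (cases "y = x") (simp_all add: norm_divide divide_simps mult.commute)
  qed
  have "((\<lambda>y. LINT t:{0<..<1}|lborel. Q y t) \<longlongrightarrow> (LINT t:{0<..<1}|lborel. D t)) (at x within lines m)"
    unfolding tendsto_at_iff_sequentially
  proof (intro allI impI)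
    fix X assume X: "\<forall>i. X i \<in> lines m - {x}" and lim: "X \<longlonglongrightarrow> x"
    have filt: "filterlim X (at x within lines m) sequentially"
      using X lim by (auto simp: filterlim_at)
    have "\<forall>\<^sub>F y in at x within lines m. dist y x < 1"
      using tendsto_ident_at by (rule tendstoD) simp
    with eventually_segment_lines[OF x]
    have "\<forall>\<^sub>F y in at x within lines m. closed_segment x y \<subseteq> lines m \<and> norm (y - x) \<le> 1"
      by eventually_elim (simp add: dist_norm)
    then have "\<forall>\<^sub>F i in sequentially. closed_segment x (X i) \<subseteq> lines m \<and> norm (X i - x) \<le> 1"
      using filt by (rule eventually_compose_filterlim)
    then obtain N where N: "\<And>i. i \<ge> N \<Longrightarrow> closed_segment x (X i) \<subseteq> lines m \<and> norm (X i - x) \<le> 1"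
      by (auto simp: eventually_sequentially)
    have "(\<lambda>i. LINT t|lborel. indicator {0<..<1} t *\<^sub>R Q (X (i + N)) t) \<longlonglongrightarrow> (LINT t|lborel. indicator {0<..<1} t *\<^sub>R D t)"
    proof (rule integral_dominated_convergence[where w = "\<lambda>t. indicator {0<..<1} t *\<^sub>R (norm (w t) * M)"])
      have "weight D" unfolding D_def by (rule avg_integrable[OF weight_mult_scale[OF w \<rho>] \<rho> f' x])
      then show "(\<lambda>t. indicator {0<..<1} t *\<^sub>R D t) \<in> borel_measurable lborel"
        unfolding set_integrable_def by simp
      have "weight (Q y)" if "y \<in> lines m" for y
      proof -
        have "weight (\<lambda>t. (w t * f (y * of_real (\<rho> t)) - w t * f (x * of_real (\<rho> t))) / (y - x))"
          by (intro set_integrable_divide set_integral_diff(1) avg_integrable[OF w \<rho> contf] x that)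
        then show ?thesis unfolding Q_def by (simp add: right_diff_distrib)
      qed
      then show "(\<lambda>t. indicator {0<..<1} t *\<^sub>R Q (X (i + N)) t) \<in> borel_measurable lborel" for i
        using X unfolding set_integrable_def by simp
      have "set_integrable lborel {0<..<1} (\<lambda>t. norm (w t) * M)"
        by (intro set_integrable_mult_left set_integrable_norm w)
      then show "integrable lborel (\<lambda>t. indicator {0<..<1} t *\<^sub>R (norm (w t) * M))"
        unfolding set_integrable_def .
      show "AE t in lborel. norm (indicator {0<..<1} t *\<^sub>R Q (X (i + N)) t) \<le> indicator {0<..<1} t *\<^sub>R (norm (w t) * M)" for i
      proof (rule AE_I2)
        fix t :: real
        show "norm (indicator {0<..<1} t *\<^sub>R Q (X (i + N)) t) \<le> indicator {0<..<1} t *\<^sub>R (norm (w t) * M)"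
        proof (cases "t \<in> {0<..<1}")
          case True
          then have "norm ((f (X (i + N) * of_real (\<rho> t)) - f (x * of_real (\<rho> t))) / (X (i + N) - x)) \<le> M"
            using \<rho> N[of "i + N"] unfolding unit_scale_def by (intro lip) auto
          from mult_left_mono[OF this norm_ge_zero[of "w t"]] have "norm (Q (X (i + N)) t) \<le> norm (w t) * M"
            unfolding Q_def norm_mult .
          then show ?thesis using True by simp
        qed simp
      qed
      show "AE t in lborel. (\<lambda>i. indicator {0<..<1} t *\<^sub>R Q (X (i + N)) t) \<longlonglongrightarrow> indicator {0<..<1} t *\<^sub>R D t"
      proof (rule AE_I2)
        fix t :: real
        show "(\<lambda>i. indicator {0<..<1} t *\<^sub>R Q (X (i + N)) t) \<longlonglongrightarrow> indicator {0<..<1} t *\<^sub>R D t"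
        proof (cases "t \<in> {0<..<1}")
          case True
          define r where "r = \<rho> t"
          have "((\<lambda>y. f (y * of_real r)) has_field_derivative f' (x * of_real r) * of_real r) (at x within lines m)"
          proof -
            have "(f has_field_derivative f' (x * of_real r)) (at (x * of_real r) within (\<lambda>y. y * of_real r) ` lines m)"
              by (rule DERIV_subset[OF f[OF lines_scale[OF x]]]) (use lines_scale in auto)
            moreover have "((\<lambda>y. y * of_real r) has_field_derivative of_real r) (at x within lines m)"
              by (auto intro!: derivative_eq_intros)
            ultimately show ?thesis using DERIV_image_chain by (fastforce simp: o_def)
          qed
          then have "((\<lambda>y. w t * ((f (y * of_real r) - f (x * of_real r)) / (y - x))) \<longlongrightarrow> w t * (f' (x * of_real r) * of_real r)) (at x within lines m)"
            unfolding has_field_derivative_iff by (intro tendsto_mult tendsto_const)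
          then have "((\<lambda>y. Q y t) \<longlongrightarrow> D t) (at x within lines m)"
            by (simp add: Q_def D_def r_def mult_ac)
          then have "(\<lambda>i. Q (X i) t) \<longlonglongrightarrow> D t"
            using filt by (rule filterlim_compose)
          then show ?thesis using True LIMSEQ_ignore_initial_segment by auto
        qed simp
      qed
    qed
    then show "((\<lambda>y. LINT t:{0<..<1}|lborel. Q y t) \<circ> X) \<longlonglongrightarrow> (LINT t:{0<..<1}|lborel. D t)"
      unfolding set_lebesgue_integral_def o_def by (rule LIMSEQ_offset)
  qed
  moreover have "\<forall>\<^sub>F y in at x within lines m. (LINT t:{0<..<1}|lborel. Q y t) = (avg \<rho> w f y - avg \<rho> w f x) / (y - x)"
  proof -
    have "\<forall>\<^sub>F y in at x within lines m. y \<in> lines m" by (simp add: eventually_at_filter)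
    then show ?thesis
    proof eventually_elim
      case (elim y)
      have "(LINT t:{0<..<1}|lborel. Q y t) = (LINT t:{0<..<1}|lborel. (w t * f (y * of_real (\<rho> t)) - w t * f (x * of_real (\<rho> t))) / (y - x))"
        unfolding Q_def by (simp add: right_diff_distrib)
      also have "\<dots> = (avg \<rho> w f y - avg \<rho> w f x) / (y - x)"
        unfolding set_integral_divide_zero avg_def
        by (subst set_integral_diff(2)) (simp_all add: avg_integrable[OF w \<rho> contf] x elim)
      finally show ?case .
    qed
  qed
  ultimately show ?thesis
    unfolding has_field_derivative_iff avg_def[of _ _ f' x] D_def by (rule Lim_transform_eventually)
qed

lemma avg_smooth:
  assumes "weight w" "unit_scale \<rho>" "f \<in> smooth_U m"
  shows "avg \<rho> w f \<in> smooth_U m"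
    "\<And>x. x \<in> lines m \<Longrightarrow> deriv_U m (avg \<rho> w f) x = avg \<rho> (\<lambda>t. w t * of_real (\<rho> t)) (deriv_U m f) x"
proof -
  have d: "has_U_derivative (avg \<rho> w f) (avg \<rho> (\<lambda>t. w t * of_real (\<rho> t)) (deriv_U m f) x) m x"
    if "weight w" "f \<in> smooth_U m" "x \<in> lines m" for w f x
    using avg_has_U_derivative[OF that(1) assms(2) that(3) smooth_U_derivative[OF that(2)] smooth_U_continuous[OF smooth_U_deriv[OF that(2)]]] .
  show "\<And>x. x \<in> lines m \<Longrightarrow> deriv_U m (avg \<rho> w f) x = avg \<rho> (\<lambda>t. w t * of_real (\<rho> t)) (deriv_U m f) x"
    by (intro deriv_U_eqI d assms)
  show "avg \<rho> w f \<in> smooth_U m"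
  proof (rule smooth_U_coinduct[of _ "{avg \<rho> w f | w f. weight w \<and> f \<in> smooth_U m}"])
    fix k assume "k \<in> {avg \<rho> w f | w f. weight w \<and> f \<in> smooth_U m}"
    then obtain w f where k: "k = avg \<rho> w f" and w: "weight w" and f: "f \<in> smooth_U m" by blast
    show "\<exists>g'\<in>{avg \<rho> w f | w f. weight w \<and> f \<in> smooth_U m}. \<forall>x\<in>lines m. has_U_derivative k (g' x) m x"
    proof (rule bexI)
      show "\<forall>x\<in>lines m. has_U_derivative k (avg \<rho> (\<lambda>t. w t * of_real (\<rho> t)) (deriv_U m f) x) m x"
        unfolding k by (intro ballI d w f)
      show "avg \<rho> (\<lambda>t. w t * of_real (\<rho> t)) (deriv_U m f) \<in> {avg \<rho> w f | w f. weight w \<and> f \<in> smooth_U m}"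
        using weight_mult_scale[OF w assms(2)] smooth_U_deriv[OF f] by auto
    qed
  next
    show "avg \<rho> w f \<in> {avg \<rho> w f | w f. weight w \<and> f \<in> smooth_U m}" using assms by auto
  qed
qed

lemma unit_scale_ident: "unit_scale (\<lambda>t. t)"
  by (auto simp: unit_scale_def)

lemma weight_one: "weight (\<lambda>_. 1)"
  by (simp add: set_integrable_def)

text \<open>
  For \<open>f(0) = 0\<close> this exhibits the quotient \<open>f(x) / x\<close> as an average of \<open>f'\<close>, hence as a smooth
  function.
\<close>

lemma smooth_U_ftc:
  assumes "f \<in> smooth_U m" "x \<in> lines m"
  shows "f x - f 0 = x * avg (\<lambda>t. t) (\<lambda>_. 1) (deriv_U m f) x"
proof -
  have int: "weight (\<lambda>t. 1 * deriv_U m f (x * of_real t))"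
    by (rule avg_integrable[OF weight_one unit_scale_ident smooth_U_continuous[OF smooth_U_deriv[OF assms(1)]] assms(2)])
  have "((\<lambda>t. x * deriv_U m f (x * of_real t)) has_integral (f (x * of_real 1) - f (x * of_real 0))) {0..1}"
  proof (rule fundamental_theorem_of_calculus)
    fix t :: real assume "t \<in> {0..1}"
    have "((\<lambda>t. x * of_real t) has_vector_derivative x * 1) (at t within {0..1})"
      by (auto intro!: derivative_eq_intros)
    moreover have "(f has_field_derivative deriv_U m f (x * of_real t)) (at (x * of_real t) within (\<lambda>t. x * of_real t) ` {0..1})"
      by (rule DERIV_subset[OF smooth_U_derivative[OF assms(1) lines_scale[OF assms(2)]]]) (use lines_scale[OF assms(2)] in auto)
    ultimately have "(f \<circ> (\<lambda>t. x * of_real t) has_vector_derivative x * 1 * deriv_U m f (x * of_real t)) (at t within {0..1})"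
      by (rule field_vector_diff_chain_within)
    then show "((\<lambda>t. f (x * of_real t)) has_vector_derivative x * deriv_U m f (x * of_real t)) (at t within {0..1})"
      by (simp add: o_def)
  qed simp
  then have "((\<lambda>t. x * deriv_U m f (x * of_real t)) has_integral (f (x * of_real 1) - f (x * of_real 0))) {0<..<1}"
    unfolding has_integral_Icc_iff_Ioo .
  from integral_unique[OF this] have "integral {0<..<1} (\<lambda>t. x * deriv_U m f (x * of_real t)) = f x - f 0"
    by simp
  moreover have "x * avg (\<lambda>t. t) (\<lambda>_. 1) (deriv_U m f) x = x * integral {0<..<1} (\<lambda>t. deriv_U m f (x * of_real t))"
    unfolding avg_def using set_borel_integral_eq_integral(2)[OF int] by simp
  ultimately show ?thesis by simp
qed

lemma integral_0_eq_avg: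
  assumes "continuous_on (lines m) f" "x \<in> lines m"
  shows "integral_0 f x = x * avg (\<lambda>t. t) (\<lambda>_. 1) f x"
proof -
  have int: "weight (\<lambda>t. 1 * f (x * of_real t))"
    by (rule avg_integrable[OF weight_one unit_scale_ident assms])
  have "((\<lambda>t. f (x * of_real t)) has_integral avg (\<lambda>t. t) (\<lambda>_. 1) f x) {0<..<1}"
    using set_borel_integral_eq_integral[OF int] unfolding avg_def by (simp add: integrable_integral)
  then have "((\<lambda>t. f (x * of_real t)) has_integral avg (\<lambda>t. t) (\<lambda>_. 1) f x) {0..1}"
    by (simp only: has_integral_Icc_iff_Ioo)
  then have "((\<lambda>t. f (x * of_real t) * x) has_integral avg (\<lambda>t. t) (\<lambda>_. 1) f x * x) {0..1}"
    by (rule has_integral_mult_left)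
  then have "(f has_contour_integral avg (\<lambda>t. t) (\<lambda>_. 1) f x * x) (linepath 0 x)"
    unfolding has_contour_integral_linepath by (simp add: linepath_def scaleR_conv_of_real mult.commute)
  then show ?thesis unfolding integral_0_def by (simp add: contour_integral_unique mult.commute)
qed

lemma avg_mult_ident: "avg \<rho> w (\<lambda>y. y * f y) x = x * avg \<rho> (\<lambda>t. w t * of_real (\<rho> t)) f x"
  unfolding avg_def set_integral_mult_right[symmetric] by (simp only: mult_ac)

section \<open>Euler operators and functions of a given type\<close>

definition euler :: "nat \<Rightarrow> complex \<Rightarrow> (complex \<Rightarrow> complex) \<Rightarrow> complex \<Rightarrow> complex" where
  "euler m c f = (\<lambda>x. x * deriv_U m f x + c * f x)"

lemma euler_smooth:
  assumes "f \<in> smooth_U m"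
  shows "euler m c f \<in> smooth_U m"
    "\<And>x. x \<in> lines m \<Longrightarrow> derivs m n (euler m c f) x =
       x * derivs m (Suc n) f x + (of_nat n + c) * derivs m n f x"
proof -
  define F where "F = (\<lambda>n x. x * derivs m (Suc n) f x + (of_nat n + c) * derivs m n f x)"
  have d: "has_U_derivative (F n) (F (Suc n) x) m x" if x: "x \<in> lines m" for n x
  proof -
    have D: "has_U_derivative (derivs m i f) (derivs m (Suc i) f x) m x" for i
      using smooth_U_derivative[OF smooth_U_derivs[OF assms] x, of i] by simp
    have "has_U_derivative (F n) ((1 * derivs m (Suc n) f x + (deriv_U m ^^ Suc (Suc n)) f x * x)
        + (of_nat n + c) * derivs m (Suc n) f x) m x"
      unfolding F_def by (intro DERIV_add DERIV_mult DERIV_cmult DERIV_ident D)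
    moreover have "(1 * derivs m (Suc n) f x + (deriv_U m ^^ Suc (Suc n)) f x * x)
        + (of_nat n + c) * derivs m (Suc n) f x = F (Suc n) x"
      unfolding F_def by (simp add: algebra_simps del: funpow.simps)
    ultimately show ?thesis by simp
  qed
  have "F 0 x = euler m c f x" for x by (simp add: F_def euler_def)
  from smooth_U_I[OF d this] show "euler m c f \<in> smooth_U m"
    "\<And>x. x \<in> lines m \<Longrightarrow> derivs m n (euler m c f) x =
       x * derivs m (Suc n) f x + (of_nat n + c) * derivs m n f x"
    by (simp_all add: F_def)
qed

lemma euler_cong:
  assumes "\<And>y. y \<in> lines m \<Longrightarrow> f y = g y" "x \<in> lines m"
  shows "euler m c f x = euler m c g x"
  unfolding euler_def using deriv_U_cong[OF assms] assms by simp

text \<open>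
  Dilations commute with \<open>x d/dx\<close>, and so do their averages.
\<close>

lemma euler_avg:
  assumes "weight w" "unit_scale \<rho>" "f \<in> smooth_U m" "x \<in> lines m"
  shows "euler m c (avg \<rho> w f) x = avg \<rho> w (euler m c f) x"
proof -
  have "continuous_on (lines m) (\<lambda>y. y * deriv_U m f y)" "continuous_on (lines m) (\<lambda>y. c * f y)"
    by (intro continuous_intros smooth_U_continuous smooth_U_deriv assms)+
  then have "avg \<rho> w (euler m c f) x = avg \<rho> w (\<lambda>y. y * deriv_U m f y) x + avg \<rho> w (\<lambda>y. c * f y) x"
    unfolding euler_def by (rule avg_add[OF assms(1,2) _ _ assms(4)])
  also have "\<dots> = x * deriv_U m (avg \<rho> w f) x + c * avg \<rho> w f x"
    unfolding avg_mult_ident avg_cmult avg_smooth(2)[OF assms] ..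
  finally show ?thesis unfolding euler_def ..
qed

text \<open>
  Since \<open>I f(x) = x \<integral> f(x t) dt\<close>, its derivative is \<open>(\<theta> + 1)\<close> of the average of \<open>f\<close>, which is the average of
  \<open>(x f)'\<close>, that is, \<open>f(x)\<close>.
\<close>

lemma integral_0_smooth:
  assumes "f \<in> smooth_U m"
  shows "integral_0 f \<in> smooth_U m" "\<And>x. x \<in> lines m \<Longrightarrow> deriv_U m (integral_0 f) x = f x"
    "\<And>n x. x \<in> lines m \<Longrightarrow> derivs m (Suc n) (integral_0 f) x = derivs m n f x"
proof -
  note A = avg_smooth[OF weight_one unit_scale_ident assms]
  have d: "has_U_derivative (integral_0 f) (f x) m x" if x: "x \<in> lines m" for x
  proof -
    have "has_U_derivative (\<lambda>y. y * avg (\<lambda>t. t) (\<lambda>_. 1) f y)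
        (1 * avg (\<lambda>t. t) (\<lambda>_. 1) f x + deriv_U m (avg (\<lambda>t. t) (\<lambda>_. 1) f) x * x) m x"
      by (intro DERIV_mult DERIV_ident smooth_U_derivative A(1) x)
    moreover have "1 * avg (\<lambda>t. t) (\<lambda>_. 1) f x + deriv_U m (avg (\<lambda>t. t) (\<lambda>_. 1) f) x * x = f x"
    proof (cases "x = 0")
      case True
      have "avg (\<lambda>t. t) (\<lambda>_. 1) f 0 = f 0"
        unfolding avg_def set_lebesgue_integral_def by simp
      then show ?thesis using True by simp
    next
      case False
      have dx: "deriv_U m (\<lambda>y. y * f y) y = euler m 1 f y" if "y \<in> lines m" for y
        using smooth_U_derivative[OF assms that] unfolding euler_def
        by (intro deriv_U_eqI that) (auto intro!: derivative_eq_intros)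
      have "(\<lambda>y. y * f y) \<in> smooth_U m"
        by (rule smooth_U_mult_ident[OF assms])
      from smooth_U_ftc[OF this x] have "x * f x = x * avg (\<lambda>t. t) (\<lambda>_. 1) (deriv_U m (\<lambda>y. y * f y)) x"
        by simp
      also have "avg (\<lambda>t. t) (\<lambda>_. 1) (deriv_U m (\<lambda>y. y * f y)) x = avg (\<lambda>t. t) (\<lambda>_. 1) (euler m 1 f) x"
        by (rule avg_cong[OF x dx])
      also have "\<dots> = euler m 1 (avg (\<lambda>t. t) (\<lambda>_. 1) f) x"
        by (rule euler_avg[OF weight_one unit_scale_ident assms x, symmetric])
      finally show ?thesis using False by (simp add: euler_def mult.commute add.commute)
    qed
    ultimately have "has_U_derivative (\<lambda>y. y * avg (\<lambda>t. t) (\<lambda>_. 1) f y) (f x) m x" by simp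
    then show ?thesis
      by (rule has_U_derivative_cong[OF _ x]) (simp add: integral_0_eq_avg[OF smooth_U_continuous[OF assms]])
  qed
  have F: "has_U_derivative (case n of 0 \<Rightarrow> integral_0 f | Suc n \<Rightarrow> derivs m n f)
     ((case Suc n of 0 \<Rightarrow> integral_0 f | Suc n \<Rightarrow> derivs m n f) x) m x" if x: "x \<in> lines m" for n x
    using d[OF x] smooth_U_derivative[OF smooth_U_derivs[OF assms] x] by (cases n) auto
  note S = smooth_U_I[of m "\<lambda>n. case n of 0 \<Rightarrow> integral_0 f | Suc n \<Rightarrow> derivs m n f" "integral_0 f", OF F]
  show "integral_0 f \<in> smooth_U m" by (rule S(1)) auto
  show "\<And>x. x \<in> lines m \<Longrightarrow> deriv_U m (integral_0 f) x = f x"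
    by (rule deriv_U_eqI[OF d])
  show "\<And>n x. x \<in> lines m \<Longrightarrow> derivs m (Suc n) (integral_0 f) x = derivs m n f x"
    using S(2)[of _ "Suc _"] by simp
qed

lemma integral_0_cong:
  assumes "x \<in> lines m" "\<And>y. y \<in> lines m \<Longrightarrow> f y = g y"
  shows "integral_0 f x = integral_0 g x"
  unfolding integral_0_def using segment_0_lines[OF assms(1)] assms(2)
  by (intro contour_integral_cong) auto

lemma deriv_U_power:
  assumes "x \<in> lines m"
  shows "derivs m i (\<lambda>x. x ^ n) x = (\<Prod>l<i. of_nat n - of_nat l) * x ^ (n - i)"
proof (rule smooth_U_I(2)[OF _ _ assms])
  fix i x
  show "has_U_derivative (\<lambda>x. (\<Prod>l<i. of_nat n - of_nat l) * x ^ (n - i)) ((\<Prod>l<Suc i. of_nat n - of_nat l) * x ^ (n - Suc i)) m x"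
  proof (cases "i < n")
    case True
    define k where "k = n - Suc i"
    have k: "n - i = Suc k" "of_nat n - of_nat i = 1 + (of_nat k :: complex)"
      using True by (simp_all add: k_def Suc_diff_Suc of_nat_diff)
    have "has_U_derivative (\<lambda>x. x ^ Suc k) ((1 + of_nat k) * (1 * x ^ k)) m x"
      by (intro DERIV_power_Suc DERIV_ident)
    from DERIV_cmult[OF this, of "\<Prod>l<i. of_nat n - of_nat l"] show ?thesis
      unfolding k(1) k_def[symmetric] by (simp add: k(2) mult_ac)
  next
    case False
    then have "(\<Prod>l<Suc i. of_nat n - of_nat l :: complex) = 0"
      by (intro prod_zero) auto
    then show ?thesis using False by (simp only:) simp
  qed
qed simp

definition typed :: "nat \<Rightarrow> nat \<Rightarrow> (complex \<Rightarrow> complex) \<Rightarrow> bool" where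
  "typed m j f \<longleftrightarrow> (\<forall>x\<in>lines m. f (eps m * x) = eps m ^ j * f x)"

text \<open>
  The relation \<open>f (\<epsilon> x) = \<epsilon>\<^sup>j f x\<close> is differentiated \<open>i\<close> times.  At \<open>x = 0\<close> it shows that the \<open>i\<close>-th
  derivative vanishes unless \<open>i \<equiv> j\<close> modulo \<open>m\<close>.
\<close>

lemma typed_derivs:
  assumes "typed m j f" "f \<in> smooth_U m" "x \<in> lines m"
  shows "eps m ^ i * derivs m i f (eps m * x) = eps m ^ j * derivs m i f x"
  using assms(3)
proof (induction i arbitrary: x)
  case 0
  then show ?case using assms(1) by (simp add: typed_def)
next
  case (Suc i)
  define g where "g = derivs m i f"
  have g: "g \<in> smooth_U m" unfolding g_def by (rule smooth_U_derivs[OF assms(2)])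
  have rot: "(\<lambda>x. g (eps m * x)) \<in> smooth_U m" "deriv_U m (\<lambda>x. g (eps m * x)) x = eps m * deriv_U m g (eps m * x)"
    using smooth_U_rotate[OF g, where i = 1] Suc.prems by auto
  have "eps m ^ i * deriv_U m (\<lambda>x. g (eps m * x)) x = deriv_U m (\<lambda>x. eps m ^ i * g (eps m * x)) x"
    using smooth_U_cmult(2)[OF rot(1) Suc.prems, of 1 "eps m ^ i"] by simp
  also have "\<dots> = deriv_U m (\<lambda>x. eps m ^ j * g x) x"
    using Suc.IH by (intro deriv_U_cong[OF _ Suc.prems]) (simp add: g_def)
  also have "\<dots> = eps m ^ j * deriv_U m g x"
    using smooth_U_cmult(2)[OF g Suc.prems, of 1 "eps m ^ j"] by simp
  finally show ?case unfolding rot(2) by (simp add: g_def mult_ac)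
qed

abbreviation eulers :: "nat \<Rightarrow> complex list \<Rightarrow> (complex \<Rightarrow> complex) \<Rightarrow> complex \<Rightarrow> complex" where
  "eulers m cs f \<equiv> foldr (euler m) cs f"

lemma eulers_smooth: "f \<in> smooth_U m \<Longrightarrow> eulers m cs f \<in> smooth_U m"
  by (induction cs) (simp_all add: euler_smooth(1))

lemma eulers_avg:
  assumes "weight w" "unit_scale \<rho>" "f \<in> smooth_U m" "x \<in> lines m"
  shows "eulers m cs (avg \<rho> w f) x = avg \<rho> w (eulers m cs f) x"
  using assms(4)
proof (induction cs arbitrary: x)
  case (Cons c cs)
  have "eulers m (c # cs) (avg \<rho> w f) x = euler m c (avg \<rho> w (eulers m cs f)) x"
    by (simp only: foldr.simps o_apply) (rule euler_cong[OF Cons.IH Cons.prems])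
  also have "\<dots> = avg \<rho> w (eulers m (c # cs) f) x"
    using euler_avg[OF assms(1,2) eulers_smooth[OF assms(3)] Cons.prems] by simp
  finally show ?case .
qed simp

lemma eulers_add:
  assumes "f \<in> smooth_U m" "g \<in> smooth_U m" "x \<in> lines m"
  shows "eulers m cs (\<lambda>x. f x + g x) x = eulers m cs f x + eulers m cs g x"
  using assms(3)
proof (induction cs arbitrary: x)
  case (Cons c cs)
  have "eulers m (c # cs) (\<lambda>x. f x + g x) x = euler m c (\<lambda>x. eulers m cs f x + eulers m cs g x) x"
    by (simp only: foldr.simps o_apply) (rule euler_cong[OF Cons.IH Cons.prems])
  also have "\<dots> = eulers m (c # cs) f x + eulers m (c # cs) g x"
    using smooth_U_add(2)[OF eulers_smooth[OF assms(1)] eulers_smooth[OF assms(2)] Cons.prems, of 1]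
    by (simp add: euler_def algebra_simps)
  finally show ?case .
qed simp

lemma eulers_cmult:
  assumes "f \<in> smooth_U m" "x \<in> lines m"
  shows "eulers m cs (\<lambda>x. a * f x) x = a * eulers m cs f x"
  using assms(2)
proof (induction cs arbitrary: x)
  case (Cons c cs)
  have "eulers m (c # cs) (\<lambda>x. a * f x) x = euler m c (\<lambda>x. a * eulers m cs f x) x"
    by (simp only: foldr.simps o_apply) (rule euler_cong[OF Cons.IH Cons.prems])
  also have "\<dots> = a * eulers m (c # cs) f x"
    using smooth_U_cmult(2)[OF eulers_smooth[OF assms(1)] Cons.prems, of 1]
    by (simp add: euler_def algebra_simps)
  finally show ?case .
qed simp

lemma eulers_power:
  assumes "x \<in> lines m"
  shows "eulers m cs (\<lambda>x. x ^ n) x = prod_list (map (\<lambda>c. of_nat n + c) cs) * x ^ n"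
  using assms
proof (induction cs arbitrary: x)
  case (Cons c cs)
  have "eulers m (c # cs) (\<lambda>x. x ^ n) x = euler m c (\<lambda>x. prod_list (map (\<lambda>c. of_nat n + c) cs) * x ^ n) x"
    by (simp only: foldr.simps o_apply) (rule euler_cong[OF Cons.IH Cons.prems])
  also have "\<dots> = prod_list (map (\<lambda>c. of_nat n + c) (c # cs)) * x ^ n"
  proof -
    define P where "P = prod_list (map (\<lambda>c. of_nat n + c) cs)"
    have "deriv_U m (\<lambda>x. P * x ^ n) x = P * (of_nat n * x ^ (n - 1))"
      using smooth_U_cmult(2)[OF smooth_U_power Cons.prems, of 1 P n] deriv_U_power[OF Cons.prems, of 1 n] by simp
    moreover have x: "x * (of_nat n * x ^ (n - 1)) = of_nat n * x ^ n" by (cases n) simp_all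
    ultimately have "x * deriv_U m (\<lambda>x. P * x ^ n) x = P * (of_nat n * x ^ n)"
      by (simp only: mult.left_commute[of x P] x)
    moreover have "prod_list (map (\<lambda>c. of_nat n + c) (c # cs)) = (of_nat n + c) * P"
      by (simp add: P_def)
    ultimately show ?thesis
      unfolding euler_def P_def[symmetric] by (simp only: algebra_simps)
  qed
  finally show ?case .
qed simp

text \<open>
  The product of Euler operators is a differential operator of order \<open>length cs\<close> with polynomial
  coefficients, hence bounded with respect to the derivatives up to that order on a segment.  The
  derivatives up to order \<open>r\<close> of the result are included for the induction.
\<close>

lemma eulers_bound:
  fixes x :: complex
  assumes "x \<in> lines m"
  shows "\<exists>K\<ge>0. \<forall>f\<in>smooth_U m. \<forall>M\<ge>0. (\<forall>i\<le>r + length cs. \<forall>y\<in>closed_segment 0 x. norm (derivs m i f y) \<le> M) \<longrightarrow>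
     (\<forall>i\<le>r. \<forall>y\<in>closed_segment 0 x. norm (derivs m i (eulers m cs f) y) \<le> K * M)"
proof (induction cs arbitrary: r)
  case Nil
  then show ?case by (intro exI[of _ 1]) simp
next
  case (Cons c cs)
  obtain K where K0: "K \<ge> 0" and K: "\<forall>f\<in>smooth_U m. \<forall>M\<ge>0.
      (\<forall>i\<le>Suc r + length cs. \<forall>y\<in>closed_segment 0 x. norm (derivs m i f y) \<le> M) \<longrightarrow>
      (\<forall>i\<le>Suc r. \<forall>y\<in>closed_segment 0 x. norm (derivs m i (eulers m cs f) y) \<le> K * M)"
    using Cons[of "Suc r"] by (elim exE conjE)
  define L where "L = norm x + real r + norm c"
  have "norm (derivs m i (eulers m (c # cs) f) y) \<le> (L * K) * M"
    if f: "f \<in> smooth_U m" and M: "M \<ge> 0"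
      and b: "\<forall>i\<le>r + length (c # cs). \<forall>y\<in>closed_segment 0 x. norm (derivs m i f y) \<le> M"
      and i: "i \<le> r" and y: "y \<in> closed_segment 0 x" for f M i y
  proof -
    have bK: "norm (derivs m i (eulers m cs f) y) \<le> K * M" if "i \<le> Suc r" for i
      by (rule K[rule_format, OF f M _ that y]) (use b in simp)
    have "y \<in> lines m" using y segment_0_lines[OF assms] by blast
    then have eq: "derivs m i (eulers m (c # cs) f) y =
        y * derivs m (Suc i) (eulers m cs f) y + (of_nat i + c) * derivs m i (eulers m cs f) y"
      using euler_smooth(2)[OF eulers_smooth[OF f]] by simp
    have "norm (derivs m i (eulers m (c # cs) f) y) \<le>
        norm y * norm (derivs m (Suc i) (eulers m cs f) y) + norm (of_nat i + c) * norm (derivs m i (eulers m cs f) y)"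
      unfolding eq by (intro order_trans[OF norm_triangle_ineq]) (simp only: norm_mult order_refl)
    also have "\<dots> \<le> norm x * (K * M) + (real r + norm c) * (K * M)"
    proof (rule add_mono)
      have "norm (derivs m (Suc i) (eulers m cs f) y) \<le> K * M"
        by (rule bK) (rule Suc_le_mono[THEN iffD2, OF i])
      then show "norm y * norm (derivs m (Suc i) (eulers m cs f) y) \<le> norm x * (K * M)"
        by (rule mult_mono[OF norm_segment_le[OF y] _ norm_ge_zero norm_ge_zero])
      have "norm (derivs m i (eulers m cs f) y) \<le> K * M"
        by (rule bK) (rule le_SucI[OF i])
      moreover have "norm (of_nat i + c) \<le> real r + norm c"
        using norm_triangle_ineq[of "of_nat i" c] i by simp
      moreover have "0 \<le> real r + norm c" by simp
      ultimately show "norm (of_nat i + c) * norm (derivs m i (eulers m cs f) y) \<le> (real r + norm c) * (K * M)"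
        by (intro mult_mono norm_ge_zero)
    qed
    finally show ?thesis by (simp add: L_def algebra_simps)
  qed
  moreover have "L * K \<ge> 0" using K0 by (simp add: L_def)
  ultimately show ?case by (intro exI[of _ "L * K"] conjI ballI allI impI)
qed

section \<open>The relation between averages and derivatives of order m\<close>

lemma complex_Weierstrass:
  fixes H :: "real \<Rightarrow> complex"
  assumes "continuous_on {0..1} H" "e > 0"
  obtains \<alpha> N where "\<And>u. u \<in> {0..1} \<Longrightarrow> norm (H u - (\<Sum>i\<le>N::nat. \<alpha> i * of_real u ^ i)) < e"
proof -
  obtain P where P: "polynomial_function P" "\<And>u. u \<in> {0..1} \<Longrightarrow> norm (H u - P u) < e"
    using Stone_Weierstrass_polynomial_function[OF compact_Icc assms] by blast
  have "real_polynomial_function (Re \<circ> P)" "real_polynomial_function (Im \<circ> P)"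
    using P(1) bounded_linear_Re bounded_linear_Im unfolding polynomial_function_def by blast+
  then obtain a b and p q :: nat where a: "(Re \<circ> P) = (\<lambda>u. \<Sum>i\<le>p. a i * u ^ i)"
      and b: "(Im \<circ> P) = (\<lambda>u. \<Sum>i\<le>q. b i * u ^ i)"
    unfolding real_polynomial_function_iff_sum by blast
  define \<alpha> where "\<alpha> = (\<lambda>i. Complex (if i \<le> p then a i else 0) (if i \<le> q then b i else 0))"
  have "P u = (\<Sum>i\<le>max p q. \<alpha> i * of_real u ^ i)" for u
  proof (rule complex_eqI)
    have "(\<Sum>i\<le>p. a i * u ^ i) = (\<Sum>i\<le>max p q. (if i \<le> p then a i else 0) * u ^ i)"
      by (rule sum.mono_neutral_cong_left) auto
    then show "Re (P u) = Re (\<Sum>i\<le>max p q. \<alpha> i * of_real u ^ i)"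
      using fun_cong[OF a, of u] by (simp add: \<alpha>_def Re_sum flip: of_real_power)
    have "(\<Sum>i\<le>q. b i * u ^ i) = (\<Sum>i\<le>max p q. (if i \<le> q then b i else 0) * u ^ i)"
      by (rule sum.mono_neutral_cong_left) auto
    then show "Im (P u) = Im (\<Sum>i\<le>max p q. \<alpha> i * of_real u ^ i)"
      using fun_cong[OF b, of u] by (simp add: \<alpha>_def Im_sum flip: of_real_power)
  qed
  then show ?thesis using P(2) that[of "\<alpha>" "max p q"] by simp
qed

lemma unit_scale_root: "unit_scale (\<lambda>t. t powr (1 / real m))"
  unfolding unit_scale_def by (auto intro!: powr_le1)

lemma avg_monomial:
  assumes "m \<ge> 1"
  shows "avg (\<lambda>t. t powr (1 / real m)) w (\<lambda>y. y ^ (m * n)) x =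
    (LINT t:{0<..<1}|lborel. w t * of_real t ^ n) * x ^ (m * n)"
proof -
  have "(of_real (t powr (1 / real m)) :: complex) ^ (m * n) = of_real t ^ n" if "t \<in> {0<..<1}" for t
  proof -
    have "(t powr (1 / real m)) ^ m = t"
      using that assms by (subst powr_power) auto
    then have "(t powr (1 / real m)) ^ (m * n) = t ^ n" by (simp add: power_mult)
    then show ?thesis by (metis of_real_power)
  qed
  then have "avg (\<lambda>t. t powr (1 / real m)) w (\<lambda>y. y ^ (m * n)) x =
      (LINT t:{0<..<1}|lborel. (w t * of_real t ^ n) * x ^ (m * n))"
    unfolding avg_def by (intro set_lebesgue_integral_cong) (auto simp: power_mult_distrib mult_ac)
  then show ?thesis by simp
qed

text \<open>
  Integrating back from the \<open>n\<close>-th derivative: each lower derivative vanishes at \<open>0\<close>, so its size on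
  the segment is at most the length of the segment times the size of the next one.
\<close>

lemma derivs_le_top_deriv:
  assumes g: "g \<in> smooth_U m" and x: "x \<in> lines m"
    and zero: "\<And>i. i < n \<Longrightarrow> derivs m i g 0 = 0"
    and top: "\<And>y. y \<in> closed_segment 0 x \<Longrightarrow> norm (derivs m n g y) \<le> e" and e: "e \<ge> 0"
    and i: "i \<le> n" and y: "y \<in> closed_segment 0 x"
  shows "norm (derivs m i g y) \<le> e * max 1 (norm x) ^ n"
proof -
  define X where "X = max 1 (norm x)"
  have X: "X \<ge> 1" "norm x \<le> X" by (auto simp: X_def)
  have "norm (derivs m (n - k) g y) \<le> e * X ^ k" if "k \<le> n" "y \<in> closed_segment 0 x" for k y
    using that
  proof (induction k arbitrary: y)
    case 0
    then show ?case using top by simp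
  next
    case (Suc k)
    define G where "G = derivs m (n - Suc k) g"
    have G: "deriv_U m G = derivs m (n - k) g"
    proof -
      have "n - k = Suc (n - Suc k)" using Suc.prems(1) by simp
      then show ?thesis by (simp add: G_def)
    qed
    have Gs: "G \<in> smooth_U m" unfolding G_def by (rule smooth_U_derivs[OF g])
    have "norm (G y - G 0) \<le> (e * X ^ k) * norm (y - 0)"
    proof (rule field_differentiable_bound[OF convex_closed_segment[of 0 x]])
      fix z assume z: "z \<in> closed_segment 0 x"
      show "(G has_field_derivative deriv_U m G z) (at z within closed_segment 0 x)"
        by (rule DERIV_subset[OF smooth_U_derivative[OF Gs] segment_0_lines[OF x]]) (use z segment_0_lines[OF x] in blast)
      show "norm (deriv_U m G z) \<le> e * X ^ k"
        unfolding G using Suc.IH[OF _ z] Suc.prems(1) by simp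
    qed (use Suc.prems in auto)
    also have "\<dots> \<le> (e * X ^ k) * X"
      using e X norm_segment_le[OF Suc.prems(2)] by (intro mult_left_mono) auto
    finally show ?case using zero[of "n - Suc k"] Suc.prems(1) by (simp add: G_def mult_ac)
  qed
  from this[of "n - i" y] have "norm (derivs m i g y) \<le> e * X ^ (n - i)" using i y by simp
  also have "\<dots> \<le> e * X ^ n" using X e by (intro mult_left_mono power_increasing) auto
  finally show ?thesis by (simp add: X_def)
qed

lemma smooth_U_sum_derivs:
  assumes "\<And>i. i \<in> A \<Longrightarrow> f i \<in> smooth_U m"
  shows "(\<lambda>x. \<Sum>i\<in>A. f i x) \<in> smooth_U m"
    "\<And>x. x \<in> lines m \<Longrightarrow> derivs m n (\<lambda>x. \<Sum>i\<in>A. f i x) x = (\<Sum>i\<in>A. derivs m n (f i) x)"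
proof -
  have d: "has_U_derivative (\<lambda>x. \<Sum>i\<in>A. derivs m n (f i) x) (\<Sum>i\<in>A. derivs m (Suc n) (f i) x) m x"
    if "x \<in> lines m" for n x
  proof (rule DERIV_sum)
    fix i assume "i \<in> A"
    from smooth_U_derivative[OF smooth_U_derivs[OF assms[OF this]] that, of n]
    show "has_U_derivative (derivs m n (f i)) (derivs m (Suc n) (f i) x) m x" by simp
  qed
  note S = smooth_U_I[of m "\<lambda>n x. \<Sum>i\<in>A. derivs m n (f i) x" "\<lambda>x. \<Sum>i\<in>A. f i x", OF d]
  show "(\<lambda>x. \<Sum>i\<in>A. f i x) \<in> smooth_U m" by (rule S(1)) auto
  show "\<And>x. x \<in> lines m \<Longrightarrow> derivs m n (\<lambda>x. \<Sum>i\<in>A. f i x) x = (\<Sum>i\<in>A. derivs m n (f i) x)"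
    by (rule S(2)) auto
qed

text \<open>
  The hypothesis \<open>rec\<close> is the assertion for \<open>g = x\<^bsup>m(n+1)\<^esup>\<close>; for constants both sides vanish, on the
  left because \<open>0\<close> belongs to \<open>cs\<close>.  The difference \<open>D g\<close> of the two sides is linear in \<open>g\<close> and bounded by
  the derivatives of \<open>g\<close> up to order \<open>m\<close> on the segment from \<open>0\<close> to \<open>x\<close>.  For \<open>g\<close> of type \<open>m\<close> the
  derivatives of order \<open>1, \<dots>, m - 1\<close> vanish at \<open>0\<close>, so that after subtraction of a polynomial in
  \<open>x\<^sup>m\<close> they are all controlled by the one of order \<open>m\<close>, which can be made as small as desired.
\<close>

lemma avg_root_intertwining:
  fixes m :: nat and w :: "real \<Rightarrow> complex" and cs :: "complex list"
  defines "\<rho> \<equiv> (\<lambda>t. t powr (1 / real m))"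
    and "\<mu> \<equiv> (\<lambda>n. LINT t:{0<..<1}|lborel. w t * of_real t ^ n)"
  assumes w: "weight w" and m: "m \<ge> 1" and len: "length cs = m" and cs0: "0 \<in> set cs"
    and rec: "\<And>n. \<mu> (Suc n) * prod_list (map (\<lambda>c. of_nat (m * Suc n) + c) cs) =
        \<mu> n * (\<Prod>l<m. of_nat (m * Suc n) - of_nat l)"
    and g: "g \<in> smooth_U m" and ty: "typed m m g" and x: "x \<in> lines m" "x \<noteq> 0"
  shows "avg \<rho> w (eulers m cs g) x = x ^ m * avg \<rho> w (derivs m m g) x"
proof -
  have \<rho>: "unit_scale \<rho>" unfolding \<rho>_def by (rule unit_scale_root)
  define D where "D = (\<lambda>h. avg \<rho> w (eulers m cs h) x - x ^ m * avg \<rho> w (derivs m m h) x)"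
  have cont: "continuous_on (lines m) (eulers m cs h)" "continuous_on (lines m) (derivs m m h)"
    if "h \<in> smooth_U m" for h
    using that by (auto intro!: smooth_U_continuous eulers_smooth smooth_U_derivs)
  have D_add: "D (\<lambda>y. h y + k y) = D h + D k" if "h \<in> smooth_U m" "k \<in> smooth_U m" for h k
  proof -
    have "avg \<rho> w (eulers m cs (\<lambda>y. h y + k y)) x = avg \<rho> w (\<lambda>y. eulers m cs h y + eulers m cs k y) x"
      by (rule avg_cong[OF x(1) eulers_add[OF that]])
    moreover have "avg \<rho> w (derivs m m (\<lambda>y. h y + k y)) x = avg \<rho> w (\<lambda>y. derivs m m h y + derivs m m k y) x"
      by (rule avg_cong[OF x(1) smooth_U_add(2)[OF that]])
    ultimately show ?thesis
      unfolding D_def using avg_add[OF w \<rho> cont(1)[OF that(1)] cont(1)[OF that(2)] x(1)]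
        avg_add[OF w \<rho> cont(2)[OF that(1)] cont(2)[OF that(2)] x(1)]
      by (simp add: algebra_simps)
  qed
  have D_cmult: "D (\<lambda>y. a * h y) = a * D h" if "h \<in> smooth_U m" for h a
  proof -
    have "avg \<rho> w (eulers m cs (\<lambda>y. a * h y)) x = avg \<rho> w (\<lambda>y. a * eulers m cs h y) x"
      by (rule avg_cong[OF x(1) eulers_cmult[OF that]])
    moreover have "avg \<rho> w (derivs m m (\<lambda>y. a * h y)) x = avg \<rho> w (\<lambda>y. a * derivs m m h y) x"
      by (rule avg_cong[OF x(1) smooth_U_cmult(2)[OF that]])
    ultimately show ?thesis unfolding D_def avg_cmult by (simp add: algebra_simps)
  qed
  have D_power: "D (\<lambda>y. y ^ (m * n)) = 0" for n
  proof -
    have E: "avg \<rho> w (eulers m cs (\<lambda>y. y ^ (m * n))) x =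
        prod_list (map (\<lambda>c. of_nat (m * n) + c) cs) * (\<mu> n * x ^ (m * n))"
    proof -
      have "avg \<rho> w (eulers m cs (\<lambda>y. y ^ (m * n))) x =
          avg \<rho> w (\<lambda>y. prod_list (map (\<lambda>c. of_nat (m * n) + c) cs) * y ^ (m * n)) x"
        by (rule avg_cong[OF x(1) eulers_power])
      then show ?thesis unfolding avg_cmult \<rho>_def avg_monomial[OF m] \<mu>_def .
    qed
    have P: "avg \<rho> w (derivs m m (\<lambda>y. y ^ (m * n))) x =
        (\<Prod>l<m. of_nat (m * n) - of_nat l) * avg \<rho> w (\<lambda>y. y ^ (m * n - m)) x"
    proof -
      have "avg \<rho> w (derivs m m (\<lambda>y. y ^ (m * n))) x =
          avg \<rho> w (\<lambda>y. (\<Prod>l<m. of_nat (m * n) - of_nat l) * y ^ (m * n - m)) x"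
        by (rule avg_cong[OF x(1) deriv_U_power])
      then show ?thesis unfolding avg_cmult .
    qed
    show ?thesis
    proof (cases n)
      case 0
      have "prod_list (map (\<lambda>c. of_nat (m * n) + c) cs) = 0"
        using cs0 0 by (simp add: prod_list_zero_iff)
      moreover have "(\<Prod>l<m. of_nat (m * n) - of_nat l :: complex) = 0"
        using 0 m by (intro prod_zero) auto
      ultimately show ?thesis unfolding D_def E P by simp
    next
      case (Suc n')
      then have mn: "m * n - m = m * n'" "m * n = m + m * n'" by simp_all
      have "avg \<rho> w (\<lambda>y. y ^ (m * n - m)) x = \<mu> n' * x ^ (m * n')"
        unfolding mn(1) \<rho>_def avg_monomial[OF m] \<mu>_def ..
      moreover have "p * (\<mu> n * x ^ (m * n)) - x ^ m * (q * (\<mu> n' * x ^ (m * n'))) = (\<mu> n * p - \<mu> n' * q) * x ^ (m * n)"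
        for p q
        by (simp add: mn(2) power_add algebra_simps)
      ultimately have "D (\<lambda>y. y ^ (m * n)) = (\<mu> n * prod_list (map (\<lambda>c. of_nat (m * n) + c) cs)
          - \<mu> n' * (\<Prod>l<m. of_nat (m * n) - of_nat l)) * x ^ (m * n)"
        unfolding D_def E P by simp
      also have "\<dots> = 0" using rec[of n'] unfolding Suc by simp
      finally show ?thesis .
    qed
  qed
  have D_sum: "D (\<lambda>y. \<Sum>i\<le>N. \<gamma> i * y ^ (m * i)) = 0" for \<gamma> and N :: nat
  proof (induction N)
    case 0
    show ?case using D_cmult[OF smooth_U_power, of "\<gamma> 0" "m * 0"] D_power[of 0] by simp
  next
    case (Suc N)
    have "(\<lambda>y. \<Sum>i\<le>N. \<gamma> i * y ^ (m * i)) \<in> smooth_U m"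
      by (intro smooth_U_sum_derivs(1) smooth_U_cmult(1) smooth_U_power)
    from D_add[OF this smooth_U_cmult(1)[OF smooth_U_power]] show ?case
      using Suc.IH D_cmult[OF smooth_U_power] D_power[of "Suc N"] by simp
  qed
  obtain K where K0: "K \<ge> 0" and K: "\<forall>f\<in>smooth_U m. \<forall>M\<ge>0. (\<forall>i\<le>0 + length cs. \<forall>y\<in>closed_segment 0 x. norm (derivs m i f y) \<le> M) \<longrightarrow>
     (\<forall>i\<le>0. \<forall>y\<in>closed_segment 0 x. norm (derivs m i (eulers m cs f) y) \<le> K * M)"
    using eulers_bound[OF x(1), of 0 cs] by (elim exE conjE)
  define W where "W = (LINT t:{0<..<1}|lborel. norm (w t))"
  have D_small: "norm (D h) \<le> (W * K + norm x ^ m * W) * M"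
    if h: "h \<in> smooth_U m" and M: "M \<ge> 0" and b: "\<And>i y. i \<le> m \<Longrightarrow> y \<in> closed_segment 0 x \<Longrightarrow> norm (derivs m i h y) \<le> M"
    for h M
  proof -
    have "norm (eulers m cs h y) \<le> K * M" if "y \<in> closed_segment 0 x" for y
      using K[rule_format, OF h M _ _ that, of 0] b len by simp
    then have 1: "norm (avg \<rho> w (eulers m cs h) x) \<le> W * (K * M)"
      unfolding W_def by (rule avg_norm_le[OF \<rho> x(1) _ w cont(1)[OF h]])
    have 2: "norm (avg \<rho> w (derivs m m h) x) \<le> W * M"
      unfolding W_def by (rule avg_norm_le[OF \<rho> x(1) _ w cont(2)[OF h]]) (rule b, simp)
    have "norm (D h) \<le> norm (avg \<rho> w (eulers m cs h) x) + norm x ^ m * norm (avg \<rho> w (derivs m m h) x)"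
      unfolding D_def by (rule order_trans[OF norm_triangle_ineq4]) (simp add: norm_mult norm_power)
    also have "\<dots> \<le> W * (K * M) + norm x ^ m * (W * M)"
      using 1 2 by (intro add_mono mult_left_mono) auto
    finally show ?thesis by (simp add: algebra_simps)
  qed
  define C where "C = (W * K + norm x ^ m * W) * max 1 (norm x) ^ m"
  have approx: "norm (D g) \<le> C * e" if e: "e > 0" for e
  proof -
    \<comment> \<open>The m-th derivative of g along the segment, as a function of the m-th power of the parameter.\<close>
    define H where "H = (\<lambda>u. derivs m m g (x * of_real (root m u)))"
    have "continuous_on {0..1} H"
      unfolding H_def
    proof (rule continuous_on_compose2[OF smooth_U_continuous[OF smooth_U_derivs[OF g]]])
      show "continuous_on {0..1} (\<lambda>u. x * of_real (root m u))"
        by (intro continuous_intros)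
    qed (use lines_scale[OF x(1)] in auto)
    then obtain \<alpha> N where \<alpha>: "\<And>u. u \<in> {0..1} \<Longrightarrow> norm (H u - (\<Sum>i\<le>N::nat. \<alpha> i * of_real u ^ i)) < e"
      using complex_Weierstrass[OF _ e] by metis
    define P where "P = (\<lambda>i. \<Prod>l<m. of_nat (m * Suc i) - of_nat l :: complex)"
    have P: "P i \<noteq> 0" for i
    proof -
      have "of_nat (m * Suc i) - of_nat l \<noteq> (0::complex)" if "l < m" for l
      proof -
        have "m * Suc i \<noteq> l" using that by simp
        then show ?thesis by (metis of_nat_eq_iff right_minus_eq)
      qed
      then show ?thesis unfolding P_def by simp
    qed
    \<comment> \<open>R is the polynomial in y ^ m that agrees with g at 0 and whose m-th derivative is the approximation.\<close>
    define \<gamma> where "\<gamma> = (\<lambda>i. case i of 0 \<Rightarrow> g 0 | Suc i \<Rightarrow> \<alpha> i / (x ^ (m * i) * P i))"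
    define R where "R = (\<lambda>y. \<Sum>i\<le>Suc N. \<gamma> i * y ^ (m * i))"
    have R: "R \<in> smooth_U m"
      unfolding R_def by (intro smooth_U_sum_derivs(1) smooth_U_cmult(1) smooth_U_power)
    have R_top: "derivs m m R y = (\<Sum>i\<le>N. \<alpha> i * (y / x) ^ (m * i))" if y: "y \<in> lines m" for y
    proof -
      have "derivs m m R y = (\<Sum>i\<le>Suc N. derivs m m (\<lambda>y. \<gamma> i * y ^ (m * i)) y)"
        unfolding R_def by (rule smooth_U_sum_derivs(2)[OF _ y]) (intro smooth_U_cmult(1) smooth_U_power)
      also have "\<dots> = (\<Sum>i\<le>Suc N. \<gamma> i * ((\<Prod>l<m. of_nat (m * i) - of_nat l) * y ^ (m * i - m)))"
        unfolding smooth_U_cmult(2)[OF smooth_U_power y] deriv_U_power[OF y] ..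
      also have "\<dots> = (\<Sum>i\<le>N. \<gamma> (Suc i) * (P i * y ^ (m * i)))"
      proof -
        have "(\<Prod>l<m. of_nat (m * 0) - of_nat l :: complex) = 0"
          using m by (intro prod_zero) auto
        moreover have "m * Suc i - m = m * i" for i by simp
        ultimately show ?thesis unfolding sum.atMost_Suc_shift P_def by (simp only:) simp
      qed
      also have "\<dots> = (\<Sum>i\<le>N. \<alpha> i * (y / x) ^ (m * i))"
        using P by (intro sum.cong refl) (simp add: \<gamma>_def power_divide)
      finally show ?thesis .
    qed
    define h where "h = (\<lambda>y. g y + (-1) * R y)"
    have h: "h \<in> smooth_U m"
      unfolding h_def by (intro smooth_U_add(1) smooth_U_cmult(1) g R)
    have h_derivs: "derivs m i h y = derivs m i g y - derivs m i R y" if "y \<in> lines m" for i y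
      unfolding h_def smooth_U_add(2)[OF g smooth_U_cmult(1)[OF R] that] smooth_U_cmult(2)[OF R that] by simp
    have em: "eps m ^ m = 1" using m by (simp add: eps_power_eq_1_iff)
    have "typed m m h"
      using ty unfolding typed_def h_def R_def em by (simp add: power_mult_distrib power_mult em)
    have z: "0 \<in> lines m" by (rule lines_zero[OF m])
    have zero: "derivs m i h 0 = 0" if "i < m" for i
    proof (cases i)
      case 0
      have "R 0 = \<gamma> 0"
        unfolding R_def sum.atMost_Suc_shift using m by (simp add: power_0_left)
      then show ?thesis using 0 by (simp add: h_def \<gamma>_def)
    next
      case (Suc i')
      have "eps m ^ i * derivs m i h 0 = derivs m i h 0"
        using typed_derivs[OF \<open>typed m m h\<close> h z, of i] em by simp
      moreover have "eps m ^ i \<noteq> 1"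
        using eps_power_eq_1_iff[OF m, of i] Suc that by (auto dest: dvd_imp_le)
      ultimately show ?thesis by simp
    qed
    have top: "norm (derivs m m h y) \<le> e" if "y \<in> closed_segment 0 x" for y
    proof -
      obtain v where v: "0 \<le> v" "v \<le> 1" "y = x * of_real v"
        using \<open>y \<in> closed_segment 0 x\<close> by (auto simp: closed_segment_def scaleR_conv_of_real mult.commute)
      have "y \<in> lines m" using v(3) lines_scale[OF x(1)] by simp
      have "H (v ^ m) = derivs m m g y"
        using v m by (simp add: H_def real_root_power_cancel)
      moreover have "(\<Sum>i\<le>N. \<alpha> i * of_real (v ^ m) ^ i) = derivs m m R y"
        unfolding R_top[OF \<open>y \<in> lines m\<close>] using x(2) v(3) by (simp add: power_mult)
      moreover have "v ^ m \<in> {0..1}" using v by (simp add: power_le_one)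
      ultimately show ?thesis using \<alpha>[of "v ^ m"] h_derivs[OF \<open>y \<in> lines m\<close>, of m] by simp
    qed
    have "norm (D h) \<le> (W * K + norm x ^ m * W) * (e * max 1 (norm x) ^ m)"
      by (rule D_small[OF h]) (use e derivs_le_top_deriv[OF h x(1) zero top] in auto)
    moreover have "D h = D g"
      using D_add[OF g smooth_U_cmult(1)[OF R], of "-1"] D_cmult[OF R, of "-1"] D_sum[of \<gamma> "Suc N"]
      unfolding h_def R_def by simp
    ultimately show ?thesis by (simp add: C_def mult_ac)
  qed
  have "norm (D g) \<le> 0"
  proof (rule field_le_epsilon)
    fix e :: real assume "e > 0"
    \<comment> \<open>C may be 0, hence the denominator |C| + 1.\<close>
    have "norm (D g) \<le> C * (e / (\<bar>C\<bar> + 1))" using approx[of "e / (\<bar>C\<bar> + 1)"] \<open>e > 0\<close> by simp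
    also have "\<dots> \<le> \<bar>C\<bar> * (e / (\<bar>C\<bar> + 1))" using \<open>e > 0\<close> by (intro mult_right_mono) auto
    also have "\<dots> \<le> e" using \<open>e > 0\<close> by (simp add: field_simps)
    finally show "norm (D g) \<le> 0 + e" by simp
  qed
  then show ?thesis by (simp add: D_def)
qed

section \<open>The components of V\<close>

definition R_weight :: "nat \<Rightarrow> (nat \<Rightarrow> complex) \<Rightarrow> real \<Rightarrow> complex" where
  "R_weight m \<nu> t = of_real (sqrt (real m)) * (\<Prod>j = 1..m - 1. Gamma (\<nu> j + 1)) /
       of_real ((2 * pi) powr ((real m - 1) / 2)) * meijer_G (m - 1) \<nu> (\<lambda>j. - of_nat j / of_nat m) t"

lemma op_R_eq_avg: "op_R m \<nu> = avg (\<lambda>t. t powr (1 / real m)) (R_weight m \<nu>)"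
  unfolding op_R_def avg_def R_weight_def by (intro ext) (simp only: mult.assoc set_integral_mult_right)

text \<open>
  With \<open>b\<^sub>j = - j / m\<close>, raising \<open>n\<close> by one multiplies each quotient \<open>\<Gamma>(b\<^sub>j + n + 1) / \<Gamma>(\<nu>\<^sub>j + n + 1)\<close> by
  \<open>(n + 1 - j / m) / (\<nu>\<^sub>j + n + 1)\<close>.
\<close>

lemma R_weight_moments:
  assumes m: "m \<ge> 2" and \<nu>: "\<And>j. j \<in> {1..m - 1} \<Longrightarrow> Re (\<nu> j) > 0"
  shows "weight (R_weight m \<nu>)"
    "(LINT t:{0<..<1}|lborel. R_weight m \<nu> t * of_real t ^ Suc n) * (\<Prod>j=1..m-1. \<nu> j + of_nat (Suc n)) =
     (LINT t:{0<..<1}|lborel. R_weight m \<nu> t * of_real t ^ n) * (\<Prod>j=1..m-1. of_nat (Suc n) - of_nat j / of_nat m)"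
proof -
  define b where "b = (\<lambda>j. - of_nat j / of_nat m :: complex)"
  define C where "C = of_real (sqrt (real m)) * (\<Prod>j = 1..m - 1. Gamma (\<nu> j + 1)) /
       of_real ((2 * pi) powr ((real m - 1) / 2))"
  have Re_b: "Re (b j) = - real j / real m" for j
    by (simp add: b_def)
  have b: "- 1 < Re (b j)" "Re (b j) < Re (\<nu> j)" if "j \<in> {1..m - 1}" for j
    using that m \<nu>[OF that] by (auto simp: Re_b field_simps intro: order.strict_trans1[of _ 0])
  have gen: "b i - b j \<notin> \<int>" if "i \<in> {1..m - 1}" "j \<in> {1..m - 1}" "i \<noteq> j" for i j
  proof
    assume "b i - b j \<in> \<int>"
    then obtain k where "b i - b j = of_int k" by (elim Ints_cases)
    then have "of_int (int j - int i) = (of_int (k * int m) :: complex)"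
      using m by (simp add: b_def field_simps)
    then have eq: "int j - int i = k * int m" by (simp only: of_int_eq_iff)
    have "\<bar>int j - int i\<bar> < int m" "int j - int i \<noteq> 0" using that by auto
    then show False using eq by (metis dvd_triv_right zdvd_imp_le zdvd_not_zless abs_dvd_iff dvd_abs_iff zero_less_abs_iff)
  qed
  have G: "set_integrable lborel {0<..<1} (meijer_G (m - 1) \<nu> b)"
    "\<And>k. (LINT t:{0<..<1}|lborel. meijer_G (m - 1) \<nu> b t * of_real t ^ k) =
       (\<Prod>j=1..m-1. Gamma (b j + of_nat k + 1) / Gamma (\<nu> j + of_nat k + 1))"
    using meijer_G_moments[OF _ b(2) b(1) gen] m by auto
  have w: "R_weight m \<nu> = (\<lambda>t. C * meijer_G (m - 1) \<nu> b t)"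
    by (rule ext) (simp only: R_weight_def C_def b_def)
  show "weight (R_weight m \<nu>)" unfolding w by (intro set_integrable_mult_right G(1))
  define M where "M = (\<lambda>k. \<Prod>j=1..m-1. Gamma (b j + of_nat k + 1) / Gamma (\<nu> j + of_nat k + 1))"
  have mom: "(LINT t:{0<..<1}|lborel. R_weight m \<nu> t * of_real t ^ k) = C * M k" for k
    unfolding w mult.assoc set_integral_mult_right M_def using G(2)[of k] by simp
  have "M (Suc n) * (\<Prod>j=1..m-1. \<nu> j + of_nat (Suc n)) = M n * (\<Prod>j=1..m-1. of_nat (Suc n) - of_nat j / of_nat m)"
    unfolding M_def prod.distrib[symmetric]
  proof (intro prod.cong refl)
    fix j assume j: "j \<in> {1..m - 1}"
    define p q where "p = b j + of_nat n + 1" and "q = \<nu> j + of_nat n + 1"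
    have "Re p > 0" "Re q > 0" using b[OF j] \<nu>[OF j] by (simp_all add: p_def q_def)
    then have "p \<notin> \<int>\<^sub>\<le>\<^sub>0" "q \<notin> \<int>\<^sub>\<le>\<^sub>0"
      by (auto elim!: nonpos_Ints_cases')
    then have "Gamma (p + 1) = p * Gamma p" "Gamma (q + 1) = q * Gamma q" "q \<noteq> 0"
      by (auto simp: Gamma_plus1)
    moreover have "b j + of_nat (Suc n) + 1 = p + 1" "\<nu> j + of_nat (Suc n) + 1 = q + 1" "\<nu> j + of_nat (Suc n) = q"
      "of_nat (Suc n) - of_nat j / of_nat m = p"
      by (simp_all add: p_def q_def b_def)
    ultimately show "Gamma (b j + of_nat (Suc n) + 1) / Gamma (\<nu> j + of_nat (Suc n) + 1) * (\<nu> j + of_nat (Suc n)) =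
        Gamma (b j + of_nat n + 1) / Gamma (\<nu> j + of_nat n + 1) * (of_nat (Suc n) - of_nat j / of_nat m)"
      unfolding p_def[symmetric] q_def[symmetric] by (simp only:) (simp add: p_def[symmetric] q_def[symmetric])
  qed
  then show "(LINT t:{0<..<1}|lborel. R_weight m \<nu> t * of_real t ^ Suc n) * (\<Prod>j=1..m-1. \<nu> j + of_nat (Suc n)) =
     (LINT t:{0<..<1}|lborel. R_weight m \<nu> t * of_real t ^ n) * (\<Prod>j=1..m-1. of_nat (Suc n) - of_nat j / of_nat m)"
    unfolding mom by (simp add: mult.assoc)
qed

text \<open>
  On \<open>x\<^bsup>mn\<^esup>\<close> the Euler operators give \<open>m\<^sup>m n \<Prod>\<^sub>j (n + \<nu>\<^sub>j)\<close> and the \<open>m\<close>-th derivative gives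
  \<open>m\<^sup>m n \<Prod>\<^sub>j (n - j / m)\<close>, which is what the recursion of the moments compensates.
\<close>

lemma op_R_intertwining:
  assumes m: "m \<ge> 2" and \<nu>: "\<And>j. j \<in> {1..m - 1} \<Longrightarrow> Re (\<nu> j) > 0"
    and g: "g \<in> smooth_U m" "typed m m g" and x: "x \<in> lines m" "x \<noteq> 0"
  shows "op_R m \<nu> (eulers m (map (\<lambda>k. of_nat m * \<nu> k) [1..<m] @ [0]) g) x = x ^ m * op_R m \<nu> (derivs m m g) x"
  unfolding op_R_eq_avg
proof (rule avg_root_intertwining[OF R_weight_moments(1)[OF m \<nu>] _ _ _ _ g x])
  fix n
  define M where "M = (\<lambda>n. LINT t:{0<..<1}|lborel. R_weight m \<nu> t * of_real t ^ n)"
  have mz: "(of_nat m :: complex) \<noteq> 0" using m by simp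
  have L: "prod_list (map (\<lambda>c. of_nat (m * Suc n) + c) (map (\<lambda>k. of_nat m * \<nu> k) [1..<m] @ [0]))
      = of_nat m ^ (m - 1) * (\<Prod>j=1..m-1. \<nu> j + of_nat (Suc n)) * of_nat (m * Suc n)"
  proof -
    have "prod_list (map (\<lambda>c. of_nat (m * Suc n) + c) (map (\<lambda>k. of_nat m * \<nu> k) [1..<m])) =
        (\<Prod>k\<in>{1..<m}. of_nat (m * Suc n) + of_nat m * \<nu> k)"
      using prod.distinct_set_conv_list[of "[1..<m]" "\<lambda>k. of_nat (m * Suc n) + of_nat m * \<nu> k"]
      by (simp add: o_def)
    also have "\<dots> = (\<Prod>k\<in>{1..m-1}. of_nat m * (\<nu> k + of_nat (Suc n)))"
      using m by (intro prod.cong) (auto simp: algebra_simps)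
    also have "\<dots> = of_nat m ^ (m - 1) * (\<Prod>j=1..m-1. \<nu> j + of_nat (Suc n))"
      by (simp add: prod.distrib del: of_nat_Suc)
    finally show ?thesis by (simp del: of_nat_Suc of_nat_mult map_map)
  qed
  have R: "(\<Prod>l<m. of_nat (m * Suc n) - of_nat l :: complex)
      = of_nat m ^ (m - 1) * (\<Prod>j=1..m-1. of_nat (Suc n) - of_nat j / of_nat m) * of_nat (m * Suc n)"
  proof -
    have "{..<m} = insert 0 {1..m-1}" using m by auto
    then have "(\<Prod>l<m. of_nat (m * Suc n) - of_nat l :: complex) =
        of_nat (m * Suc n) * (\<Prod>l\<in>{1..m-1}. of_nat (m * Suc n) - of_nat l)"
      by simp
    also have "(\<Prod>l\<in>{1..m-1}. of_nat (m * Suc n) - of_nat l :: complex) =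
       (\<Prod>l\<in>{1..m-1}. of_nat m * (of_nat (Suc n) - of_nat l / of_nat m))"
      using mz by (intro prod.cong refl) (simp add: algebra_simps)
    also have "\<dots> = of_nat m ^ (m - 1) * (\<Prod>j=1..m-1. of_nat (Suc n) - of_nat j / of_nat m)"
      by (simp add: prod.distrib del: of_nat_Suc)
    finally show ?thesis by (simp only: mult_ac)
  qed
  have "M (Suc n) * (\<Prod>j=1..m-1. \<nu> j + of_nat (Suc n)) = M n * (\<Prod>j=1..m-1. of_nat (Suc n) - of_nat j / of_nat m)"
    unfolding M_def by (rule R_weight_moments(2)[OF m \<nu>])
  moreover have "X * (c * A * d) = (X * A) * (c * d)" for X c A d :: complex
    by (simp add: mult_ac)
  ultimately have "M (Suc n) * (of_nat m ^ (m - 1) * (\<Prod>j=1..m-1. \<nu> j + of_nat (Suc n)) * of_nat (m * Suc n)) =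
      M n * (of_nat m ^ (m - 1) * (\<Prod>j=1..m-1. of_nat (Suc n) - of_nat j / of_nat m) * of_nat (m * Suc n))"
    by (simp only:)
  then show "(LINT t:{0<..<1}|lborel. R_weight m \<nu> t * of_real t ^ Suc n) *
      prod_list (map (\<lambda>c. of_nat (m * Suc n) + c) (map (\<lambda>k. of_nat m * \<nu> k) [1..<m] @ [0])) =
      (LINT t:{0<..<1}|lborel. R_weight m \<nu> t * of_real t ^ n) * (\<Prod>l<m. of_nat (m * Suc n) - of_nat l)"
    unfolding L R M_def .
qed (use m in auto)

lemma typed_zero:
  assumes "typed m j f" "1 \<le> j" "j < m"
  shows "f 0 = 0"
proof -
  have "f 0 = eps m ^ j * f 0" using assms lines_zero[of m] unfolding typed_def by force
  moreover have "eps m ^ j \<noteq> 1" using eps_power_eq_1_iff[of m j] assms by (auto dest: dvd_imp_le)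
  ultimately show ?thesis by simp
qed

lemma typed_cong: "typed m j f \<Longrightarrow> (\<And>x. x \<in> lines m \<Longrightarrow> f x = g x) \<Longrightarrow> typed m j g"
  unfolding typed_def by (metis lines_eps)

lemma typed_deriv:
  assumes "typed m (Suc j) f" "f \<in> smooth_U m"
  shows "typed m j (deriv_U m f)"
  unfolding typed_def
proof
  fix x assume "x \<in> lines m"
  from typed_derivs[OF assms this, of 1] show "deriv_U m f (eps m * x) = eps m ^ j * deriv_U m f x"
    by simp
qed

lemma typed_avg: "typed m j f \<Longrightarrow> typed m j (avg \<rho> w f)"
  unfolding typed_def avg_def
proof
  fix x assume f: "\<forall>x\<in>lines m. f (eps m * x) = eps m ^ j * f x" and x: "x \<in> lines m"
  have "f (eps m * x * of_real (\<rho> t)) = eps m ^ j * f (x * of_real (\<rho> t))" for t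
    using f lines_scale[OF x] by (simp add: mult.assoc)
  then show "(LINT t:{0<..<1}|lborel. w t * f (eps m * x * of_real (\<rho> t))) =
      eps m ^ j * (LINT t:{0<..<1}|lborel. w t * f (x * of_real (\<rho> t)))"
    unfolding set_integral_mult_right[symmetric] by (simp only: mult.left_commute)
qed

lemma typed_integral_0:
  assumes "typed m j f" "f \<in> smooth_U m"
  shows "typed m (Suc j) (integral_0 f)"
proof (rule typed_cong)
  show "typed m (Suc j) (\<lambda>x. x * avg (\<lambda>t. t) (\<lambda>_. 1) f x)"
    using typed_avg[OF assms(1), of "\<lambda>t. t" "\<lambda>_. 1"] unfolding typed_def by simp
qed (simp add: integral_0_eq_avg[OF smooth_U_continuous[OF assms(2)]])

text \<open>
  Functions of type \<open>1, \<dots>, m - 1\<close> vanish at \<open>0\<close>, so that the singular term \<open>(c / x) h(x)\<close> is \<open>c\<close> times an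
  average of \<open>h'\<close>.  The value at \<open>0\<close> prescribed by the limit is therefore the value of this
  smooth expression.
\<close>

lemma bessel_factor_typed:
  assumes h: "h \<in> smooth_U m" and ty: "typed m (Suc j) h" and j: "Suc j < m"
  shows "bessel_factor m c h \<in> smooth_U m" "typed m j (bessel_factor m c h)"
    "\<And>x. x \<noteq> 0 \<Longrightarrow> bessel_factor m c h x = deriv_U m h x + c / x * h x"
proof -
  define q where "q = avg (\<lambda>t. t) (\<lambda>_. 1) (deriv_U m h)"
  define b where "b = (\<lambda>x. deriv_U m h x + c * q x)"
  have q: "q \<in> smooth_U m" unfolding q_def
    by (intro avg_smooth(1) weight_one unit_scale_ident smooth_U_deriv h)
  have b: "b \<in> smooth_U m" unfolding b_def
    by (intro smooth_U_add(1) smooth_U_cmult(1) smooth_U_deriv h q)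
  have "typed m j (deriv_U m h)" by (rule typed_deriv[OF ty h])
  then have tb: "typed m j b"
    using typed_avg[of m j "deriv_U m h"] unfolding b_def q_def typed_def by (simp add: algebra_simps)
  have h0: "h 0 = 0" using typed_zero[OF ty] j by simp
  have z: "0 \<in> lines m" using j by (intro lines_zero) simp
  have off: "b x = deriv_U m h x + c / x * h x" if "x \<in> lines m" "x \<noteq> 0" for x
    using smooth_U_ftc[OF h that(1)] h0 that(2) by (simp add: b_def q_def)
  have "Lim (at 0 within lines m) (\<lambda>x. deriv_U m h x + c / x * h x) = Lim (at 0 within lines m) b"
    by (rule Lim_lines_cong) (simp add: off)
  also have "\<dots> = b 0"
    using smooth_U_continuous[OF b] z unfolding continuous_on_def
    by (intro tendsto_Lim at_within_lines_nontrivial) auto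
  finally have eq: "b x = bessel_factor m c h x" if "x \<in> lines m" for x
    using off[OF that] by (simp add: bessel_factor_def extend_0_def)
  show "bessel_factor m c h \<in> smooth_U m" by (rule smooth_U_cong(1)[OF b eq])
  show "typed m j (bessel_factor m c h)" by (rule typed_cong[OF tb eq])
  show "\<And>x. x \<noteq> 0 \<Longrightarrow> bessel_factor m c h x = deriv_U m h x + c / x * h x"
    by (simp add: bessel_factor_def extend_0_def)
qed

lemma bessel_factor_cong:
  assumes "\<And>y. y \<in> lines m \<Longrightarrow> f y = g y" "x \<in> lines m"
  shows "bessel_factor m c f x = bessel_factor m c g x"
proof -
  have eq: "deriv_U m f y + c / y * f y = deriv_U m g y + c / y * g y" if "y \<in> lines m" for y
    using deriv_U_cong[OF assms(1) that] assms(1)[OF that] by simp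
  have "Lim (at 0 within lines m) (\<lambda>y. deriv_U m f y + c / y * f y) = Lim (at 0 within lines m) (\<lambda>y. deriv_U m g y + c / y * g y)"
    by (rule Lim_lines_cong) (rule eq)
  then show ?thesis using eq[OF assms(2)] by (simp add: bessel_factor_def extend_0_def)
qed

lemma op_A_top: "op_A m \<nu> m F = F"
  by (simp add: op_A_def)

lemma op_A_pred: "Suc j = m \<Longrightarrow> op_A m \<nu> j F = deriv_U m F"
  by (simp add: op_A_def)

lemma op_A_step:
  "Suc j < m \<Longrightarrow> op_A m \<nu> j F = bessel_factor m (of_nat m * \<nu> (Suc j) + of_nat m - of_nat (Suc j)) (op_A m \<nu> (Suc j) F)"
  by (simp add: op_A_def upt_conv_Cons)

lemma op_A_cong:
  assumes "\<And>y. y \<in> lines m \<Longrightarrow> F y = F' y" "x \<in> lines m" "j \<le> m"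
  shows "op_A m \<nu> j F x = op_A m \<nu> j F' x"
  using assms(3,2)
proof (induction j arbitrary: x rule: inc_induct)
  case base
  then show ?case by (simp add: op_A_top assms(1))
next
  case (step j)
  show ?case
  proof (cases "Suc j = m")
    case True
    then show ?thesis using deriv_U_cong[OF assms(1) step.prems] by (simp add: op_A_pred)
  next
    case False
    then have "Suc j < m" using step.hyps by simp
    then show ?thesis
      unfolding op_A_step[OF \<open>Suc j < m\<close>] by (intro bessel_factor_cong step.IH step.prems)
  qed
qed

text \<open>
  The rule that moves powers of \<open>x\<close> past a factor \<open>d/dx + (c + n) / x\<close>.
\<close>

lemma euler_power_mult:
  assumes h: "h \<in> smooth_U m" and x: "x \<in> lines m" "x \<noteq> 0"
  shows "euler m c (\<lambda>y. y ^ n * h y) x = x ^ Suc n * (deriv_U m h x + (c + of_nat n) / x * h x)"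
proof -
  have "has_U_derivative (\<lambda>y. y ^ n * h y) (of_nat n * x ^ (n - 1) * h x + deriv_U m h x * x ^ n) m x"
    by (intro DERIV_mult smooth_U_derivative h x) (auto intro!: derivative_eq_intros)
  then have "deriv_U m (\<lambda>y. y ^ n * h y) x = of_nat n * x ^ (n - 1) * h x + deriv_U m h x * x ^ n"
    by (rule deriv_U_eqI) (rule x)
  then show ?thesis
    using x(2) unfolding euler_def by (cases n) (simp_all add: field_simps)
qed

text \<open>
  Downward induction on \<open>j\<close>.  In the step, \<open>A\<^sub>j\<close> arises from \<open>A\<^bsub>j+1\<^esub>\<close> by the factor with
  \<open>c = m \<nu>\<^bsub>j+1\<^esub> + (m - j - 1)\<close>, and \<open>m - j - 1\<close> is the exponent that has accumulated so far.
\<close>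

lemma op_A_typed:
  assumes F: "F \<in> smooth_U m" "typed m m F" and j: "1 \<le> j" "j < m"
  shows "op_A m \<nu> j F \<in> smooth_U m \<and> typed m j (op_A m \<nu> j F) \<and>
    (\<forall>x\<in>lines m. x ^ (m - j) * op_A m \<nu> j F x = eulers m (map (\<lambda>k. of_nat m * \<nu> k) [Suc j..<m] @ [0]) F x)"
proof -
  have "j \<le> m - 1" using j by simp
  then show ?thesis using j(1)
  proof (induction j rule: inc_induct)
    case base
    have "typed m (Suc (m - 1)) F" using F(2) j by simp
    then show ?case
      using F(1) j typed_deriv by (auto simp: op_A_pred smooth_U_deriv euler_def)
  next
    case (step j)
    have j': "Suc j < m" using step.hyps by simp
    define h where "h = op_A m \<nu> (Suc j) F"
    have h: "h \<in> smooth_U m" "typed m (Suc j) h"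
      "\<And>x. x \<in> lines m \<Longrightarrow> x ^ (m - Suc j) * h x = eulers m (map (\<lambda>k. of_nat m * \<nu> k) [Suc (Suc j)..<m] @ [0]) F x"
      using step.IH by (auto simp: h_def)
    define c where "c = of_nat m * \<nu> (Suc j) + of_nat m - of_nat (Suc j)"
    have A: "op_A m \<nu> j F = bessel_factor m c h"
      unfolding op_A_step[OF j'] h_def c_def ..
    note B = bessel_factor_typed[OF h(1,2) j', where c = c]
    have "x ^ (m - j) * bessel_factor m c h x = eulers m (map (\<lambda>k. of_nat m * \<nu> k) [Suc j..<m] @ [0]) F x"
      if x: "x \<in> lines m" for x
    proof -
      have "eulers m (map (\<lambda>k. of_nat m * \<nu> k) [Suc j..<m] @ [0]) F x =
          euler m (of_nat m * \<nu> (Suc j)) (eulers m (map (\<lambda>k. of_nat m * \<nu> k) [Suc (Suc j)..<m] @ [0]) F) x"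
        using j' by (simp add: upt_conv_Cons)
      also have "\<dots> = euler m (of_nat m * \<nu> (Suc j)) (\<lambda>y. y ^ (m - Suc j) * h y) x"
        by (rule euler_cong[OF h(3)[symmetric] x])
      also have "\<dots> = x ^ (m - j) * bessel_factor m c h x"
      proof (cases "x = 0")
        case True
        have "m - j \<noteq> 0" "m - Suc j \<noteq> 0" using j' by auto
        then show ?thesis using True by (simp add: euler_def power_0_left)
      next
        case False
        have "c = of_nat m * \<nu> (Suc j) + of_nat (m - Suc j)" "m - j = Suc (m - Suc j)"
          using j' by (simp_all add: c_def of_nat_diff)
        then show ?thesis using euler_power_mult[OF h(1) x False] B(3)[OF False] by simp
      qed
      finally show ?thesis ..
    qed
    then show ?case using B(1,2) unfolding A by blast
  qed
qed

lemma type_proj_smooth: "f \<in> smooth_U m \<Longrightarrow> type_proj m i f \<in> smooth_U m"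
proof -
  assume f: "f \<in> smooth_U m"
  have "type_proj m i f = (\<lambda>x. 1 / of_nat m * (\<Sum>j = 0..m - 1. eps m powi (- int (i * j)) * f (eps m ^ j * x)))"
    by (rule ext) (rule type_proj_def)
  then show ?thesis
    by (simp only:) (intro smooth_U_cmult(1) smooth_U_sum_derivs(1) smooth_U_rotate(1) f)
qed

lemma type_proj_lessThan:
  "m \<ge> 1 \<Longrightarrow> type_proj m i f x = 1 / of_nat m * (\<Sum>j<m. f (eps m ^ j * x) / eps m ^ (i * j))"
  unfolding type_proj_def
  by (intro arg_cong2[of _ _ _ _ "(*)"] refl sum.cong)
     (auto simp: power_int_minus field_simps simp del: of_nat_mult)

lemma type_proj_typed:
  assumes m: "m \<ge> 1"
  shows "typed m i (type_proj m i f)"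
  unfolding typed_def
proof
  fix x assume "x \<in> lines m"
  have em: "eps m ^ m = 1" using m by (simp add: eps_power_eq_1_iff)
  define a where "a = (\<lambda>j. f (eps m ^ j * x) / eps m ^ (i * j))"
  have "a m = a 0" by (simp add: a_def em power_mult mult.commute[of i])
  have "(\<Sum>j<m. f (eps m ^ j * (eps m * x)) / eps m ^ (i * j)) = (\<Sum>j<m. eps m ^ i * a (Suc j))"
    by (intro sum.cong refl) (simp add: a_def power_add mult.assoc mult.left_commute)
  also have "\<dots> = eps m ^ i * (\<Sum>j<m. a (Suc j))"
    by (simp only: sum_distrib_left)
  also have "(\<Sum>j<m. a (Suc j)) = (\<Sum>j<m. a j)"
    using sum.lessThan_Suc_shift[of a m] \<open>a m = a 0\<close> by simp
  finally show "type_proj m i f (eps m * x) = eps m ^ i * type_proj m i f x"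
    unfolding type_proj_lessThan[OF m] a_def by simp
qed

lemma typed_eps_power:
  assumes "typed m j h" "x \<in> lines m"
  shows "h (eps m ^ l * x) = eps m ^ (j * l) * h x"
proof (induction l)
  case (Suc l)
  have "h (eps m ^ Suc l * x) = h (eps m * (eps m ^ l * x))" by (simp add: mult.assoc)
  also have "\<dots> = eps m ^ j * h (eps m ^ l * x)"
    using assms(1) lines_eps_power[OF assms(2)] unfolding typed_def by blast
  finally show ?case using Suc.IH by (simp add: power_add)
qed simp

text \<open>
  Orthogonality of the characters of the cyclic group of order \<open>m\<close>.
\<close>

lemma type_proj_of_typed:
  assumes ty: "typed m j h" and x: "x \<in> lines m" and i: "i \<in> {1..m - 1}" and j: "j \<in> {1..m}"
  shows "type_proj m i h x = (if i = j then h x else 0)"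
proof -
  have m: "m \<ge> 1" using j by simp
  define q where "q = eps m ^ j / eps m ^ i"
  have "(\<Sum>l<m. h (eps m ^ l * x) / eps m ^ (i * l)) = (\<Sum>l<m. q ^ l) * h x"
    unfolding sum_distrib_right
    by (intro sum.cong refl) (simp add: typed_eps_power[OF ty x] q_def power_divide power_mult)
  then have *: "type_proj m i h x = 1 / of_nat m * ((\<Sum>l<m. q ^ l) * h x)"
    unfolding type_proj_lessThan[OF m] by simp
  show ?thesis
  proof (cases "i = j")
    case True
    then have "(\<Sum>l<m. q ^ l) = of_nat m" by (simp add: q_def)
    then show ?thesis using * True m by simp
  next
    case False
    have "j mod m \<noteq> i mod m" using i j False by (cases "j = m") auto
    then have "eps m ^ j \<noteq> eps m ^ i" unfolding eps_power complex_root_unity_eq[OF m] .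
    then have "q \<noteq> 1" by (simp add: q_def)
    moreover have "q ^ m = 1"
    proof -
      have "(eps m ^ l) ^ m = 1" for l using m by (simp add: eps_power_eq_1_iff flip: power_mult)
      then show ?thesis by (simp add: q_def power_divide)
    qed
    ultimately have "(\<Sum>l<m. q ^ l) = 0" using geometric_sum[of q m] by simp
    then show ?thesis using * False by simp
  qed
qed

lemma type_proj_deriv:
  assumes f: "f \<in> smooth_U m" and x: "x \<in> lines m"
  shows "deriv_U m (type_proj m (Suc i) f) x = type_proj m i (deriv_U m f) x"
proof -
  have m: "m \<ge> 1" by (rule lines_nonempty_imp[OF x])
  have "has_U_derivative (\<lambda>x. 1 / of_nat m * (\<Sum>j<m. f (eps m ^ j * x) / eps m ^ (Suc i * j)))
      (1 / of_nat m * (\<Sum>j<m. deriv_U m (\<lambda>x. f (eps m ^ j * x)) x / eps m ^ (Suc i * j))) m x"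
    by (intro DERIV_cmult DERIV_sum DERIV_cdivide smooth_U_derivative[OF smooth_U_rotate(1)] f x)
  moreover have "deriv_U m (\<lambda>x. f (eps m ^ j * x)) x / eps m ^ (Suc i * j) = deriv_U m f (eps m ^ j * x) / eps m ^ (i * j)" for j
    unfolding smooth_U_rotate(2)[OF f x] by (simp add: power_add)
  ultimately have "has_U_derivative (type_proj m (Suc i) f) (type_proj m i (deriv_U m f) x) m x"
    unfolding type_proj_lessThan[OF m, abs_def] by simp
  then show ?thesis by (rule deriv_U_eqI) (rule x)
qed

lemma type_proj_m: "m \<ge> 1 \<Longrightarrow> type_proj m m f x = type_proj m 0 f x"
proof -
  assume m: "m \<ge> 1"
  have "eps m ^ (m * j) = 1" for j using m by (simp add: eps_power_eq_1_iff)
  then show ?thesis unfolding type_proj_lessThan[OF m] by simp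
qed

lemma integral_0_pow_smooth:
  assumes "f \<in> smooth_U m"
  shows "(integral_0 ^^ n) f \<in> smooth_U m"
    "\<And>x. x \<in> lines m \<Longrightarrow> derivs m (n + i) ((integral_0 ^^ n) f) x = derivs m i f x"
proof -
  show S: "(integral_0 ^^ n) f \<in> smooth_U m" for n
    by (induction n) (simp_all add: assms integral_0_smooth(1))
  fix x assume "x \<in> lines m"
  then show "derivs m (n + i) ((integral_0 ^^ n) f) x = derivs m i f x"
  proof (induction n)
    case (Suc n)
    then show ?case using integral_0_smooth(3)[OF S[of n] Suc.prems, of "n + i"] by simp
  qed simp
qed

lemma integral_0_pow_typed:
  assumes "f \<in> smooth_U m" "typed m j f"
  shows "typed m (j + n) ((integral_0 ^^ n) f)"
proof (induction n)
  case (Suc n)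
  from typed_integral_0[OF Suc.IH integral_0_pow_smooth(1)[OF assms(1)]] show ?case by simp
qed (simp add: assms)

lemma integral_0_pow_cong:
  assumes "\<And>y. y \<in> lines m \<Longrightarrow> f y = g y" "x \<in> lines m"
  shows "(integral_0 ^^ n) f x = (integral_0 ^^ n) g x"
  using assms(2)
proof (induction n arbitrary: x)
  case (Suc n)
  then show ?case using integral_0_cong[OF Suc.prems, of "(integral_0 ^^ n) f" "(integral_0 ^^ n) g"] by simp
qed (simp add: assms)

lemma integral_0_deriv:
  assumes "q \<in> smooth_U m" "x \<in> lines m"
  shows "integral_0 (deriv_U m q) x = q x - q 0"
  using smooth_U_ftc[OF assms] integral_0_eq_avg[OF smooth_U_continuous[OF smooth_U_deriv[OF assms(1)]] assms(2)]
  by simp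

section \<open>The intertwining relation\<close>

theorem theorem4p1:
  fixes m :: nat and \<nu> k :: "nat \<Rightarrow> complex"
  assumes "m \<ge> 2"
    and "\<And>j. j \<in> {1..m - 1} \<Longrightarrow> Re (\<nu> j) > 0"
    and "\<And>j. j \<in> {1..m - 1} \<Longrightarrow> k j = of_nat m * \<nu> j + of_nat m - of_nat j"
  shows "\<forall>f\<in>smooth_U m. op_V m \<nu> f \<in> smooth_U m \<and>
           (\<forall>x\<in>lines m. dunkl_T m k (op_V m \<nu> f) x = op_V m \<nu> (deriv_U m f) x)"
proof -
  have m: "m \<ge> 1" using assms(1) by simp
  note w = R_weight_moments(1)[OF assms(1,2)]
  have R_smooth: "op_R m \<nu> q \<in> smooth_U m" if "q \<in> smooth_U m" for q
    unfolding op_R_eq_avg by (rule avg_smooth(1)[OF w unit_scale_root that])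
  have R_deriv: "deriv_U m (op_R m \<nu> q) x =
      avg (\<lambda>t. t powr (1 / real m)) (\<lambda>t. R_weight m \<nu> t * of_real (t powr (1 / real m))) (deriv_U m q) x"
    if "q \<in> smooth_U m" "x \<in> lines m" for q x
    unfolding op_R_eq_avg by (rule avg_smooth(2)[OF w unit_scale_root that])
  have R_cong: "op_R m \<nu> q x = op_R m \<nu> q' x" if "\<And>y. y \<in> lines m \<Longrightarrow> q y = q' y" "x \<in> lines m" for q q' x
    unfolding op_R_eq_avg by (rule avg_cong[OF that(2,1)])
  define g where "g = (\<lambda>f j. (integral_0 ^^ (m - j)) (type_proj m j f))"
  define h where "h = (\<lambda>f j. op_A m \<nu> j (op_R m \<nu> (g f j)))"
  have V: "op_V m \<nu> f = (\<lambda>x. \<Sum>j=1..m. h f j x)" for f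
    by (rule ext) (simp add: op_V_def h_def g_def)
  have g: "g f j \<in> smooth_U m" "typed m m (g f j)" if "f \<in> smooth_U m" "j \<in> {1..m}" for f j
  proof -
    show "g f j \<in> smooth_U m"
      unfolding g_def by (intro integral_0_pow_smooth(1) type_proj_smooth that(1))
    show "typed m m (g f j)"
      using integral_0_pow_typed[OF type_proj_smooth[OF that(1)] type_proj_typed[OF m], of j "m - j"] that(2)
      by (simp add: g_def)
  qed
  have F: "op_R m \<nu> (g f j) \<in> smooth_U m" "typed m m (op_R m \<nu> (g f j))" if "f \<in> smooth_U m" "j \<in> {1..m}" for f j
    using R_smooth[OF g(1)[OF that]] typed_avg[OF g(2)[OF that]] by (simp_all add: op_R_eq_avg)
  have h: "h f j \<in> smooth_U m" "typed m j (h f j)" if f: "f \<in> smooth_U m" and j: "j \<in> {1..m}" for f j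
  proof -
    have "h f j \<in> smooth_U m \<and> typed m j (h f j)"
    proof (cases "j = m")
      case True
      then show ?thesis using F[OF f j] by (simp add: h_def op_A_top)
    next
      case False
      then show ?thesis using op_A_typed[OF F[OF f j]] j by (simp add: h_def)
    qed
    then show "h f j \<in> smooth_U m" "typed m j (h f j)" by auto
  qed
  have V_smooth: "op_V m \<nu> f \<in> smooth_U m" if "f \<in> smooth_U m" for f
    unfolding V by (rule smooth_U_sum_derivs(1)) (rule h(1)[OF that])
  define T where "T = (\<lambda>f x. deriv_U m f x + (\<Sum>i = 1..m - 1. k i / x * type_proj m i f x))"
  have key: "T (op_V m \<nu> f) x = op_V m \<nu> (deriv_U m f) x"
    if f: "f \<in> smooth_U m" and x: "x \<in> lines m" "x \<noteq> 0" for f x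
  proof -
    define f' where "f' = deriv_U m f"
    have f': "f' \<in> smooth_U m" unfolding f'_def by (rule smooth_U_deriv[OF f])
    \<comment> \<open>The image under T(k) of the component of type j.\<close>
    define t where "t = (\<lambda>j. deriv_U m (h f j) x + (if j < m then k j / x * h f j x else 0))"
    have "deriv_U m (op_V m \<nu> f) x = (\<Sum>j=1..m. deriv_U m (h f j) x)"
      using smooth_U_sum_derivs(2)[of "{1..m}" "h f" m, OF h(1)[OF f] x(1), of 1] unfolding V by simp
    moreover have "(\<Sum>i=1..m-1. k i / x * type_proj m i (op_V m \<nu> f) x) = (\<Sum>j=1..m. if j < m then k j / x * h f j x else 0)"
    proof -
      have "type_proj m i (op_V m \<nu> f) x = h f i x" if i: "i \<in> {1..m - 1}" for i
      proof -
        have "type_proj m i (op_V m \<nu> f) x = (\<Sum>j=1..m. type_proj m i (h f j) x)"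
          unfolding type_proj_lessThan[OF m] V sum_divide_distrib sum_distrib_left
          by (rule sum.swap)
        also have "\<dots> = (\<Sum>j=1..m. if i = j then h f j x else 0)"
          by (intro sum.cong refl type_proj_of_typed[OF h(2)[OF f] x(1) i])
        finally show ?thesis using i m by (auto simp: le_diff_conv)
      qed
      then have "(\<Sum>i=1..m-1. k i / x * type_proj m i (op_V m \<nu> f) x) = (\<Sum>i=1..m-1. k i / x * h f i x)"
        by (intro sum.cong) auto
      also have "\<dots> = (\<Sum>j=1..m. if j < m then k j / x * h f j x else 0)"
        by (rule sum.mono_neutral_cong_left) auto
      finally show ?thesis .
    qed
    ultimately have T: "T (op_V m \<nu> f) x = (\<Sum>j=1..m. t j)"
      by (simp add: T_def t_def sum.distrib)
    \<comment> \<open>The component of type j of V f' comes from the component of type j + 1 of f.\<close>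
    have step: "h f' j x = t (Suc j)" if j: "j \<in> {1..<m}" for j
    proof -
      define q where "q = type_proj m (Suc j) f"
      have q: "q \<in> smooth_U m" "typed m (Suc j) q"
        unfolding q_def by (intro type_proj_smooth f, intro type_proj_typed m)
      have pq: "type_proj m j f' y = deriv_U m q y" if "y \<in> lines m" for y
        unfolding q_def f'_def by (rule type_proj_deriv[OF f that, symmetric])
      have Ipq: "integral_0 (type_proj m j f') y = q y - q 0" if "y \<in> lines m" for y
        using integral_0_cong[OF that pq] integral_0_deriv[OF q(1) that] by simp
      show ?thesis
      proof (cases "Suc j = m")
        case True
        \<comment> \<open>Here q' and q differ by the constant q(0), but have the same derivative.\<close>
        define q' where "q' = integral_0 (type_proj m j f')"
        have "m - j = 1" using True by simp
        then have g': "g f' j = q'" by (simp add: g_def q'_def)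
        have gm: "g f m = q" using True by (simp add: g_def q_def)
        have q's: "q' \<in> smooth_U m" unfolding q'_def by (intro integral_0_smooth(1) type_proj_smooth f')
        have dq': "deriv_U m q' y = deriv_U m q y" if "y \<in> lines m" for y
          unfolding q'_def using integral_0_smooth(2)[OF type_proj_smooth[OF f'] that] pq[OF that] by simp
        have "h f' j x = deriv_U m (op_R m \<nu> q') x"
          using True by (simp add: h_def g' op_A_pred)
        also have "\<dots> = deriv_U m (op_R m \<nu> q) x"
          unfolding R_deriv[OF q's x(1)] R_deriv[OF q(1) x(1)] by (rule avg_cong[OF x(1) dq'])
        finally show ?thesis using True by (simp add: t_def h_def gm op_A_top)
      next
        case False
        then have j': "Suc j < m" using j by simp
        have q0: "q 0 = 0" using typed_zero[OF q(2)] j' by simp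
        have "g f' j y = g f (Suc j) y" if "y \<in> lines m" for y
        proof -
          have "m - j = Suc (m - Suc j)" using j' by simp
          then have "g f' j y = (integral_0 ^^ (m - Suc j)) (integral_0 (type_proj m j f')) y"
            unfolding g_def by (simp only: funpow_Suc_right o_apply)
          also have "\<dots> = (integral_0 ^^ (m - Suc j)) q y"
            by (rule integral_0_pow_cong[OF _ that]) (simp add: Ipq q0)
          finally show ?thesis by (simp only: g_def q_def)
        qed
        then have "h f' j x = op_A m \<nu> j (op_R m \<nu> (g f (Suc j))) x"
          unfolding h_def using j by (intro op_A_cong R_cong x(1)) auto
        also have "\<dots> = bessel_factor m (k (Suc j)) (h f (Suc j)) x"
          unfolding op_A_step[OF j'] using assms(3)[of "Suc j"] j' by (simp add: h_def)
        also have "\<dots> = t (Suc j)"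
          using j' x(2) by (simp add: t_def bessel_factor_def extend_0_def)
        finally show ?thesis .
      qed
    qed
    \<comment> \<open>Type 1 is sent to type 0, that is, to type m: this is the relation between R and the m-th derivative.\<close>
    have wrap: "h f' m x = t 1"
    proof -
      have m1: "1 \<in> {1..m}" "1 < m" using assms(1) by auto
      define G where "G = g f 1"
      have G: "G \<in> smooth_U m" "typed m m G" unfolding G_def by (rule g[OF f m1(1)])+
      have "h f' m x = op_R m \<nu> (type_proj m m f') x"
        by (simp add: h_def op_A_top g_def)
      also have "\<dots> = op_R m \<nu> (derivs m m G) x"
      proof (rule R_cong[OF _ x(1)])
        fix y assume y: "y \<in> lines m"
        have "type_proj m m f' y = deriv_U m (type_proj m (Suc 0) f) y"
          unfolding type_proj_m[OF m] f'_def by (rule type_proj_deriv[OF f y, symmetric])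
        moreover have "derivs m m G y = derivs m 1 (type_proj m 1 f) y"
          using integral_0_pow_smooth(2)[OF type_proj_smooth[OF f] y, of "m - 1" 1] m1(2) by (simp add: G_def g_def)
        ultimately show "type_proj m m f' y = derivs m m G y" by simp
      qed
      finally have "x ^ m * h f' m x = op_R m \<nu> (eulers m (map (\<lambda>k. of_nat m * \<nu> k) [1..<m] @ [0]) G) x"
        using op_R_intertwining[OF assms(1,2) G x] by simp
      also have "\<dots> = eulers m (map (\<lambda>k. of_nat m * \<nu> k) [1..<m] @ [0]) (op_R m \<nu> G) x"
        unfolding op_R_eq_avg by (rule eulers_avg[OF w unit_scale_root G(1) x(1), symmetric])
      also have "\<dots> = euler m (of_nat m * \<nu> 1) (eulers m (map (\<lambda>k. of_nat m * \<nu> k) [Suc 1..<m] @ [0]) (op_R m \<nu> G)) x"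
        using m1(2) by (simp add: upt_conv_Cons)
      also have "\<dots> = euler m (of_nat m * \<nu> 1) (\<lambda>y. y ^ (m - 1) * h f 1 y) x"
        using op_A_typed[OF F[OF f m1(1)] order_refl m1(2), of \<nu>]
        by (intro euler_cong[OF _ x(1)]) (simp add: h_def G_def)
      also have "\<dots> = x ^ Suc (m - 1) * (deriv_U m (h f 1) x + (of_nat m * \<nu> 1 + of_nat (m - 1)) / x * h f 1 x)"
        by (rule euler_power_mult[OF h(1)[OF f m1(1)] x])
      also have "\<dots> = x ^ m * t 1"
        using assms(3)[of 1] m1(2) by (simp add: t_def of_nat_diff)
      finally show ?thesis using x(2) by simp
    qed
    have "op_V m \<nu> f' x = (\<Sum>j\<in>{1..<m}. h f' j x) + h f' m x"
    proof -
      have "{1..m} = insert m {1..<m}" using m by auto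
      then show ?thesis unfolding V by (simp add: add.commute)
    qed
    also have "\<dots> = (\<Sum>j\<in>{1..<m}. t (Suc j)) + t 1"
      using step wrap by simp
    also have "(\<Sum>j\<in>{1..<m}. t (Suc j)) = (\<Sum>j\<in>{Suc 1..<Suc m}. t j)"
      by (rule sum.shift_bounds_Suc_ivl[symmetric])
    also have "(\<Sum>j\<in>{Suc 1..<Suc m}. t j) + t 1 = (\<Sum>j=1..m. t j)"
    proof -
      have "{1..m} = insert 1 {Suc 1..<Suc m}" using m by auto
      then show ?thesis by (simp add: add.commute)
    qed
    finally show ?thesis unfolding T f'_def[symmetric] by simp
  qed
  show ?thesis
  proof (intro ballI conjI)
    fix f assume f: "f \<in> smooth_U m"
    show "op_V m \<nu> f \<in> smooth_U m" by (rule V_smooth[OF f])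
    fix x assume x: "x \<in> lines m"
    have T: "dunkl_T m k (op_V m \<nu> f) = extend_0 m (T (op_V m \<nu> f))"
      by (simp add: dunkl_T_def T_def)
    show "dunkl_T m k (op_V m \<nu> f) x = op_V m \<nu> (deriv_U m f) x"
    proof (cases "x = 0")
      case True
      \<comment> \<open>At 0 the left-hand side is a limit by definition, and the right-hand side is continuous.\<close>
      have "Lim (at 0 within lines m) (T (op_V m \<nu> f)) = Lim (at 0 within lines m) (op_V m \<nu> (deriv_U m f))"
        by (rule Lim_lines_cong) (rule key[OF f])
      also have "\<dots> = op_V m \<nu> (deriv_U m f) 0"
        using smooth_U_continuous[OF V_smooth[OF smooth_U_deriv[OF f]]] x True unfolding continuous_on_def
        by (intro tendsto_Lim at_within_lines_nontrivial) auto
      finally show ?thesis unfolding T using True by (simp add: extend_0_def)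
    next
      case False
      then show ?thesis unfolding T using key[OF f x] by (simp add: extend_0_def)
    qed
  qed
qed

end
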